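(* For any $\alpha<2-\sqrt2$ and $C_1>2$ there exists $\varepsilon>0$ such that for all sufficiently small $\rho>0$ and all $\lambda$ with $$C_1\sqrt{\tfrac1\rho\log\tfrac1\rho}<\lambda<\Big(\tfrac1\rho\Big)^{\alpha},$$ the planted submatrix problem with sparsity $\rho$ and signal-to-noise ratio $\lambda$ has the $\varepsilon$-overlap gap property.
   Context: For $\rho\in(0,1)$ and $q\in[0,\rho]$ let $N\rho_N$ and $Nq_N$ be nearest integers to $N\rho$ and $Nq$ (ties broken so that $q_N\le\rho_N$). Let $\Sigma_N(r)=\{x\in\{0,1\}^N:\sum_ix_i=Nr\}$. Planted submatrix model: $A=\frac\lambda Nvv^T+W$ with $v\in\Sigma_N(\rho_N)$, $\lambda>0$, and $W$ symmetric with independent centered Gaussian entries on and above the diagonal, of variance $1/N$ off the diagonal and $2/N$ on it. Let $H_N(x)=(x,Wx)$ and $$E_N(q_N;\rho_N,\lambda)=\frac1N\max_{x\in\Sigma_N(\rho_N),\,(x,v)=Nq_N}H_N(x)+\lambda q_N^2 .$$ The constrained energy is $E(q;\rho,\lambda)=\lim_{N\to\infty}E_N(q_N;\rho_N,\lambda)$; this limit exists almost surely and is deterministic. $\varepsilon$-overlap gap property ($\varepsilon>0$): there exist three points $w<x<y<\rho$ (in $[0,\rho]$) such that (1) $w<\rho^2<x$ and $y<\rho^{1+\varepsilon}$; (2) $\max\{E(w;\rho,\lambda),E(y;\rho,\lambda)\}<E(x;\rho,\lambda)$; (3) $\sup_{q\in(w,\varepsilon\rho]}E(q;\rho,\lambda)<\sup_{q\in[\varepsilon\rho,\rho]}E(q;\rho,\lambda)$.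 *)

theory Defs
  imports "HOL-Probability.Probability"
begin

text \<open>
  Vectors of dimension \<open>N\<close> are functions on the index set \<open>{..<N}\<close>, extensional outside of it, so
  that sets of 0/1-vectors are finite.
\<close>

text \<open>
  \<open>N * grid N r\<close> is the nearest integer to \<open>N * r\<close>. Rounding ties upwards makes \<open>grid N\<close> monotone,
  so that \<open>q \<le> \<rho>\<close> implies \<open>grid N q \<le> grid N \<rho>\<close>.
\<close>

definition grid :: "nat \<Rightarrow> real \<Rightarrow> real" where
  "grid N r = real_of_int (round (real N * r)) / real N"

definition Sparse :: "nat \<Rightarrow> real \<Rightarrow> (nat \<Rightarrow> real) set" where
  "Sparse N r = {x \<in> {..<N} \<rightarrow>\<^sub>E {0, 1}. (\<Sum>i<N. x i) = real N * r}"

definition ip :: "nat \<Rightarrow> (nat \<Rightarrow> real) \<Rightarrow> (nat \<Rightarrow> real) \<Rightarrow> real" where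
  "ip N x y = (\<Sum>i<N. x i * y i)"

text \<open>
  The planted submatrix model, for all sizes \<open>N\<close> at once: \<open>W N i j\<close> (\<open>i, j < N\<close>) are the entries
  of the noise matrix of size \<open>N\<close>, and \<open>v N\<close> is the planted vector. All noise matrices live
  on one probability space, but nothing is assumed about their joint law for different \<open>N\<close>.
  The observed matrix is \<open>A = (lam/N) v v\<^sup>T + W\<close>.
\<close>

locale planted_submatrix = prob_space M
  for M :: "'w measure" and W :: "nat \<Rightarrow> nat \<Rightarrow> nat \<Rightarrow> 'w \<Rightarrow> real"
    and v :: "nat \<Rightarrow> nat \<Rightarrow> real" and \<rho> lam :: real +
  assumes sparsity: "0 < \<rho>" "\<rho> < 1"
    and snr: "0 < lam"
    and planted: "\<And>N. v N \<in> Sparse N (grid N \<rho>)"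
    and W_sym: "\<And>N i j \<omega>. i < N \<Longrightarrow> j < N \<Longrightarrow> \<omega> \<in> space M \<Longrightarrow> W N i j \<omega> = W N j i \<omega>"
    and W_indep: "\<And>N. indep_vars (\<lambda>_. borel) (\<lambda>(i, j). W N i j) {(i, j). i \<le> j \<and> j < N}"
    and W_offdiag: "\<And>N i j. i < j \<Longrightarrow> j < N \<Longrightarrow>
          distributed M lborel (W N i j) (normal_density 0 (sqrt (1 / real N)))"
    and W_diag: "\<And>N i. i < N \<Longrightarrow>
          distributed M lborel (W N i i) (normal_density 0 (sqrt (2 / real N)))"

definition hamiltonian :: "nat \<Rightarrow> (nat \<Rightarrow> nat \<Rightarrow> real) \<Rightarrow> (nat \<Rightarrow> real) \<Rightarrow> real" where
  "hamiltonian N B x = ip N x (\<lambda>i. \<Sum>j<N. B i j * x j)"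

text \<open>
  The constrained energy at size \<open>N\<close> for the noise matrix \<open>B\<close> and the planted vector \<open>u\<close>, i.e.
  the maximum of \<open>(x, A x) / N\<close> over sparse vectors \<open>x\<close> with \<open>(x, u) / N =\<close> \<open>grid N q\<close>, for the matrix \<open>A\<close> built from them.
  For \<open>0 \<le> q \<le> \<rho> < 1/2\<close> and \<open>N\<close> large the maximum is over a nonempty finite set.
\<close>

definition energy_N ::
  "nat \<Rightarrow> (nat \<Rightarrow> nat \<Rightarrow> real) \<Rightarrow> (nat \<Rightarrow> real) \<Rightarrow> real \<Rightarrow> real \<Rightarrow> real \<Rightarrow> real" where
  "energy_N N B u \<rho> lam q =
     1 / real N * Max (hamiltonian N B ` {x \<in> Sparse N (grid N \<rho>). ip N x u = real N * grid N q})
     + lam * (grid N q)\<^sup>2"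

text \<open>The constrained energy \<open>E(q; \<rho>, lam)\<close>: the deterministic almost sure limit.\<close>

definition energy ::
  "'w measure \<Rightarrow> (nat \<Rightarrow> nat \<Rightarrow> nat \<Rightarrow> 'w \<Rightarrow> real) \<Rightarrow> (nat \<Rightarrow> nat \<Rightarrow> real)
    \<Rightarrow> real \<Rightarrow> real \<Rightarrow> real \<Rightarrow> real" where
  "energy M W v \<rho> lam q =
     (THE e. AE \<omega> in M.
        (\<lambda>N. energy_N N (\<lambda>i j. W N i j \<omega>) (v N) \<rho> lam q) \<longlonglongrightarrow> e)"

text \<open>Suprema are taken in the extended reals, where they always exist.\<close>

definition overlap_gap_property :: "real \<Rightarrow> real \<Rightarrow> (real \<Rightarrow> real) \<Rightarrow> bool" where
  "overlap_gap_property \<epsilon> \<rho> E \<longleftrightarrow>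
     (\<exists>w x y. 0 \<le> w \<and> w < x \<and> x < y \<and> y < \<rho> \<and>
        w < \<rho>\<^sup>2 \<and> \<rho>\<^sup>2 < x \<and> y < \<rho> powr (1 + \<epsilon>) \<and>
        max (E w) (E y) < E x \<and>
        (SUP q\<in>{w<..\<epsilon> * \<rho>}. ereal (E q)) < (SUP q\<in>{\<epsilon> * \<rho>..\<rho>}. ereal (E q)))"

end

theory Submission
  imports Defs
begin

text \<open>
  Write \<open>G q\<close> for the limiting maximum of the noise under the overlap constraint, so that
  \<open>E q = G q + lam * q\<^sup>2\<close>. The covariance \<open>2 N R\<^sup>2\<close> of the noise is convex in the overlap \<open>R\<close>, hence the
  Sudakov-Fernique inequality makes the mean maxima superadditive in \<open>N\<close> up to rounding, and \<open>G\<close> exists;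
  Gaussian concentration and Borel-Cantelli turn this into almost sure convergence.

  The noise does not know the planted vector. A maximiser over all sparse vectors therefore has overlap
  close to \<open>\<rho>\<^sup>2\<close>, so \<open>G\<close> is maximal near \<open>\<rho>\<^sup>2\<close>, and the signal term gives \<open>E 0 < E x\<close> for \<open>x\<close> slightly
  above \<open>\<rho>\<^sup>2\<close>. A field of strength \<open>\<rho>\<close> in the planted direction can be traded, one site at a time, for a
  shift of one row of the noise, whose change of measure has bounded cost. So such a field raises the mean
  maximum per site only by \<open>O(\<rho> powr (8/3))\<close>, which yields \<open>G y \<le> G x - \<rho> * y + O(\<rho> powr (8/3))\<close>. At
  \<open>y = \<rho> powr (8/5)\<close> this beats the gain \<open>lam * y\<^sup>2\<close>, since \<open>lam < \<rho> powr (- 3/5)\<close>.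

  Finally \<open>E \<rho> = lam * \<rho>\<^sup>2\<close>, and for \<open>q \<le> \<epsilon> * \<rho>\<close> a first moment bound gives
  \<open>E q \<le> 2 * \<rho> * sqrt (\<rho> * (1 + ln (1/\<rho>))) + lam * (\<epsilon> * \<rho>)\<^sup>2\<close>, which is smaller because \<open>C\<^sub>1 > 2\<close>.
\<close>

section \<open>Standard normal measures\<close>

text \<open>No formula for the limit is used: \<open>G\<close> is only ever compared with itself or
  bounded crudely. Around \<rho>^2 it is maximal up to \<open>8 * sqrt \<delta>\<close>, with
  \<delta> free, so \<open>x\<close> can be put so close to \<rho>^2 that this loss is less than
  \<open>lam * x\<^sup>2\<close>; this is why \<open>w = 0\<close> serves as left point.

  The exponents come from one balance. A given site is relevant to the maximum with probability
  about \<rho>; a bounded shift of its row multiplies this by a truncation level \<open>K\<close>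
  and leaves a remainder of order K^(-2), by a third moment of the density. Equality at K =
  \<rho>^(-1/3) gives \<rho>^(2/3) per site, hence the total error \<rho>^(8/3) at field strength
  \<rho>. The point \<open>y\<close> must then lie well above \<rho>^(5/3) and well below \<rho> /
  \<open>lam\<close>, which is possible for \<alpha> < 2/3. Second moments would only reach \<alpha>
  < 1/2, short of 2 - sqrt 2.

  Maxima are not differentiable, so both the Gaussian comparison and the concentration bound work
  with finite steps whose accumulated errors vanish.\<close>

abbreviation std_normal :: "real measure" where
  "std_normal \<equiv> density lborel (\<lambda>x. ennreal (std_normal_density x))"

lemma prob_space_std_normal: "prob_space std_normal"
  by (rule prob_space_normal_density) simp

lemma std_normal_has_bochner_integral_exp:
  "has_bochner_integral std_normal (\<lambda>x. exp (s * x)) (exp (s\<^sup>2 / 2))"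
proof -
  have eq: "std_normal_density x * exp (s * x) = exp (s\<^sup>2 / 2) * normal_density s 1 x" for x
    by (simp add: normal_density_def exp_add[symmetric] field_simps power2_eq_square)
  have "has_bochner_integral lborel (\<lambda>x. exp (s\<^sup>2 / 2) * normal_density s 1 x) (exp (s\<^sup>2 / 2) * 1)"
    by (intro has_bochner_integral_mult_right) (simp add: has_bochner_integral_iff)
  then show ?thesis
    by (subst has_bochner_integral_density) (simp_all add: eq)
qed

lemma nn_integral_std_normal_affine:
  fixes f :: "real \<Rightarrow> ennreal"
  assumes [measurable]: "f \<in> borel_measurable borel" and "c \<noteq> 0"
  shows "(\<integral>\<^sup>+x. f x \<partial>std_normal)
    = \<bar>c\<bar> * (\<integral>\<^sup>+x. ennreal (std_normal_density (t + c * x)) * f (t + c * x) \<partial>lborel)"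
  using nn_integral_real_affine[of "\<lambda>x. ennreal (std_normal_density x) * f x" c t] assms
  by (simp add: nn_integral_density)

text \<open>One-dimensional Cameron-Martin formula: completing the square shows that a translation
  is paid for by an exponential density. It is the induction step for product measures.\<close>

lemma nn_integral_std_normal_shift:
  fixes f :: "real \<Rightarrow> ennreal"
  assumes [measurable]: "f \<in> borel_measurable borel"
  shows "(\<integral>\<^sup>+x. f (x + t) \<partial>std_normal) = (\<integral>\<^sup>+x. f x * ennreal (exp (t * x - t\<^sup>2 / 2)) \<partial>std_normal)"
proof -
  have eq: "std_normal_density (t + x) * exp (t * (t + x) - t\<^sup>2 / 2) = std_normal_density x" for x
    by (simp add: normal_density_def exp_add[symmetric] field_simps power2_eq_square)
  have "(\<integral>\<^sup>+x. f x * ennreal (exp (t * x - t\<^sup>2 / 2)) \<partial>std_normal)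
    = (\<integral>\<^sup>+x. ennreal (std_normal_density (t + 1 * x))
          * (f (t + 1 * x) * ennreal (exp (t * (t + 1 * x) - t\<^sup>2 / 2))) \<partial>lborel)"
    by (subst nn_integral_std_normal_affine[of _ 1 t]) simp_all
  also have "\<dots> = (\<integral>\<^sup>+x. ennreal (std_normal_density x) * f (x + t) \<partial>lborel)"
  proof (rule nn_integral_cong)
    fix x
    have "ennreal (std_normal_density (t + x)) * (f (t + x) * ennreal (exp (t * (t + x) - t\<^sup>2 / 2)))
       = ennreal (std_normal_density (t + x) * exp (t * (t + x) - t\<^sup>2 / 2)) * f (t + x)"
      by (simp add: ennreal_mult mult_ac)
    then show "ennreal (std_normal_density (t + 1 * x))
        * (f (t + 1 * x) * ennreal (exp (t * (t + 1 * x) - t\<^sup>2 / 2)))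
      = ennreal (std_normal_density x) * f (x + t)"
      unfolding eq by (simp add: add.commute)
  qed
  also have "\<dots> = (\<integral>\<^sup>+x. f (x + t) \<partial>std_normal)"
    by (simp add: nn_integral_density)
  finally show ?thesis ..
qed

text \<open>The joint density depends on \<open>x\<^sup>2 + y\<^sup>2\<close> only, so rotation
  invariance of Lebesgue measure remains. It is built from one-dimensional affine substitutions and
  exchanges of the order of integration.\<close>

lemma nn_integral_std_normal_rotation:
  fixes f :: "real \<times> real \<Rightarrow> ennreal"
  assumes [measurable]: "f \<in> borel_measurable (borel \<Otimes>\<^sub>M borel)" and cs: "c\<^sup>2 + s\<^sup>2 = 1"
  shows "(\<integral>\<^sup>+x. \<integral>\<^sup>+y. f (c * x + s * y, c * y - s * x) \<partial>std_normal \<partial>std_normal)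
    = (\<integral>\<^sup>+x. \<integral>\<^sup>+y. f (x, y) \<partial>std_normal \<partial>std_normal)"
proof -
  interpret N: prob_space std_normal by (rule prob_space_std_normal)
  have LL: "pair_sigma_finite (lborel :: real measure) (lborel :: real measure)" ..
  note Fub = pair_sigma_finite.Fubini'[OF LL]
  have dens: "std_normal_density x * std_normal_density y = exp (- (x\<^sup>2 + y\<^sup>2) / 2) / (2 * pi)" for x y
    by (simp add: normal_density_def exp_add[symmetric] field_simps power2_eq_square)
  let ?d = "\<lambda>x y. ennreal (std_normal_density x) * ennreal (std_normal_density y)"
  have inv: "?d (c * x + s * y) (c * y - s * x) = ?d x y" for x y
  proof -
    have "(c * x + s * y)\<^sup>2 + (c * y - s * x)\<^sup>2 = (c\<^sup>2 + s\<^sup>2) * (x\<^sup>2 + y\<^sup>2)"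
      by (simp add: power2_eq_square algebra_simps)
    then show ?thesis by (simp add: ennreal_mult[symmetric] dens cs)
  qed
  have unfold2: "(\<integral>\<^sup>+x. \<integral>\<^sup>+y. g x y \<partial>std_normal \<partial>std_normal) = (\<integral>\<^sup>+x. \<integral>\<^sup>+y. ?d x y * g x y \<partial>lborel \<partial>lborel)"
    if [measurable]: "case_prod g \<in> borel_measurable (borel \<Otimes>\<^sub>M borel)" for g
  proof -
    have "(\<integral>\<^sup>+y. ?d x y * g x y \<partial>lborel) = ennreal (std_normal_density x) * (\<integral>\<^sup>+y. g x y \<partial>std_normal)" for x
      by (simp add: nn_integral_density nn_integral_cmult[symmetric] mult_ac)
    then show ?thesis by (simp add: nn_integral_density)
  qed
  let ?h = "\<lambda>x y. ?d x y * f (x, y)"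
  have key: "(\<integral>\<^sup>+x. \<integral>\<^sup>+y. ?h (c * x + s * y) (c * y - s * x) \<partial>lborel \<partial>lborel)
    = (\<integral>\<^sup>+x. \<integral>\<^sup>+y. ?h x y \<partial>lborel \<partial>lborel)"
  \<comment> \<open>The substitution for the second variable divides by \<open>c\<close>. Quarter
    turns, which exchange the axes up to sign, are therefore treated apart.\<close>
  proof (cases "c = 0")
    case True
    then have s: "\<bar>s\<bar> = 1" "s \<noteq> 0" using cs by (auto simp: power2_eq_1_iff)
    have "(\<integral>\<^sup>+x. \<integral>\<^sup>+y. ?h x y \<partial>lborel \<partial>lborel) = (\<integral>\<^sup>+y. \<integral>\<^sup>+x. ?h x y \<partial>lborel \<partial>lborel)"
      by (rule Fub[symmetric]) measurable
    also have "\<dots> = (\<integral>\<^sup>+x. \<integral>\<^sup>+z. ?h z (0 + (- s) * x) \<partial>lborel \<partial>lborel)"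
      by (subst nn_integral_real_affine[of _ "- s" 0]) (simp_all add: s)
    also have "\<dots> = (\<integral>\<^sup>+x. \<integral>\<^sup>+y. ?h (0 + s * y) (0 + (- s) * x) \<partial>lborel \<partial>lborel)"
    proof (rule nn_integral_cong)
      fix x
      show "(\<integral>\<^sup>+z. ?h z (0 + (- s) * x) \<partial>lborel) = (\<integral>\<^sup>+y. ?h (0 + s * y) (0 + (- s) * x) \<partial>lborel)"
        by (subst nn_integral_real_affine[of _ s 0]) (simp_all add: s)
    qed
    finally show ?thesis by (simp add: True)
  next
    \<comment> \<open>The second variable is substituted with \<open>u\<close> fixed, then the first
      one with \<open>y\<close> fixed; the two Jacobians \<open>1 / c\<close> and \<open>c\<close>
      cancel.\<close>
    case False
    have "(\<integral>\<^sup>+u. \<integral>\<^sup>+v. ?h u v \<partial>lborel \<partial>lborel)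
      = (\<integral>\<^sup>+u. \<integral>\<^sup>+y. \<bar>1 / c\<bar> * ?h u (- (s / c) * u + (1 / c) * y) \<partial>lborel \<partial>lborel)"
    proof (rule nn_integral_cong)
      fix u
      show "(\<integral>\<^sup>+v. ?h u v \<partial>lborel) = (\<integral>\<^sup>+y. \<bar>1 / c\<bar> * ?h u (- (s / c) * u + (1 / c) * y) \<partial>lborel)"
        by (subst nn_integral_real_affine[of _ "1 / c" "- (s / c) * u"])
           (simp_all add: False nn_integral_cmult)
    qed
    also have "\<dots> = (\<integral>\<^sup>+y. \<integral>\<^sup>+u. \<bar>1 / c\<bar> * ?h u (- (s / c) * u + (1 / c) * y) \<partial>lborel \<partial>lborel)"
      by (rule Fub[symmetric]) measurable
    also have "\<dots> = (\<integral>\<^sup>+y. \<integral>\<^sup>+x. ?h (c * x + s * y) (c * y - s * x) \<partial>lborel \<partial>lborel)"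
    proof (rule nn_integral_cong)
      fix y
      have eq: "- (s / c) * (s * y + c * x) + (1 / c) * y = c * y - s * x" for x
      proof -
        have "- (s / c) * (s * y + c * x) + (1 / c) * y = (1 - s\<^sup>2) * y / c - s * x"
          using False by (simp add: field_simps power2_eq_square)
        also have "1 - s\<^sup>2 = c * c" using cs by (simp add: power2_eq_square algebra_simps)
        finally show ?thesis using False by simp
      qed
      have "(\<integral>\<^sup>+u. \<bar>1 / c\<bar> * ?h u (- (s / c) * u + (1 / c) * y) \<partial>lborel)
        = \<bar>c\<bar> * (\<integral>\<^sup>+x. \<bar>1 / c\<bar> * ?h (s * y + c * x) (- (s / c) * (s * y + c * x) + (1 / c) * y) \<partial>lborel)"
        by (rule nn_integral_real_affine) (use False in simp_all)
      also have "\<dots> = \<bar>c\<bar> * (\<bar>1 / c\<bar> * (\<integral>\<^sup>+x. ?h (c * x + s * y) (c * y - s * x) \<partial>lborel))"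
        unfolding eq by (subst nn_integral_cmult) (simp_all add: add.commute)
      also have "\<dots> = (\<integral>\<^sup>+x. ?h (c * x + s * y) (c * y - s * x) \<partial>lborel)"
        using False by (simp add: mult.assoc[symmetric] ennreal_mult[symmetric])
      finally show "(\<integral>\<^sup>+u. \<bar>1 / c\<bar> * ?h u (- (s / c) * u + (1 / c) * y) \<partial>lborel)
        = (\<integral>\<^sup>+x. ?h (c * x + s * y) (c * y - s * x) \<partial>lborel)" .
    qed
    also have "\<dots> = (\<integral>\<^sup>+x. \<integral>\<^sup>+y. ?h (c * x + s * y) (c * y - s * x) \<partial>lborel \<partial>lborel)"
      by (rule Fub) measurable
    finally show ?thesis ..
  qed
  then show ?thesis
    by (subst (1 2) unfold2) (simp_all add: inv)
qed

section \<open>Product Gaussian measures: rotations, translations, moments\<close>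

definition gauss :: "'i set \<Rightarrow> ('i \<Rightarrow> real) measure" where
  "gauss I = (\<Pi>\<^sub>M i\<in>I. std_normal)"

definition lin :: "'i set \<Rightarrow> ('i \<Rightarrow> real) \<Rightarrow> ('i \<Rightarrow> real) \<Rightarrow> real" where
  "lin I a g = (\<Sum>i\<in>I. a i * g i)"

lemma sets_gauss [measurable_cong]: "sets (gauss I) = sets (\<Pi>\<^sub>M i\<in>I. borel)"
  unfolding gauss_def by (intro sets_PiM_cong) simp_all

lemma measurable_gauss: "measurable (gauss I) N = measurable (\<Pi>\<^sub>M i\<in>I. borel) N"
  by (rule measurable_cong_sets[OF sets_gauss refl])

lemma space_gauss: "space (gauss I) = extensional I"
  by (simp add: gauss_def space_PiM PiE_def)

interpretation std_normal: prob_space std_normal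
  by (rule prob_space_std_normal)

interpretation std_normals: product_sigma_finite "\<lambda>_. std_normal"
  by standard

lemma prob_space_gauss: "prob_space (gauss I)"
  unfolding gauss_def by (intro prob_space_PiM prob_space_std_normal)

lemma lin_measurable [measurable]: "lin I a \<in> borel_measurable (gauss I)"
  unfolding lin_def by measurable

lemma lin_cong: "(\<And>i. i \<in> I \<Longrightarrow> g i = h i) \<Longrightarrow> lin I a g = lin I a h"
  by (simp add: lin_def)

text \<open>Both components are kept. The first alone expresses Gaussian convolution, but the path
  of small rotations used for concentration recovers an earlier state from both components of a
  later one.\<close>

definition gauss_rot ::
  "'i set \<Rightarrow> real \<Rightarrow> real \<Rightarrow> ('i \<Rightarrow> real) \<times> ('i \<Rightarrow> real) \<Rightarrow> ('i \<Rightarrow> real) \<times> ('i \<Rightarrow> real)" where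
  "gauss_rot I c s = (\<lambda>(x, y). (\<lambda>i\<in>I. c * x i + s * y i, \<lambda>i\<in>I. c * y i - s * x i))"

lemma gauss_rot_measurable [measurable]:
  "gauss_rot I c s \<in> gauss I \<Otimes>\<^sub>M gauss I \<rightarrow>\<^sub>M gauss I \<Otimes>\<^sub>M gauss I"
  unfolding gauss_rot_def by measurable

text \<open>Induction over the coordinates: the planar rotation handles the new coordinate pair. The
  function \<open>f\<close> is arbitrary because the inner double integral over that pair becomes
  the function to which the induction hypothesis is applied.\<close>

lemma nn_integral_gauss_rot:
  assumes "finite I" "c\<^sup>2 + s\<^sup>2 = 1" and "f \<in> borel_measurable (gauss I \<Otimes>\<^sub>M gauss I)"
  shows "(\<integral>\<^sup>+x. \<integral>\<^sup>+y. f (gauss_rot I c s (x, y)) \<partial>gauss I \<partial>gauss I)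
    = (\<integral>\<^sup>+x. \<integral>\<^sup>+y. f (x, y) \<partial>gauss I \<partial>gauss I)"
  using assms(1,3)
proof (induction I arbitrary: f rule: finite_induct)
  case empty
  have eq: "x = (\<lambda>_. undefined)" if "x \<in> space (gauss {})" for x :: "'a \<Rightarrow> real"
    using that by (simp add: space_gauss)
  show ?case
    proof (intro nn_integral_cong)
    fix x y :: "'a \<Rightarrow> real" assume "x \<in> space (gauss {})" "y \<in> space (gauss {})"
    from eq[OF this(1)] eq[OF this(2)] show "f (gauss_rot {} c s (x, y)) = f (x, y)"
      by (simp add: gauss_rot_def restrict_def)
  qed
next
  case (insert i I)
  note [measurable] = insert.prems
  have f': "f \<in> borel_measurable (Pi\<^sub>M (insert i I) (\<lambda>_. borel) \<Otimes>\<^sub>M Pi\<^sub>M (insert i I) (\<lambda>_. borel))"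
    using insert.prems measurable_cong_sets[OF sets_pair_measure_cong[OF sets_gauss sets_gauss] refl] by blast
  note [measurable] = f'
  interpret G: prob_space "gauss I" by (rule prob_space_gauss)
  have GN: "pair_sigma_finite (gauss I) std_normal" ..
  have ins: "(\<integral>\<^sup>+x. g x \<partial>gauss (insert i I)) = (\<integral>\<^sup>+x. \<integral>\<^sup>+u. g (x(i := u)) \<partial>std_normal \<partial>gauss I)"
    if [measurable]: "g \<in> borel_measurable (Pi\<^sub>M (insert i I) (\<lambda>_. borel))" for g :: "('a \<Rightarrow> real) \<Rightarrow> ennreal"
    unfolding gauss_def
    by (rule std_normals.product_nn_integral_insert) (use insert.hyps in simp_all)
  have two: "(\<integral>\<^sup>+x. \<integral>\<^sup>+y. g x y \<partial>gauss (insert i I) \<partial>gauss (insert i I))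
    = (\<integral>\<^sup>+x. \<integral>\<^sup>+y. \<integral>\<^sup>+u. \<integral>\<^sup>+v. g (x(i := u)) (y(i := v)) \<partial>std_normal \<partial>std_normal \<partial>gauss I \<partial>gauss I)"
    if [measurable]: "case_prod g \<in> borel_measurable (Pi\<^sub>M (insert i I) (\<lambda>_. borel) \<Otimes>\<^sub>M Pi\<^sub>M (insert i I) (\<lambda>_. borel))"
    for g :: "('a \<Rightarrow> real) \<Rightarrow> ('a \<Rightarrow> real) \<Rightarrow> ennreal"
  proof -
    have "(\<integral>\<^sup>+x. \<integral>\<^sup>+y. g x y \<partial>gauss (insert i I) \<partial>gauss (insert i I))
      = (\<integral>\<^sup>+x. \<integral>\<^sup>+y. \<integral>\<^sup>+v. g x (y(i := v)) \<partial>std_normal \<partial>gauss I \<partial>gauss (insert i I))"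
      proof (intro nn_integral_cong ins)
        fix x assume "x \<in> space (gauss (insert i I))"
        then have [measurable]: "x \<in> space (Pi\<^sub>M (insert i I) (\<lambda>_. borel))"
          by (simp add: space_gauss space_PiM PiE_def)
        show "g x \<in> borel_measurable (Pi\<^sub>M (insert i I) (\<lambda>_. borel))" by measurable
      qed
    also have "\<dots> = (\<integral>\<^sup>+x. \<integral>\<^sup>+u. \<integral>\<^sup>+y. \<integral>\<^sup>+v. g (x(i := u)) (y(i := v)) \<partial>std_normal \<partial>gauss I \<partial>std_normal \<partial>gauss I)"
      by (rule ins) measurable
    also have "\<dots> = (\<integral>\<^sup>+x. \<integral>\<^sup>+y. \<integral>\<^sup>+u. \<integral>\<^sup>+v. g (x(i := u)) (y(i := v)) \<partial>std_normal \<partial>std_normal \<partial>gauss I \<partial>gauss I)"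
    proof (rule nn_integral_cong)
      fix x assume [measurable]: "x \<in> space (gauss I)"
      then have [measurable]: "x \<in> space (Pi\<^sub>M I (\<lambda>_. borel))" by (simp add: space_gauss space_PiM PiE_def)
      show "(\<integral>\<^sup>+u. \<integral>\<^sup>+y. \<integral>\<^sup>+v. g (x(i := u)) (y(i := v)) \<partial>std_normal \<partial>gauss I \<partial>std_normal)
         = (\<integral>\<^sup>+y. \<integral>\<^sup>+u. \<integral>\<^sup>+v. g (x(i := u)) (y(i := v)) \<partial>std_normal \<partial>std_normal \<partial>gauss I)"
        by (rule pair_sigma_finite.Fubini'[OF GN]) measurable
    qed
    finally show ?thesis .
  qed
  have rot: "gauss_rot (insert i I) c s (x(i := u), y(i := v))
     = ((fst (gauss_rot I c s (x, y)))(i := c * u + s * v), (snd (gauss_rot I c s (x, y)))(i := c * v - s * u))"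
    for x y u v
    using insert.hyps by (auto simp: gauss_rot_def fun_eq_iff restrict_def)
  let ?F = "\<lambda>p. \<integral>\<^sup>+u. \<integral>\<^sup>+v. f ((fst p)(i := u), (snd p)(i := v)) \<partial>std_normal \<partial>std_normal"
  have Fm: "?F \<in> borel_measurable (gauss I \<Otimes>\<^sub>M gauss I)"
    by measurable
  have "(\<integral>\<^sup>+x. \<integral>\<^sup>+y. f (gauss_rot (insert i I) c s (x, y)) \<partial>gauss (insert i I) \<partial>gauss (insert i I))
    = (\<integral>\<^sup>+x. \<integral>\<^sup>+y. \<integral>\<^sup>+u. \<integral>\<^sup>+v. f (gauss_rot (insert i I) c s (x(i := u), y(i := v)))
         \<partial>std_normal \<partial>std_normal \<partial>gauss I \<partial>gauss I)"
  proof (rule two)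
    have [measurable]: "gauss_rot (insert i I) c s \<in> (Pi\<^sub>M (insert i I) (\<lambda>_. borel) \<Otimes>\<^sub>M Pi\<^sub>M (insert i I) (\<lambda>_. borel))
        \<rightarrow>\<^sub>M (Pi\<^sub>M (insert i I) (\<lambda>_. borel) \<Otimes>\<^sub>M Pi\<^sub>M (insert i I) (\<lambda>_. borel))"
      unfolding gauss_rot_def by measurable
    show "(\<lambda>(x, y). f (gauss_rot (insert i I) c s (x, y)))
      \<in> borel_measurable (Pi\<^sub>M (insert i I) (\<lambda>_. borel) \<Otimes>\<^sub>M Pi\<^sub>M (insert i I) (\<lambda>_. borel))"
      by measurable
  qed
  also have "\<dots> = (\<integral>\<^sup>+x. \<integral>\<^sup>+y. ?F (gauss_rot I c s (x, y)) \<partial>gauss I \<partial>gauss I)"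
  proof (rule nn_integral_cong, rule nn_integral_cong)
    fix x y assume xy: "x \<in> space (gauss I)" "y \<in> space (gauss I)"
    obtain x' y' where xy': "gauss_rot I c s (x, y) = (x', y')" by force
    have [measurable]: "x' \<in> space (Pi\<^sub>M I (\<lambda>_. borel))" "y' \<in> space (Pi\<^sub>M I (\<lambda>_. borel))"
      using xy' by (auto simp: gauss_rot_def space_PiM)
    show "(\<integral>\<^sup>+u. \<integral>\<^sup>+v. f (gauss_rot (insert i I) c s (x(i := u), y(i := v))) \<partial>std_normal \<partial>std_normal)
       = ?F (gauss_rot I c s (x, y))"
      unfolding rot xy' fst_conv snd_conv
      using nn_integral_std_normal_rotation[of "\<lambda>p. f (x'(i := fst p), y'(i := snd p))" c s, OF _ assms(2)]
      unfolding fst_conv snd_conv by (rule meta_mp) measurable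
  qed
  also have "\<dots> = (\<integral>\<^sup>+x. \<integral>\<^sup>+y. ?F (x, y) \<partial>gauss I \<partial>gauss I)"
    by (rule insert.IH[OF Fm])
  also have "\<dots> = (\<integral>\<^sup>+x. \<integral>\<^sup>+y. f (x, y) \<partial>gauss (insert i I) \<partial>gauss (insert i I))"
    unfolding fst_conv snd_conv by (rule two[symmetric]) measurable
  finally show ?case .
qed

lemma distr_gauss_rot:
  assumes "finite I" "c\<^sup>2 + s\<^sup>2 = 1"
  shows "distr (gauss I \<Otimes>\<^sub>M gauss I) (gauss I \<Otimes>\<^sub>M gauss I) (gauss_rot I c s) = gauss I \<Otimes>\<^sub>M gauss I"
proof (rule measure_eqI)
  interpret G: prob_space "gauss I" by (rule prob_space_gauss)
  fix A assume "A \<in> sets (distr (gauss I \<Otimes>\<^sub>M gauss I) (gauss I \<Otimes>\<^sub>M gauss I) (gauss_rot I c s))"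
  then have [measurable]: "A \<in> sets (gauss I \<Otimes>\<^sub>M gauss I)" by simp
  have "emeasure (distr (gauss I \<Otimes>\<^sub>M gauss I) (gauss I \<Otimes>\<^sub>M gauss I) (gauss_rot I c s)) A
    = (\<integral>\<^sup>+p. indicator A (gauss_rot I c s p) \<partial>(gauss I \<Otimes>\<^sub>M gauss I))"
    by (subst nn_integral_distr[symmetric, where T = "gauss_rot I c s" and M' = "gauss I \<Otimes>\<^sub>M gauss I"]) auto
  also have "\<dots> = (\<integral>\<^sup>+x. \<integral>\<^sup>+y. indicator A (gauss_rot I c s (x, y)) \<partial>gauss I \<partial>gauss I)"
    by (rule G.nn_integral_fst[symmetric]) measurable
  also have "\<dots> = (\<integral>\<^sup>+x. \<integral>\<^sup>+y. indicator A (x, y) \<partial>gauss I \<partial>gauss I)"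
    by (rule nn_integral_gauss_rot[OF assms]) measurable
  also have "\<dots> = (\<integral>\<^sup>+p. indicator A p \<partial>(gauss I \<Otimes>\<^sub>M gauss I))"
    by (rule G.nn_integral_fst) measurable
  finally show "emeasure (distr (gauss I \<Otimes>\<^sub>M gauss I) (gauss I \<Otimes>\<^sub>M gauss I) (gauss_rot I c s)) A
    = emeasure (gauss I \<Otimes>\<^sub>M gauss I) A"
    by simp
qed simp

text \<open>Cameron-Martin formula in finite dimension. The density factorises over the coordinates,
  so each induction step is the one-dimensional formula.\<close>

lemma nn_integral_gauss_shift:
  assumes "finite I" and "f \<in> borel_measurable (gauss I)"
  shows "(\<integral>\<^sup>+x. f (\<lambda>i\<in>I. x i + r i) \<partial>gauss I)
    = (\<integral>\<^sup>+x. f x * ennreal (exp (lin I r x - (\<Sum>i\<in>I. (r i)\<^sup>2) / 2)) \<partial>gauss I)"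
  using assms
proof (induction I arbitrary: f rule: finite_induct)
  case empty
  have eq: "x = (\<lambda>_. undefined)" if "x \<in> space (gauss {})" for x :: "'a \<Rightarrow> real"
    using that by (simp add: space_gauss)
  show ?case
    proof (intro nn_integral_cong)
    fix x :: "'a \<Rightarrow> real" assume "x \<in> space (gauss {})"
    from eq[OF this] show "f (\<lambda>i\<in>{}. x i + r i) = f x * ennreal (exp (lin {} r x - (\<Sum>i\<in>{}. (r i)\<^sup>2) / 2))"
      by (simp add: lin_def restrict_def)
  qed
next
  case (insert i I)
  have f' [measurable]: "f \<in> borel_measurable (Pi\<^sub>M (insert i I) (\<lambda>_. borel))"
    using insert.prems by (simp add: measurable_gauss)
  interpret G: prob_space "gauss I" by (rule prob_space_gauss)
  have ins: "(\<integral>\<^sup>+x. g x \<partial>gauss (insert i I)) = (\<integral>\<^sup>+x. \<integral>\<^sup>+u. g (x(i := u)) \<partial>std_normal \<partial>gauss I)"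
    if [measurable]: "g \<in> borel_measurable (Pi\<^sub>M (insert i I) (\<lambda>_. borel))" for g :: "('a \<Rightarrow> real) \<Rightarrow> ennreal"
    unfolding gauss_def
    by (rule std_normals.product_nn_integral_insert) (use insert.hyps in simp_all)
  have upd: "(\<lambda>j\<in>insert i I. (x(i := u)) j + r j) = (\<lambda>j\<in>I. x j + r j)(i := u + r i)" for x u
    by (auto simp: fun_eq_iff restrict_def)
  let ?Z = "\<lambda>x. ennreal (exp (lin I r x - (\<Sum>j\<in>I. (r j)\<^sup>2) / 2))"
  have Z: "ennreal (exp (lin (insert i I) r (x(i := u)) - (\<Sum>j\<in>insert i I. (r j)\<^sup>2) / 2))
    = ennreal (exp (r i * u - (r i)\<^sup>2 / 2)) * ?Z x" for x u
  proof -
    have "lin (insert i I) r (x(i := u)) = r i * u + lin I r x"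
      using insert.hyps by (auto simp: lin_def intro!: sum.cong)
    then have "exp (lin (insert i I) r (x(i := u)) - (\<Sum>j\<in>insert i I. (r j)\<^sup>2) / 2)
       = exp (r i * u - (r i)\<^sup>2 / 2) * exp (lin I r x - (\<Sum>j\<in>I. (r j)\<^sup>2) / 2)"
      using insert.hyps by (simp add: exp_add[symmetric] field_simps)
    then show ?thesis by (simp add: ennreal_mult)
  qed
  let ?F = "\<lambda>x. \<integral>\<^sup>+u. f (x(i := u + r i)) \<partial>std_normal"
  have Fm: "?F \<in> borel_measurable (gauss I)" by measurable
  have [measurable]: "lin (insert i I) r \<in> borel_measurable (Pi\<^sub>M (insert i I) (\<lambda>_. borel))"
    unfolding lin_def by measurable
  have "(\<integral>\<^sup>+x. f (\<lambda>i\<in>insert i I. x i + r i) \<partial>gauss (insert i I))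
    = (\<integral>\<^sup>+x. \<integral>\<^sup>+u. f (\<lambda>j\<in>insert i I. (x(i := u)) j + r j) \<partial>std_normal \<partial>gauss I)"
    by (rule ins) measurable
  also have "\<dots> = (\<integral>\<^sup>+x. ?F x * ?Z x \<partial>gauss I)"
    unfolding upd by (rule insert.IH[OF Fm])
  also have "\<dots> = (\<integral>\<^sup>+x. \<integral>\<^sup>+u. f (x(i := u)) *
      ennreal (exp (lin (insert i I) r (x(i := u)) - (\<Sum>j\<in>insert i I. (r j)\<^sup>2) / 2)) \<partial>std_normal \<partial>gauss I)"
  proof (rule nn_integral_cong)
    fix x assume "x \<in> space (gauss I)"
    then have [measurable]: "x \<in> space (Pi\<^sub>M I (\<lambda>_. borel))" by (simp add: space_gauss space_PiM PiE_def)
    have "?F x = (\<integral>\<^sup>+u. f (x(i := u)) * ennreal (exp (r i * u - (r i)\<^sup>2 / 2)) \<partial>std_normal)"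
      by (rule nn_integral_std_normal_shift) measurable
    then show "?F x * ?Z x = (\<integral>\<^sup>+u. f (x(i := u)) *
      ennreal (exp (lin (insert i I) r (x(i := u)) - (\<Sum>j\<in>insert i I. (r j)\<^sup>2) / 2)) \<partial>std_normal)"
      unfolding Z by (simp add: nn_integral_multc[symmetric] mult.assoc)
  qed
  also have "\<dots> = (\<integral>\<^sup>+x. f x *
      ennreal (exp (lin (insert i I) r x - (\<Sum>j\<in>insert i I. (r j)\<^sup>2) / 2)) \<partial>gauss (insert i I))"
    by (rule ins[symmetric]) measurable
  finally show ?case .
qed

lemma lin_has_bochner_integral_exp:
  assumes "finite I"
  shows "has_bochner_integral (gauss I) (\<lambda>g. exp (lin I a g)) (exp ((\<Sum>i\<in>I. (a i)\<^sup>2) / 2))"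
proof -
  have one: "integrable std_normal (\<lambda>x. exp (s * x))" "(\<integral>x. exp (s * x) \<partial>std_normal) = exp (s\<^sup>2 / 2)" for s
    using std_normal_has_bochner_integral_exp[of s] by (auto simp: has_bochner_integral_iff)
  have eq: "exp (lin I a g) = (\<Prod>i\<in>I. exp (a i * g i))" for g
    using assms by (simp add: lin_def exp_sum)
  show ?thesis
    unfolding has_bochner_integral_iff eq gauss_def
    using std_normals.product_integrable_prod[OF assms, of "\<lambda>i x. exp (a i * x)"]
      std_normals.product_integral_prod[OF assms, of "\<lambda>i x. exp (a i * x)"] assms
    by (simp add: one exp_sum[symmetric] sum_divide_distrib)
qed

lemma lin_uminus: "lin I (\<lambda>i. - a i) g = - lin I a g"
  by (simp add: lin_def sum_negf)

lemma lin_scale: "lin I (\<lambda>i. c * a i) g = c * lin I a g"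
  by (simp add: lin_def sum_distrib_left mult.assoc)

text \<open>A single term of the exponential series is at most the whole series, so every moment is
  dominated by a two-sided exponential moment.\<close>

lemma integrable_lin_abs_pow:
  assumes "finite I"
  shows "integrable (gauss I) (\<lambda>g. \<bar>lin I a g\<bar> ^ k)"
proof (rule Bochner_Integration.integrable_bound)
  have "integrable (gauss I) (\<lambda>g. exp (lin I b g))" for b
    using lin_has_bochner_integral_exp[OF assms] by (auto simp: has_bochner_integral_iff)
  from this[of a] this[of "\<lambda>i. - a i"]
  show "integrable (gauss I) (\<lambda>g. fact k * (exp (lin I a g) + exp (- lin I a g)))"
    by (simp add: lin_uminus)
  have "\<bar>x\<bar> ^ k \<le> fact k * (exp x + exp (- x))" for x :: real
  proof -
    have "\<bar>x\<bar> ^ k / fact k = (\<Sum>n\<in>{k}. \<bar>x\<bar> ^ n / fact n)" by simp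
    also have "\<dots> \<le> (\<Sum>n. \<bar>x\<bar> ^ n / fact n)"
      using summable_exp[of "\<bar>x\<bar>"] by (intro sum_le_suminf) (auto simp: field_simps)
    also have "\<dots> = exp \<bar>x\<bar>" by (simp add: exp_def divide_inverse mult.commute)
    also have "\<dots> \<le> exp x + exp (- x)" by (cases "x \<ge> 0") auto
    finally show ?thesis by (simp add: field_simps)
  qed
  then show "AE g in gauss I. norm (\<bar>lin I a g\<bar> ^ k) \<le> norm (fact k * (exp (lin I a g) + exp (- lin I a g)))"
    by (intro AE_I2) simp
qed measurable

lemma integrable_lin: "finite I \<Longrightarrow> integrable (gauss I) (lin I a)"
  using integrable_lin_abs_pow[of I a 1] by (simp add: integrable_abs_iff)

lemma gauss_component:
  fixes f :: "real \<Rightarrow> real"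
  assumes "i \<in> I" and [measurable]: "f \<in> borel_measurable borel"
  shows "(\<integral>g. f (g i) \<partial>gauss I) = (\<integral>x. f x \<partial>std_normal)"
proof -
  have d: "distr (gauss I) std_normal (\<lambda>g. g i) = std_normal"
    unfolding gauss_def using assms by (intro distr_PiM_component) (auto intro: prob_space_std_normal)
  have m: "(\<lambda>g. g i) \<in> gauss I \<rightarrow>\<^sub>M std_normal"
    using assms(1) by (simp add: measurable_gauss)
  have "(\<integral>x. f x \<partial>distr (gauss I) std_normal (\<lambda>g. g i)) = (\<integral>g. f (g i) \<partial>gauss I)"
    by (rule integral_distr[OF m]) simp
  then show ?thesis unfolding d ..
qed

lemma std_normal_mean: "(\<integral>x. x \<partial>std_normal) = 0"
  using integral_std_normal_moment_odd[of 0] by (simp add: integral_density)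

lemma std_normal_second_moment: "(\<integral>x. x * x \<partial>std_normal) = 1"
  using integral_std_normal_moment_even[of 1] by (simp add: integral_density power2_eq_square)

lemma integral_lin:
  assumes "finite I" shows "(\<integral>g. lin I a g \<partial>gauss I) = 0"
proof -
  have c: "integrable (gauss I) (\<lambda>g. g i)" if "i \<in> I" for i
  proof -
    have "lin I (\<lambda>j. if j = i then 1 else 0) = (\<lambda>g. g i)"
      using that assms by (simp add: fun_eq_iff lin_def if_distrib[of "\<lambda>x. x * _"] cong: if_cong)
    then show ?thesis using integrable_lin[OF assms, of "\<lambda>j. if j = i then 1 else 0"] by simp
  qed
  have "(\<integral>g. lin I a g \<partial>gauss I) = (\<Sum>i\<in>I. a i * (\<integral>g. g i \<partial>gauss I))"
    unfolding lin_def by (simp add: c)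
  also have "\<dots> = 0" by (simp add: gauss_component[where f = "\<lambda>x. x"] std_normal_mean)
  finally show ?thesis .
qed

lemma integrable_lin_mult:
  assumes "finite I" shows "integrable (gauss I) (\<lambda>g. lin I a g * lin I b g)"
proof (rule Bochner_Integration.integrable_bound)
  show "integrable (gauss I) (\<lambda>g. \<bar>lin I a g\<bar>\<^sup>2 + \<bar>lin I b g\<bar>\<^sup>2)"
    using assms by (intro Bochner_Integration.integrable_add integrable_lin_abs_pow)
  have "\<bar>x * y\<bar> \<le> \<bar>\<bar>x\<bar>\<^sup>2 + \<bar>y\<bar>\<^sup>2\<bar>" for x y :: real
  proof -
    have "0 \<le> \<bar>x\<bar> * \<bar>y\<bar>" by simp
    with sum_squares_bound[of "\<bar>x\<bar>" "\<bar>y\<bar>"] have "\<bar>x\<bar> * \<bar>y\<bar> \<le> \<bar>x\<bar>\<^sup>2 + \<bar>y\<bar>\<^sup>2" by linarith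
    then show ?thesis unfolding abs_mult by linarith
  qed
  then show "AE g in gauss I. norm (lin I a g * lin I b g) \<le> norm (\<bar>lin I a g\<bar>\<^sup>2 + \<bar>lin I b g\<bar>\<^sup>2)"
    by (intro AE_I2) simp
qed measurable

lemma integral_lin_mult:
  assumes "finite I" shows "(\<integral>g. lin I a g * lin I b g \<partial>gauss I) = (\<Sum>i\<in>I. a i * b i)"
proof -
  have l: "lin I (\<lambda>j. if j = i then 1 else 0) g = g i" if "i \<in> I" for i g
    using that assms by (simp add: lin_def if_distrib[of "\<lambda>x. x * _"] cong: if_cong)
  have c: "integrable (gauss I) (\<lambda>g. g i * g j)" if "i \<in> I" "j \<in> I" for i j
    using integrable_lin_mult[OF assms, of "\<lambda>j. if j = i then 1 else 0" "\<lambda>k. if k = j then 1 else 0"]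
    by (simp add: l that)
  have ij: "(\<integral>g. g i * g j \<partial>gauss I) = (if i = j then 1 else 0)" if "i \<in> I" "j \<in> I" for i j
  proof (cases "i = j")
    case True
    then show ?thesis
      using gauss_component[OF that(1), of "\<lambda>x. x * x"] by (simp add: std_normal_second_moment)
  next
    case False
    \<comment> \<open>The identity at the two distinct sites and constant 1 elsewhere. The product
      formula then factorises the covariance, and the factor at \<open>i\<close> has mean
      zero.\<close>
    let ?f = "\<lambda>k x. if k \<in> {i, j} then x else (1::real)"
    have i: "integrable std_normal (\<lambda>x. x)"
      using integrable_std_normal_moment[of 1] by (simp add: integrable_density)
    have pr: "(\<Prod>k\<in>I. ?f k (g k)) = g i * g j" for g :: "'a \<Rightarrow> real"
    proof -
      have "(\<Prod>k\<in>I. ?f k (g k)) = (\<Prod>k\<in>{i, j}. g k)"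
        using that assms by (subst prod.mono_neutral_right[of I "{i, j}"]) auto
      then show ?thesis using False by simp
    qed
    have "(\<integral>g. (\<Prod>k\<in>I. ?f k (g k)) \<partial>gauss I) = (\<Prod>k\<in>I. (\<integral>x. ?f k x \<partial>std_normal))"
      unfolding gauss_def
    proof (rule std_normals.product_integral_prod[OF assms])
      show "integrable std_normal (?f k)" for k
        using i by (cases "k \<in> {i, j}") simp_all
    qed
    also have "\<dots> = 0"
      using that assms by (intro prod_zero bexI[of _ i]) (auto simp: std_normal_mean)
    finally show ?thesis using False unfolding pr by simp
  qed
  have "(\<integral>g. lin I a g * lin I b g \<partial>gauss I) = (\<integral>g. (\<Sum>i\<in>I. \<Sum>j\<in>I. (a i * b j) * (g i * g j)) \<partial>gauss I)"
    unfolding lin_def by (simp add: sum_product mult_ac)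
  also have "\<dots> = (\<Sum>i\<in>I. \<Sum>j\<in>I. (a i * b j) * (\<integral>g. g i * g j \<partial>gauss I))"
    by (simp add: c)
  also have "\<dots> = (\<Sum>i\<in>I. a i * b i)"
    using assms by (simp add: ij if_distrib[of "\<lambda>x. _ * x"] cong: if_cong)
  finally show ?thesis .
qed

section \<open>The soft maximum and Gaussian comparison\<close>

text \<open>The free energy at inverse temperature \<beta>: a smooth substitute for the maximum with
  error at most \<open>ln (card T) / \<beta>\<close>. Its gradient is \<open>gibbs\<close>.\<close>

definition lse :: "real \<Rightarrow> 't set \<Rightarrow> ('t \<Rightarrow> real) \<Rightarrow> real" where
  "lse \<beta> T z = ln (\<Sum>t\<in>T. exp (\<beta> * z t)) / \<beta>"

definition gibbs :: "real \<Rightarrow> 't set \<Rightarrow> ('t \<Rightarrow> real) \<Rightarrow> 't \<Rightarrow> real" where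
  "gibbs \<beta> T z t = exp (\<beta> * z t) / (\<Sum>s\<in>T. exp (\<beta> * z s))"

lemma partition_function_pos:
  fixes z :: "'t \<Rightarrow> real"
  assumes "finite T" "T \<noteq> {}" shows "0 < (\<Sum>t\<in>T. exp (\<beta> * z t))"
  using assms by (intro sum_pos) auto

lemma gibbs_nonneg: "0 \<le> gibbs \<beta> T z t"
  unfolding gibbs_def by (intro divide_nonneg_nonneg sum_nonneg) auto

lemma sum_gibbs:
  assumes "finite T" "T \<noteq> {}" shows "(\<Sum>t\<in>T. gibbs \<beta> T z t) = 1"
  using partition_function_pos[OF assms, of \<beta> z] unfolding gibbs_def sum_divide_distrib[symmetric] by simp

lemma lse_ge_Max:
  assumes "finite T" "T \<noteq> {}" "0 < \<beta>" shows "Max (z ` T) \<le> lse \<beta> T z"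
proof (subst Max_le_iff, use assms in simp, use assms in simp, intro ballI)
  fix y assume "y \<in> z ` T"
  then obtain t where t: "t \<in> T" "y = z t" by auto
  have "exp (\<beta> * z t) \<le> (\<Sum>s\<in>T. exp (\<beta> * z s))"
    using t assms by (intro member_le_sum) auto
  then have "\<beta> * z t \<le> ln (\<Sum>s\<in>T. exp (\<beta> * z s))"
    using partition_function_pos[OF assms(1,2)] by (simp add: ln_ge_iff)
  then show "y \<le> lse \<beta> T z" using assms t by (simp add: lse_def field_simps)
qed

lemma lse_le_Max:
  assumes "finite T" "T \<noteq> {}" "0 < \<beta>" shows "lse \<beta> T z \<le> Max (z ` T) + ln (card T) / \<beta>"
proof -
  have "(\<Sum>s\<in>T. exp (\<beta> * z s)) \<le> (\<Sum>s\<in>T. exp (\<beta> * Max (z ` T)))"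
    using assms by (intro sum_mono) auto
  also have "\<dots> = exp (\<beta> * Max (z ` T) + ln (card T))"
    using assms by (simp add: exp_add card_gt_0_iff)
  finally have "ln (\<Sum>s\<in>T. exp (\<beta> * z s)) \<le> \<beta> * Max (z ` T) + ln (card T)"
    using partition_function_pos[OF assms(1,2)] ln_le_cancel_iff[of "\<Sum>s\<in>T. exp (\<beta> * z s)" "exp (\<beta> * Max (z ` T) + ln (card T))"]
    by simp
  then show ?thesis using assms by (simp add: lse_def field_simps)
qed

lemma Max_abs_le_sum:
  fixes z :: "'t \<Rightarrow> real"
  assumes "finite T" "T \<noteq> {}" shows "\<bar>Max (z ` T)\<bar> \<le> (\<Sum>t\<in>T. \<bar>z t\<bar>)"
proof -
  have "Max (z ` T) \<in> z ` T" using assms by (intro Max_in) auto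
  then obtain t where "t \<in> T" "Max (z ` T) = z t" by auto
  then show ?thesis using assms by (simp add: member_le_sum[of t T "\<lambda>t. \<bar>z t\<bar>"])
qed

lemma lse_abs_le:
  assumes "finite T" "T \<noteq> {}" "0 < \<beta>"
  shows "\<bar>lse \<beta> T z\<bar> \<le> (\<Sum>t\<in>T. \<bar>z t\<bar>) + ln (card T) / \<beta>"
proof -
  have "0 \<le> ln (card T) / \<beta>" using assms by (simp add: Suc_le_eq card_gt_0_iff)
  then show ?thesis
    using lse_ge_Max[OF assms, of z] lse_le_Max[OF assms, of z] Max_abs_le_sum[OF assms(1,2), of z] by linarith
qed

text \<open>The two-replica form of a variance. It writes the second derivative of
  \<open>lse\<close> through differences \<open>u s - u t\<close>, so that the Gaussian comparison
  involves increments only, not individual variances.\<close>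

lemma weighted_variance:
  fixes p u :: "'t \<Rightarrow> real"
  assumes "(\<Sum>t\<in>T. p t) = 1"
  shows "(\<Sum>t\<in>T. p t * (u t)\<^sup>2) - (\<Sum>t\<in>T. p t * u t)\<^sup>2
    = (\<Sum>s\<in>T. \<Sum>t\<in>T. p s * p t * (u s - u t)\<^sup>2) / 2"
proof -
  have "(\<Sum>s\<in>T. \<Sum>t\<in>T. p s * p t * (u s - u t)\<^sup>2)
    = (\<Sum>s\<in>T. \<Sum>t\<in>T. (p s * (u s)\<^sup>2) * p t) + (\<Sum>s\<in>T. \<Sum>t\<in>T. p s * (p t * (u t)\<^sup>2))
      - 2 * (\<Sum>s\<in>T. \<Sum>t\<in>T. (p s * u s) * (p t * u t))"
    by (simp add: sum.distrib[symmetric] sum_distrib_left sum_subtractf[symmetric] power2_eq_square algebra_simps)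
  also have "\<dots> = 2 * ((\<Sum>t\<in>T. p t * (u t)\<^sup>2) - (\<Sum>t\<in>T. p t * u t)\<^sup>2)"
    unfolding sum_product[symmetric] by (simp add: assms power2_eq_square)
  finally show ?thesis by simp
qed

text \<open>Along the ray \<open>z t + r * u t\<close> the derivatives of \<open>lse\<close> are
  cumulants of \<open>u\<close> under the Gibbs measure, up to powers of \<beta>. The third cumulant
  is at most 6 times the cubed maximum of \<open>\<bar>u t\<bar>\<close>, and this 6 cancels the
  factorial in the remainder. Replacing the maximum by a sum makes the bound easy to
  integrate.\<close>

lemma lse_taylor:
  assumes T: "finite T" "T \<noteq> {}" and "0 < \<beta>"
  shows "\<bar>lse \<beta> T (\<lambda>t. z t + u t) - (lse \<beta> T z + (\<Sum>t\<in>T. gibbs \<beta> T z t * u t)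
      + \<beta> / 4 * (\<Sum>s\<in>T. \<Sum>t\<in>T. gibbs \<beta> T z s * gibbs \<beta> T z t * (u s - u t)\<^sup>2))\<bar>
    \<le> \<beta>\<^sup>2 * (\<Sum>t\<in>T. \<bar>u t\<bar> ^ 3)"
proof -
  \<comment> \<open>Unnormalised Gibbs moments. The derivative rule for their normalised versions
    \<open>m\<close> generates all the cumulants needed.\<close>
  define M where "M k r = (\<Sum>t\<in>T. u t ^ k * exp (\<beta> * (z t + r * u t)))" for k r
  have pos: "0 < M 0 r" for r
    using partition_function_pos[OF T, of \<beta> "\<lambda>t. z t + r * u t"] by (simp add: M_def)
  have dM: "(M k has_real_derivative \<beta> * M (Suc k) r) (at r)" for k r
    unfolding M_def by (auto intro!: derivative_eq_intros sum.cong simp: sum_distrib_left algebra_simps)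
  define m where "m k r = M k r / M 0 r" for k r
  have m0: "m 0 r = 1" for r using pos[of r] by (simp add: m_def)
  have dm: "(m k has_real_derivative \<beta> * (m (Suc k) r - m k r * m 1 r)) (at r)" for k r
    unfolding m_def using pos[of r]
    by (auto intro!: derivative_eq_intros dM simp: field_simps power2_eq_square)
  define \<mu> where "\<mu> = Max ((\<lambda>t. \<bar>u t\<bar>) ` T)"
  have "\<mu> \<in> (\<lambda>t. \<bar>u t\<bar>) ` T" unfolding \<mu>_def using T by (intro Max_in) auto
  then obtain t0 where t0: "t0 \<in> T" "\<mu> = \<bar>u t0\<bar>" by auto
  have \<mu>: "\<bar>u t\<bar> \<le> \<mu>" if "t \<in> T" for t unfolding \<mu>_def using T that by (intro Max_ge) auto
  have m_le: "\<bar>m k r\<bar> \<le> \<mu> ^ k" for k r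
  proof -
    have "\<bar>M k r\<bar> \<le> (\<Sum>t\<in>T. \<mu> ^ k * exp (\<beta> * (z t + r * u t)))"
      unfolding M_def by (rule order_trans[OF sum_abs], rule sum_mono)
        (auto simp: abs_mult power_abs intro!: mult_right_mono power_mono \<mu>)
    also have "\<dots> = \<mu> ^ k * M 0 r" by (simp add: M_def sum_distrib_left)
    finally show ?thesis using pos[of r] by (simp add: m_def field_simps)
  qed
  \<comment> \<open>The free energy and its first three derivatives in \<open>r\<close>, that is,
    the first three cumulants with the factors 1, \<beta> and \<beta>^2.\<close>
  define D where "D j r = (if j = 0 then ln (M 0 r) / \<beta> else if j = 1 then m 1 r
     else if j = 2 then \<beta> * (m 2 r - m 1 r * m 1 r)
     else \<beta>\<^sup>2 * (m 3 r - 3 * m 2 r * m 1 r + 2 * m 1 r ^ 3))" for j :: nat and r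
  have dD: "DERIV (D j) r :> D (Suc j) r" if "j < 3" for j r
  proof -
    have "j = 0 \<or> j = 1 \<or> j = 2" using that by arith
    then consider "j = 0" | "j = 1" | "j = 2" by blast
    then show ?thesis
    proof cases
      case 1
      have "((\<lambda>r. ln (M 0 r) / \<beta>) has_real_derivative m 1 r) (at r)"
        using pos[of r] assms(3) by (auto intro!: derivative_eq_intros dM simp: m_def field_simps)
      then show ?thesis using 1 by (simp add: D_def[abs_def])
    next
      case 2
      then show ?thesis using dm[of 1 r] by (simp add: D_def[abs_def] numeral_2_eq_2)
    next
      case 3
      have "((\<lambda>r. \<beta> * (m 2 r - m 1 r * m 1 r)) has_real_derivative
         \<beta>\<^sup>2 * (m 3 r - 3 * m 2 r * m 1 r + 2 * m 1 r ^ 3)) (at r)"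
        using dm[of 2 r] dm[of 1 r]
        by (auto intro!: derivative_eq_intros simp: numeral_3_eq_3 numeral_2_eq_2 algebra_simps power2_eq_square)
      then show ?thesis using 3 by (simp add: D_def[abs_def])
    qed
  qed
  obtain r where r: "D 0 1 = (\<Sum>j<3. D j 0 / fact j * 1 ^ j) + D 3 r / fact 3 * 1 ^ 3"
    using Maclaurin[of 1 3 D "D 0"] dD by auto
  have "\<bar>D 3 r\<bar> \<le> \<beta>\<^sup>2 * (6 * \<mu> ^ 3)"
  proof -
    have "0 \<le> \<mu>" using t0 by simp
    then have "\<bar>m 2 r * m 1 r\<bar> \<le> \<mu>\<^sup>2 * \<mu> ^ 1" "\<bar>m 1 r ^ 3\<bar> \<le> (\<mu> ^ 1) ^ 3"
      unfolding abs_mult power_abs by (intro mult_mono power_mono m_le; simp)+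
    then have "\<bar>m 3 r - 3 * m 2 r * m 1 r + 2 * m 1 r ^ 3\<bar> \<le> 6 * \<mu> ^ 3"
      using m_le[of 3 r] by (simp add: power2_eq_square power3_eq_cube mult.assoc)
    then show ?thesis by (simp add: D_def abs_mult mult_left_mono)
  qed
  moreover have "\<mu> ^ 3 \<le> (\<Sum>t\<in>T. \<bar>u t\<bar> ^ 3)"
    unfolding t0(2) using t0(1) T by (intro member_le_sum[of t0 T "\<lambda>t. \<bar>u t\<bar> ^ 3"]) auto
  ultimately have err: "\<bar>D 3 r / 6\<bar> \<le> \<beta>\<^sup>2 * (\<Sum>t\<in>T. \<bar>u t\<bar> ^ 3)"
    using mult_left_mono[of "\<mu> ^ 3" "\<Sum>t\<in>T. \<bar>u t\<bar> ^ 3" "\<beta>\<^sup>2"] by simp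
  have mg: "m k 0 = (\<Sum>t\<in>T. gibbs \<beta> T z t * u t ^ k)" for k
    by (simp add: m_def M_def gibbs_def sum_divide_distrib mult.commute)
  have D2: "D 2 0 = \<beta> * ((\<Sum>s\<in>T. \<Sum>t\<in>T. gibbs \<beta> T z s * gibbs \<beta> T z t * (u s - u t)\<^sup>2) / 2)"
    using weighted_variance[OF sum_gibbs[OF T, of \<beta> z], of u] by (simp add: D_def mg power2_eq_square)
  have D0: "D 0 1 = lse \<beta> T (\<lambda>t. z t + u t)" "D 0 0 = lse \<beta> T z" "D 1 0 = (\<Sum>t\<in>T. gibbs \<beta> T z t * u t)"
    by (simp_all add: D_def lse_def M_def mg)
  have "D 0 1 = D 0 0 + D 1 0 + D 2 0 / 2 + D 3 r / 6"
    using r by (simp add: eval_nat_numeral)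
  then have "lse \<beta> T (\<lambda>t. z t + u t) - (lse \<beta> T z + (\<Sum>t\<in>T. gibbs \<beta> T z t * u t)
      + \<beta> / 4 * (\<Sum>s\<in>T. \<Sum>t\<in>T. gibbs \<beta> T z s * gibbs \<beta> T z t * (u s - u t)\<^sup>2)) = D 3 r / 6"
    unfolding D0 D2 by simp
  with err show ?thesis by simp
qed

section \<open>Gaussian interpolation between two processes\<close>

lemma gauss_convolution:
  fixes F :: "('i \<Rightarrow> real) \<Rightarrow> real"
  assumes "finite I" "c\<^sup>2 + s\<^sup>2 = 1" and [measurable]: "F \<in> borel_measurable (gauss I)"
  shows "(\<integral>x. F x \<partial>gauss I) = (\<integral>p. F (\<lambda>i\<in>I. c * fst p i + s * snd p i) \<partial>(gauss I \<Otimes>\<^sub>M gauss I))"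
proof -
  interpret G: prob_space "gauss I" by (rule prob_space_gauss)
  let ?P = "gauss I \<Otimes>\<^sub>M gauss I"
  have "(\<integral>x. F x \<partial>gauss I) = (\<integral>x. F x \<partial>distr ?P (gauss I) fst)"
    by (simp add: G.distr_pair_fst)
  also have "\<dots> = (\<integral>p. F (fst p) \<partial>?P)" by (rule integral_distr) simp_all
  also have "\<dots> = (\<integral>p. F (fst p) \<partial>distr ?P ?P (gauss_rot I c s))"
    by (simp add: distr_gauss_rot[OF assms(1,2)])
  also have "\<dots> = (\<integral>p. F (fst (gauss_rot I c s p)) \<partial>?P)" by (rule integral_distr) simp_all
  also have "\<dots> = (\<integral>p. F (\<lambda>i\<in>I. c * fst p i + s * snd p i) \<partial>?P)"
    by (simp add: gauss_rot_def case_prod_beta)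
  finally show ?thesis .
qed

lemma lin_comb: "lin I a (\<lambda>i\<in>I. c * x i + s * y i) = c * lin I a x + s * lin I a y"
  by (simp add: lin_def sum_distrib_left sum.distrib[symmetric] algebra_simps)

lemma lin_diff: "lin I (\<lambda>i. a i - b i) g = lin I a g - lin I b g"
  by (simp add: lin_def sum_subtractf algebra_simps)

lemma (in prob_space) integral_diff_le:
  fixes f g :: "'a \<Rightarrow> real"
  assumes "integrable M f" "integrable M g" "\<And>x. x \<in> space M \<Longrightarrow> \<bar>f x - g x\<bar> \<le> C"
  shows "\<bar>(\<integral>x. f x \<partial>M) - (\<integral>x. g x \<partial>M)\<bar> \<le> C"
proof -
  have "\<bar>(\<integral>x. f x \<partial>M) - (\<integral>x. g x \<partial>M)\<bar> = \<bar>\<integral>x. f x - g x \<partial>M\<bar>"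
    using assms by simp
  also have "\<dots> \<le> (\<integral>x. \<bar>f x - g x\<bar> \<partial>M)"
    by (rule integral_abs_bound)
  also have "\<dots> \<le> (\<integral>x. C \<partial>M)"
    using assms by (intro integral_mono) auto
  finally show ?thesis by (simp add: prob_space)
qed

lemma (in prob_space) integrable_lse:
  assumes "finite T" "T \<noteq> {}" "0 < \<beta>" and z: "\<And>t. t \<in> T \<Longrightarrow> integrable M (z t)"
  shows "integrable M (\<lambda>w. lse \<beta> T (\<lambda>t. z t w))"
proof (rule Bochner_Integration.integrable_bound)
  show "integrable M (\<lambda>w. (\<Sum>t\<in>T. \<bar>z t w\<bar>) + ln (card T) / \<beta>)"
    using z by auto
  show "(\<lambda>w. lse \<beta> T (\<lambda>t. z t w)) \<in> borel_measurable M"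
    unfolding lse_def using z[THEN borel_measurable_integrable] by measurable
  have "0 \<le> (\<Sum>t\<in>T. \<bar>z t w\<bar>) + ln (card T) / \<beta>" for w
    using assms by (intro add_nonneg_nonneg sum_nonneg) (auto simp: Suc_le_eq card_gt_0_iff)
  then show "AE w in M. norm (lse \<beta> T (\<lambda>t. z t w)) \<le> norm ((\<Sum>t\<in>T. \<bar>z t w\<bar>) + ln (card T) / \<beta>)"
    using lse_abs_le[OF assms(1-3)] by (intro AE_I2) (simp add: abs_of_nonneg)
qed

lemma (in prob_space) integrable_Max:
  assumes "finite T" "T \<noteq> {}" and z: "\<And>t. t \<in> T \<Longrightarrow> integrable M (z t)"
  shows "integrable M (\<lambda>w. Max ((\<lambda>t. z t w) ` T) :: real)"
proof (rule Bochner_Integration.integrable_bound)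
  show "integrable M (\<lambda>w. \<Sum>t\<in>T. \<bar>z t w\<bar>)" using z by auto
  show "(\<lambda>w. Max ((\<lambda>t. z t w) ` T)) \<in> borel_measurable M"
    using z[THEN borel_measurable_integrable] assms(1) by measurable
  show "AE w in M. norm (Max ((\<lambda>t. z t w) ` T)) \<le> norm (\<Sum>t\<in>T. \<bar>z t w\<bar>)"
    using Max_abs_le_sum[OF assms(1,2)] by (intro AE_I2) (simp add: sum_nonneg abs_of_nonneg)
qed

definition incr :: "'i set \<Rightarrow> ('t \<Rightarrow> 'i \<Rightarrow> real) \<Rightarrow> 't \<Rightarrow> 't \<Rightarrow> real" where
  "incr I a s t = (\<Sum>i\<in>I. (a s i - a t i)\<^sup>2)"

definition gibbs_incr :: "real \<Rightarrow> 't set \<Rightarrow> 'i set \<Rightarrow> ('t \<Rightarrow> 'i \<Rightarrow> real) \<Rightarrow> ('t \<Rightarrow> real) \<Rightarrow> real" where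
  "gibbs_incr \<beta> T I a z = (\<Sum>s\<in>T. \<Sum>t\<in>T. gibbs \<beta> T z s * gibbs \<beta> T z t * incr I a s t)"

definition third_moments :: "'t set \<Rightarrow> 'i set \<Rightarrow> ('t \<Rightarrow> 'i \<Rightarrow> real) \<Rightarrow> real" where
  "third_moments T I a = (\<Sum>t\<in>T. \<integral>x. \<bar>lin I (a t) x\<bar> ^ 3 \<partial>gauss I)"

lemma integral_lin_diff_square:
  assumes "finite I"
  shows "(\<integral>x. (lin I (a s) x - lin I (a t) x)\<^sup>2 \<partial>gauss I) = incr I a s t"
  using integral_lin_mult[OF assms, of "\<lambda>i. a s i - a t i" "\<lambda>i. a s i - a t i"]
  by (simp add: lin_diff incr_def power2_eq_square)

lemma integrable_lin_diff_square:
  assumes "finite I"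
  shows "integrable (gauss I) (\<lambda>x. (lin I (a s) x - lin I (a t) x)\<^sup>2)"
  using integrable_lin_mult[OF assms, of "\<lambda>i. a s i - a t i" "\<lambda>i. a s i - a t i"]
  by (simp add: lin_diff power2_eq_square)

text \<open>Averaging the Taylor expansion over the Gaussian increment kills the linear term and
  turns every squared difference into \<open>incr\<close>.\<close>

lemma integral_lse_small_increment:
  assumes I: "finite I" and T: "finite T" "T \<noteq> {}" and "0 < \<beta>" "0 \<le> r"
  shows "\<bar>(\<integral>x. lse \<beta> T (\<lambda>t. z t + r * lin I (a t) x) \<partial>gauss I)
     - (lse \<beta> T z + \<beta> / 4 * r\<^sup>2 * gibbs_incr \<beta> T I a z)\<bar> \<le> \<beta>\<^sup>2 * r ^ 3 * third_moments T I a"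
proof -
  interpret G: prob_space "gauss I" by (rule prob_space_gauss)
  let ?p = "gibbs \<beta> T z"
  define P where "P x = lse \<beta> T z + (\<Sum>t\<in>T. ?p t * (r * lin I (a t) x))
      + \<beta> / 4 * (\<Sum>s\<in>T. \<Sum>t\<in>T. ?p s * ?p t * (r * lin I (a s) x - r * lin I (a t) x)\<^sup>2)" for x
  have sq: "(r * lin I (a s) x - r * lin I (a t) x)\<^sup>2 = r\<^sup>2 * (lin I (a s) x - lin I (a t) x)\<^sup>2" for s t x
    by (simp add: power_mult_distrib[symmetric] algebra_simps)
  note [simp] = integrable_lin[OF I] integral_lin[OF I] integral_lin_diff_square[OF I]
    integrable_lin_diff_square[OF I] integrable_lin_abs_pow[OF I]
  have Pint: "integrable (gauss I) P"
    unfolding P_def sq by (intro Bochner_Integration.integrable_add integrable_const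
      Bochner_Integration.integrable_sum integrable_mult_right) simp_all
  have "(\<integral>x. P x \<partial>gauss I) = lse \<beta> T z + \<beta> / 4 * (\<Sum>s\<in>T. \<Sum>t\<in>T. ?p s * ?p t * (r\<^sup>2 * incr I a s t))"
    unfolding P_def sq by (simp add: G.prob_space)
  also have "\<dots> = lse \<beta> T z + \<beta> / 4 * r\<^sup>2 * gibbs_incr \<beta> T I a z"
    by (simp add: gibbs_incr_def sum_distrib_left mult_ac)
  finally have Pval: "(\<integral>x. P x \<partial>gauss I) = \<dots>" .
  have Lint: "integrable (gauss I) (\<lambda>x. lse \<beta> T (\<lambda>t. z t + r * lin I (a t) x))"
    using T assms(4) by (intro G.integrable_lse) auto
  have "\<bar>(\<integral>x. lse \<beta> T (\<lambda>t. z t + r * lin I (a t) x) \<partial>gauss I) - (\<integral>x. P x \<partial>gauss I)\<bar>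
    = \<bar>\<integral>x. lse \<beta> T (\<lambda>t. z t + r * lin I (a t) x) - P x \<partial>gauss I\<bar>"
    using Pint Lint by simp
  also have "\<dots> \<le> (\<integral>x. \<bar>lse \<beta> T (\<lambda>t. z t + r * lin I (a t) x) - P x\<bar> \<partial>gauss I)"
    by (rule integral_abs_bound)
  also have "\<dots> \<le> (\<integral>x. \<beta>\<^sup>2 * (\<Sum>t\<in>T. \<bar>r * lin I (a t) x\<bar> ^ 3) \<partial>gauss I)"
  proof (rule integral_mono)
    show "integrable (gauss I) (\<lambda>x. \<bar>lse \<beta> T (\<lambda>t. z t + r * lin I (a t) x) - P x\<bar>)"
      using Pint Lint by simp
    show "integrable (gauss I) (\<lambda>x. \<beta>\<^sup>2 * (\<Sum>t\<in>T. \<bar>r * lin I (a t) x\<bar> ^ 3))"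
      by (simp add: abs_mult power_mult_distrib)
    show "\<bar>lse \<beta> T (\<lambda>t. z t + r * lin I (a t) x) - P x\<bar> \<le> \<beta>\<^sup>2 * (\<Sum>t\<in>T. \<bar>r * lin I (a t) x\<bar> ^ 3)" for x
      unfolding P_def by (rule lse_taylor[OF T assms(4)])
  qed
  also have "\<dots> = \<beta>\<^sup>2 * r ^ 3 * third_moments T I a"
    using assms(5) by (simp add: abs_mult power_mult_distrib third_moments_def sum_distrib_left mult_ac)
  finally show ?thesis unfolding Pval .
qed

lemma gibbs_incr_bounds:
  assumes "finite T" "T \<noteq> {}"
  shows "0 \<le> gibbs_incr \<beta> T I a z" "gibbs_incr \<beta> T I a z \<le> (\<Sum>s\<in>T. \<Sum>t\<in>T. incr I a s t)"
proof -
  have i: "0 \<le> incr I a s t" for s t unfolding incr_def by (intro sum_nonneg) simp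
  have g1: "gibbs \<beta> T z t \<le> 1" if "t \<in> T" for t
    using member_le_sum[OF that, of "gibbs \<beta> T z"] sum_gibbs[OF assms, of \<beta> z] assms(1)
    by (simp add: gibbs_nonneg)
  show "0 \<le> gibbs_incr \<beta> T I a z"
    unfolding gibbs_incr_def by (intro sum_nonneg mult_nonneg_nonneg gibbs_nonneg i)
  show "gibbs_incr \<beta> T I a z \<le> (\<Sum>s\<in>T. \<Sum>t\<in>T. incr I a s t)"
    unfolding gibbs_incr_def
  proof (intro sum_mono)
    fix s t assume st: "s \<in> T" "t \<in> T"
    have "gibbs \<beta> T z s * gibbs \<beta> T z t \<le> 1 * 1"
      using g1[OF st(1)] g1[OF st(2)] by (intro mult_mono) (auto simp: gibbs_nonneg)
    then show "gibbs \<beta> T z s * gibbs \<beta> T z t * incr I a s t \<le> incr I a s t"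
      using i[of s t] by (intro mult_left_le_one_le) (auto simp: gibbs_nonneg)
  qed
qed

lemma (in prob_space) integrable_gibbs_incr:
  assumes "finite T" "T \<noteq> {}" and [measurable]: "\<And>t. t \<in> T \<Longrightarrow> z t \<in> borel_measurable M"
  shows "integrable M (\<lambda>w. gibbs_incr \<beta> T I a (\<lambda>t. z t w))"
proof (rule integrable_const_bound)
  show "AE w in M. norm (gibbs_incr \<beta> T I a (\<lambda>t. z t w)) \<le> (\<Sum>s\<in>T. \<Sum>t\<in>T. incr I a s t)"
    unfolding real_norm_def abs_of_nonneg[OF gibbs_incr_bounds(1)[OF assms(1,2)]]
    by (intro AE_I2 gibbs_incr_bounds(2)[OF assms(1,2)])
  show "(\<lambda>w. gibbs_incr \<beta> T I a (\<lambda>t. z t w)) \<in> borel_measurable M"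
    unfolding gibbs_incr_def gibbs_def by measurable
qed

text \<open>Adding variance \<open>h\<close> has the same effect in law as adding an independent
  increment scaled by \<open>sqrt h\<close>. For a fixed first copy the expansion in the small
  increment applies, and this finite step replaces differentiation in the variance.\<close>

lemma integral_lse_variance_step:
  assumes I: "finite I" and T: "finite T" "T \<noteq> {}" and "0 < \<beta>" "0 \<le> \<tau>" "0 < h"
  shows "\<bar>(\<integral>x. lse \<beta> T (\<lambda>t. sqrt (\<tau> + h) * lin I (a t) x + z t) \<partial>gauss I)
     - (\<integral>x. lse \<beta> T (\<lambda>t. sqrt \<tau> * lin I (a t) x + z t)
          + \<beta> / 4 * h * gibbs_incr \<beta> T I a (\<lambda>t. sqrt \<tau> * lin I (a t) x + z t) \<partial>gauss I)\<bar>
    \<le> \<beta>\<^sup>2 * sqrt h ^ 3 * third_moments T I a"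
proof -
  interpret G: prob_space "gauss I" by (rule prob_space_gauss)
  interpret GG: pair_prob_space "gauss I" "gauss I" by standard
  define c s where "c = sqrt \<tau> / sqrt (\<tau> + h)" and "s = sqrt h / sqrt (\<tau> + h)"
  have cs: "c\<^sup>2 + s\<^sup>2 = 1" "sqrt (\<tau> + h) * c = sqrt \<tau>" "sqrt (\<tau> + h) * s = sqrt h"
    using assms(5,6) by (simp_all add: c_def s_def power_divide add_divide_distrib[symmetric])
  have fstI: "integrable (gauss I \<Otimes>\<^sub>M gauss I) (\<lambda>p. lin I b (fst p))" for b
    using integrable_distr[of fst "gauss I \<Otimes>\<^sub>M gauss I" "gauss I" "lin I b"]
      integrable_lin[OF I, of b] by (simp add: G.distr_pair_fst)
  have sndI: "integrable (gauss I \<Otimes>\<^sub>M gauss I) (\<lambda>p. lin I b (snd p))" for b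
    using GG.integrable_product_swap[OF fstI[of b]] by (simp add: case_prod_unfold)
  have "(\<integral>x. lse \<beta> T (\<lambda>t. sqrt (\<tau> + h) * lin I (a t) x + z t) \<partial>gauss I)
    = (\<integral>p. lse \<beta> T (\<lambda>t. sqrt (\<tau> + h) * lin I (a t) (\<lambda>i\<in>I. c * fst p i + s * snd p i) + z t)
        \<partial>(gauss I \<Otimes>\<^sub>M gauss I))"
    unfolding lse_def by (rule gauss_convolution[OF I cs(1)]) measurable
  also have "\<dots> = (\<integral>p. lse \<beta> T (\<lambda>t. (sqrt \<tau> * lin I (a t) (fst p) + z t) + sqrt h * lin I (a t) (snd p))
        \<partial>(gauss I \<Otimes>\<^sub>M gauss I))"
    by (simp add: lin_comb distrib_left mult.assoc[symmetric] cs add_ac)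
  also have "\<dots> = (\<integral>x. (\<integral>y. lse \<beta> T (\<lambda>t. (sqrt \<tau> * lin I (a t) x + z t) + sqrt h * lin I (a t) y) \<partial>gauss I) \<partial>gauss I)"
  proof (subst GG.integral_fst'[symmetric])
    show "integrable (gauss I \<Otimes>\<^sub>M gauss I)
       (\<lambda>p. lse \<beta> T (\<lambda>t. (sqrt \<tau> * lin I (a t) (fst p) + z t) + sqrt h * lin I (a t) (snd p)))"
      by (intro GG.integrable_lse T assms(4) Bochner_Integration.integrable_add integrable_mult_right fstI sndI
        GG.integrable_const)
  qed simp
  finally have eq: "(\<integral>x. lse \<beta> T (\<lambda>t. sqrt (\<tau> + h) * lin I (a t) x + z t) \<partial>gauss I) = \<dots>" .
  show ?thesis
    unfolding eq
  proof (rule G.integral_diff_le)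
    have "integrable (gauss I \<Otimes>\<^sub>M gauss I)
       (\<lambda>p. lse \<beta> T (\<lambda>t. (sqrt \<tau> * lin I (a t) (fst p) + z t) + sqrt h * lin I (a t) (snd p)))"
      by (intro GG.integrable_lse T assms(4) Bochner_Integration.integrable_add integrable_mult_right fstI sndI
        GG.integrable_const)
    from GG.integrable_fst'[OF this]
    show "integrable (gauss I)
      (\<lambda>x. \<integral>y. lse \<beta> T (\<lambda>t. (sqrt \<tau> * lin I (a t) x + z t) + sqrt h * lin I (a t) y) \<partial>gauss I)"
      by simp
    show "integrable (gauss I) (\<lambda>x. lse \<beta> T (\<lambda>t. sqrt \<tau> * lin I (a t) x + z t)
          + \<beta> / 4 * h * gibbs_incr \<beta> T I a (\<lambda>t. sqrt \<tau> * lin I (a t) x + z t))"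
      using T assms(4) integrable_lin[OF I]
      by (intro Bochner_Integration.integrable_add integrable_mult_right G.integrable_lse G.integrable_gibbs_incr) auto
    show "\<bar>(\<integral>y. lse \<beta> T (\<lambda>t. (sqrt \<tau> * lin I (a t) x + z t) + sqrt h * lin I (a t) y) \<partial>gauss I)
       - (lse \<beta> T (\<lambda>t. sqrt \<tau> * lin I (a t) x + z t)
          + \<beta> / 4 * h * gibbs_incr \<beta> T I a (\<lambda>t. sqrt \<tau> * lin I (a t) x + z t))\<bar>
      \<le> \<beta>\<^sup>2 * sqrt h ^ 3 * third_moments T I a" for x
      using integral_lse_small_increment[OF I T assms(4), of "sqrt h" "\<lambda>t. sqrt \<tau> * lin I (a t) x + z t" a] assms(6)
      by simp
  qed
qed

text \<open>Errors of order h^(3/2) disappear in the sum: \<open>n\<close> steps of length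
  \<open>1 / n\<close> accumulate only \<open>C / sqrt n\<close>. Monotonicity thus follows without
  differentiating \<psi>.\<close>

lemma real_nonincreasing_by_small_steps:
  fixes \<psi> :: "real \<Rightarrow> real"
  assumes step: "\<And>t h. 0 \<le> t \<Longrightarrow> 0 < h \<Longrightarrow> t + h \<le> 1 \<Longrightarrow> \<psi> (t + h) \<le> \<psi> t + C * sqrt h ^ 3"
  shows "\<psi> 1 \<le> \<psi> 0"
proof (rule field_le_epsilon)
  fix e :: real assume "0 < e"
  have n_bound: "\<psi> 1 \<le> \<psi> 0 + C / sqrt n" if n: "0 < n" for n :: nat
  proof -
    define h where "h = 1 / real n"
    have "\<psi> (k * h) \<le> \<psi> 0 + k * (C * sqrt h ^ 3)" if "k \<le> n" for k :: nat
      using that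
    proof (induction k)
      case (Suc k)
      have "\<psi> (real k * h + h) \<le> \<psi> (real k * h) + C * sqrt h ^ 3"
      proof (rule step)
        show "real k * h + h \<le> 1" using Suc.prems n by (simp add: h_def field_simps)
      qed (use n in \<open>auto simp: h_def\<close>)
      then show ?case using Suc by (simp add: algebra_simps)
    qed simp
    from this[of n] have "\<psi> 1 \<le> \<psi> 0 + n * (C * sqrt h ^ 3)"
      using n by (simp add: h_def)
    also have "n * (C * sqrt h ^ 3) = C / sqrt n"
      using n by (simp add: h_def real_sqrt_divide power3_eq_cube)
    finally show ?thesis .
  qed
  have "(\<lambda>n. C / sqrt (real n)) \<longlonglongrightarrow> 0"
    by real_asymp
  then have "eventually (\<lambda>n. C / sqrt (real n) < e) sequentially"
    using \<open>0 < e\<close> by (rule order_tendstoD)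
  with eventually_gt_at_top[of 0] have "eventually (\<lambda>n. \<psi> 1 \<le> \<psi> 0 + e) sequentially"
  proof eventually_elim
    case (elim n) then show ?case using n_bound[of n] by simp
  qed
  then show "\<psi> 1 \<le> \<psi> 0 + e" by simp
qed

definition gmax :: "'i set \<Rightarrow> 't set \<Rightarrow> ('t \<Rightarrow> 'i \<Rightarrow> real) \<Rightarrow> ('t \<Rightarrow> real) \<Rightarrow> real" where
  "gmax I T a c = (\<integral>x. Max ((\<lambda>t. lin I (a t) x + c t) ` T) \<partial>gauss I)"

text \<open>The interpolation \<open>sqrt \<tau> X + sqrt (1 - \<tau>) Y\<close> moves variance from
  \<open>Y\<close> to \<open>X\<close>. Each unit of variance raises the mean of \<open>lse\<close>
  by \<open>\<beta> / 4\<close> times the Gibbs average of the increments, which is smaller for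
  \<open>X\<close>; so the mean is nonincreasing in \<tau>.\<close>

lemma lse_comparison:
  assumes I: "finite I" and J: "finite J" and T: "finite T" "T \<noteq> {}" and \<beta>: "0 < \<beta>"
    and le: "\<And>s t. s \<in> T \<Longrightarrow> t \<in> T \<Longrightarrow> incr I a s t \<le> incr J b s t"
  shows "(\<integral>x. lse \<beta> T (\<lambda>t. lin I (a t) x + c t) \<partial>gauss I) \<le> (\<integral>y. lse \<beta> T (\<lambda>t. lin J (b t) y + c t) \<partial>gauss J)"
proof -
  interpret G: prob_space "gauss I" by (rule prob_space_gauss)
  interpret H: prob_space "gauss J" by (rule prob_space_gauss)
  interpret GH: pair_prob_space "gauss I" "gauss J" by standard
  have fstI: "integrable (gauss I \<Otimes>\<^sub>M gauss J) (\<lambda>p. lin I b (fst p))" for b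
    using integrable_distr[of fst "gauss I \<Otimes>\<^sub>M gauss J" "gauss I" "lin I b"]
      integrable_lin[OF I, of b] by (simp add: H.distr_pair_fst)
  have sndI: "integrable (gauss I \<Otimes>\<^sub>M gauss J) (\<lambda>p. lin J b (snd p))" for b
  proof -
    interpret HG: pair_prob_space "gauss J" "gauss I" by standard
    have "integrable (gauss J \<Otimes>\<^sub>M gauss I) (\<lambda>p. lin J b (fst p))"
      using integrable_distr[of fst "gauss J \<Otimes>\<^sub>M gauss I" "gauss J" "lin J b"]
        integrable_lin[OF J, of b] by (simp add: G.distr_pair_fst)
    from HG.integrable_product_swap[OF this] show ?thesis by (simp add: case_prod_unfold)
  qed
  define z where "z \<tau> \<upsilon> p t = sqrt \<tau> * lin I (a t) (fst p) + (sqrt \<upsilon> * lin J (b t) (snd p) + c t)"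
    for \<tau> \<upsilon> and p :: "('a \<Rightarrow> real) \<times> ('b \<Rightarrow> real)" and t
  define \<psi> where "\<psi> \<tau> = (\<integral>p. lse \<beta> T (z \<tau> (1 - \<tau>) p) \<partial>(gauss I \<Otimes>\<^sub>M gauss J))" for \<tau>
  have zI: "integrable (gauss I \<Otimes>\<^sub>M gauss J) (\<lambda>p. z \<tau> \<upsilon> p t)" for \<tau> \<upsilon> t
    unfolding z_def using fstI sndI by auto
  have lI: "integrable (gauss I \<Otimes>\<^sub>M gauss J) (\<lambda>p. lse \<beta> T (z \<tau> \<upsilon> p))" for \<tau> \<upsilon>
    using GH.integrable_lse[OF T \<beta>, of "\<lambda>t p. z \<tau> \<upsilon> p t"] zI by simp
  have gI: "integrable (gauss I \<Otimes>\<^sub>M gauss J) (\<lambda>p. gibbs_incr \<beta> T K d (z \<tau> \<upsilon> p))"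
    for \<tau> \<upsilon> and K :: "'d set" and d
    using GH.integrable_gibbs_incr[OF T, of "\<lambda>t p. z \<tau> \<upsilon> p t" \<beta> K d] zI[THEN borel_measurable_integrable] by simp
  have gle: "gibbs_incr \<beta> T I a y \<le> gibbs_incr \<beta> T J b y" for y
    unfolding gibbs_incr_def by (intro sum_mono mult_left_mono le) (auto simp: gibbs_nonneg)
  let ?K = "\<beta>\<^sup>2 * third_moments T I a + \<beta>\<^sup>2 * third_moments T J b"
  have "\<psi> 1 \<le> \<psi> 0"
  proof (rule real_nonincreasing_by_small_steps[where C = ?K])
    fix \<tau> h :: real assume th: "0 \<le> \<tau>" "0 < h" "\<tau> + h \<le> 1"
    \<comment> \<open>Both \<open>\<psi> (\<tau> + h)\<close> and \<open>\<psi> \<tau>\<close> are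
      compared with one common state in which the variance \<open>h\<close> is missing: the first
      restores it through the \<open>I\<close>-process, the second through the
      \<open>J\<close>-process.\<close>
    define \<upsilon> where "\<upsilon> = 1 - \<tau> - h"
    have \<upsilon>: "0 \<le> \<upsilon>" "1 - (\<tau> + h) = \<upsilon>" "1 - \<tau> = \<upsilon> + h" using th by (auto simp: \<upsilon>_def)
    let ?A = "\<lambda>p. lse \<beta> T (z \<tau> \<upsilon> p) + \<beta> / 4 * h * gibbs_incr \<beta> T I a (z \<tau> \<upsilon> p)"
    let ?B = "\<lambda>p. lse \<beta> T (z \<tau> \<upsilon> p) + \<beta> / 4 * h * gibbs_incr \<beta> T J b (z \<tau> \<upsilon> p)"
    have AI: "integrable (gauss I \<Otimes>\<^sub>M gauss J) ?A" and BI: "integrable (gauss I \<Otimes>\<^sub>M gauss J) ?B"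
      by (intro Bochner_Integration.integrable_add integrable_mult_right lI gI)+
    have "\<bar>\<psi> (\<tau> + h) - (\<integral>p. ?A p \<partial>(gauss I \<Otimes>\<^sub>M gauss J))\<bar> \<le> \<beta>\<^sup>2 * sqrt h ^ 3 * third_moments T I a"
    proof -
      have "\<psi> (\<tau> + h) = (\<integral>y. \<integral>x. lse \<beta> T (z (\<tau> + h) \<upsilon> (x, y)) \<partial>gauss I \<partial>gauss J)"
        unfolding \<psi>_def \<upsilon> using GH.integral_snd[of "\<lambda>x y. lse \<beta> T (z (\<tau> + h) \<upsilon> (x, y))"] lI by (simp add: case_prod_unfold)
      moreover have "(\<integral>p. ?A p \<partial>(gauss I \<Otimes>\<^sub>M gauss J)) = (\<integral>y. \<integral>x. ?A (x, y) \<partial>gauss I \<partial>gauss J)"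
        using GH.integral_snd[of "\<lambda>x y. ?A (x, y)"] AI by (simp add: case_prod_unfold)
      moreover have "\<bar>(\<integral>y. \<integral>x. lse \<beta> T (z (\<tau> + h) \<upsilon> (x, y)) \<partial>gauss I \<partial>gauss J)
          - (\<integral>y. \<integral>x. ?A (x, y) \<partial>gauss I \<partial>gauss J)\<bar> \<le> \<beta>\<^sup>2 * sqrt h ^ 3 * third_moments T I a"
      proof (rule H.integral_diff_le)
        show "integrable (gauss J) (\<lambda>y. \<integral>x. lse \<beta> T (z (\<tau> + h) \<upsilon> (x, y)) \<partial>gauss I)"
          using GH.integrable_snd[of "\<lambda>x y. lse \<beta> T (z (\<tau> + h) \<upsilon> (x, y))"] lI by (simp add: case_prod_unfold)
        show "integrable (gauss J) (\<lambda>y. \<integral>x. ?A (x, y) \<partial>gauss I)"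
          using GH.integrable_snd[of "\<lambda>x y. ?A (x, y)"] AI by (simp add: case_prod_unfold)
        show "\<bar>(\<integral>x. lse \<beta> T (z (\<tau> + h) \<upsilon> (x, y)) \<partial>gauss I) - (\<integral>x. ?A (x, y) \<partial>gauss I)\<bar>
          \<le> \<beta>\<^sup>2 * sqrt h ^ 3 * third_moments T I a" for y
          using integral_lse_variance_step[OF I T \<beta> th(1,2), of a "\<lambda>t. sqrt \<upsilon> * lin J (b t) y + c t"]
          by (simp add: z_def[abs_def])
      qed
      ultimately show ?thesis by simp
    qed
    moreover have "\<bar>\<psi> \<tau> - (\<integral>p. ?B p \<partial>(gauss I \<Otimes>\<^sub>M gauss J))\<bar> \<le> \<beta>\<^sup>2 * sqrt h ^ 3 * third_moments T J b"
    proof -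
      have "\<psi> \<tau> = (\<integral>x. \<integral>y. lse \<beta> T (z \<tau> (\<upsilon> + h) (x, y)) \<partial>gauss J \<partial>gauss I)"
        unfolding \<psi>_def \<upsilon> using GH.integral_fst[of "\<lambda>x y. lse \<beta> T (z \<tau> (\<upsilon> + h) (x, y))"] lI by (simp add: case_prod_unfold)
      moreover have "(\<integral>p. ?B p \<partial>(gauss I \<Otimes>\<^sub>M gauss J)) = (\<integral>x. \<integral>y. ?B (x, y) \<partial>gauss J \<partial>gauss I)"
        using GH.integral_fst[of "\<lambda>x y. ?B (x, y)"] BI by (simp add: case_prod_unfold)
      moreover have "\<bar>(\<integral>x. \<integral>y. lse \<beta> T (z \<tau> (\<upsilon> + h) (x, y)) \<partial>gauss J \<partial>gauss I)
          - (\<integral>x. \<integral>y. ?B (x, y) \<partial>gauss J \<partial>gauss I)\<bar> \<le> \<beta>\<^sup>2 * sqrt h ^ 3 * third_moments T J b"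
      proof (rule G.integral_diff_le)
        show "integrable (gauss I) (\<lambda>x. \<integral>y. lse \<beta> T (z \<tau> (\<upsilon> + h) (x, y)) \<partial>gauss J)"
          using GH.integrable_fst[of "\<lambda>x y. lse \<beta> T (z \<tau> (\<upsilon> + h) (x, y))"] lI by (simp add: case_prod_unfold)
        show "integrable (gauss I) (\<lambda>x. \<integral>y. ?B (x, y) \<partial>gauss J)"
          using GH.integrable_fst[of "\<lambda>x y. ?B (x, y)"] BI by (simp add: case_prod_unfold)
        show "\<bar>(\<integral>y. lse \<beta> T (z \<tau> (\<upsilon> + h) (x, y)) \<partial>gauss J) - (\<integral>y. ?B (x, y) \<partial>gauss J)\<bar>
          \<le> \<beta>\<^sup>2 * sqrt h ^ 3 * third_moments T J b" for x
          using integral_lse_variance_step[OF J T \<beta> \<upsilon>(1) th(2), of b "\<lambda>t. sqrt \<tau> * lin I (a t) x + c t"]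
          by (simp add: z_def[abs_def] add.left_commute)
      qed
      ultimately show ?thesis by simp
    qed
    moreover have "(\<integral>p. ?A p \<partial>(gauss I \<Otimes>\<^sub>M gauss J)) \<le> (\<integral>p. ?B p \<partial>(gauss I \<Otimes>\<^sub>M gauss J))"
      using th \<beta> by (intro integral_mono AI BI add_left_mono mult_left_mono gle) auto
    ultimately show "\<psi> (\<tau> + h) \<le> \<psi> \<tau> + ?K * sqrt h ^ 3"
      unfolding distrib_right by (simp add: mult_ac)
  qed
  moreover have "\<psi> 1 = (\<integral>x. lse \<beta> T (\<lambda>t. lin I (a t) x + c t) \<partial>gauss I)"
    using GH.integral_fst[of "\<lambda>x y. lse \<beta> T (\<lambda>t. lin I (a t) x + c t)"] lI[of 1 0]
    by (simp add: \<psi>_def z_def[abs_def] H.prob_space case_prod_unfold)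
  moreover have "\<psi> 0 = (\<integral>y. lse \<beta> T (\<lambda>t. lin J (b t) y + c t) \<partial>gauss J)"
    using GH.integral_snd[of "\<lambda>x y. lse \<beta> T (\<lambda>t. lin J (b t) y + c t)"] lI[of 0 1]
    by (simp add: \<psi>_def z_def[abs_def] G.prob_space case_prod_unfold)
  ultimately show ?thesis by simp
qed

lemma integrable_Max_lin:
  assumes "finite I" "finite T" "T \<noteq> {}"
  shows "integrable (gauss I) (\<lambda>x. Max ((\<lambda>t. lin I (a t) x + c t) ` T))"
proof -
  interpret G: prob_space "gauss I" by (rule prob_space_gauss)
  show ?thesis using assms integrable_lin[OF assms(1)] by (intro G.integrable_Max) auto
qed

text \<open>The soft comparison passes to the maximum at low temperature. The deterministic field
  \<open>c\<close> is common to both sides and plays no part in the increments.\<close>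

theorem sudakov_fernique:
  assumes I: "finite I" and J: "finite J" and T: "finite T" "T \<noteq> {}"
    and le: "\<And>s t. s \<in> T \<Longrightarrow> t \<in> T \<Longrightarrow> incr I a s t \<le> incr J b s t"
  shows "gmax I T a c \<le> gmax J T b c"
proof (rule field_le_epsilon)
  interpret G: prob_space "gauss I" by (rule prob_space_gauss)
  interpret H: prob_space "gauss J" by (rule prob_space_gauss)
  fix e :: real assume "0 < e"
  \<comment> \<open>The summand 1 keeps \<beta> positive when \<open>T\<close> is a
    singleton.\<close>
  define \<beta> where "\<beta> = (ln (card T) + 1) / e"
  have card: "0 \<le> ln (card T)" using T by (simp add: Suc_le_eq card_gt_0_iff)
  then have \<beta>: "0 < \<beta>" "ln (card T) / \<beta> \<le> e"
    using \<open>0 < e\<close> by (auto simp: \<beta>_def field_simps intro!: divide_pos_pos add_nonneg_pos)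
  have "gmax I T a c \<le> (\<integral>x. lse \<beta> T (\<lambda>t. lin I (a t) x + c t) \<partial>gauss I)"
    unfolding gmax_def using T \<beta> integrable_lin[OF I] I
    by (intro integral_mono G.integrable_lse lse_ge_Max integrable_Max_lin) auto
  also have "\<dots> \<le> (\<integral>y. lse \<beta> T (\<lambda>t. lin J (b t) y + c t) \<partial>gauss J)"
    by (rule lse_comparison[OF I J T \<beta>(1) le])
  also have "\<dots> \<le> (\<integral>y. Max ((\<lambda>t. lin J (b t) y + c t) ` T) + ln (card T) / \<beta> \<partial>gauss J)"
    using T \<beta> integrable_lin[OF J] J
    by (intro integral_mono H.integrable_lse lse_le_Max Bochner_Integration.integrable_add integrable_Max_lin) auto
  also have "\<dots> = gmax J T b c + ln (card T) / \<beta>"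
    using integrable_Max_lin[OF J T] by (simp add: gmax_def H.prob_space)
  finally show "gmax I T a c \<le> gmax J T b c + e" using \<beta>(2) by simp
qed

section \<open>Concentration of Gaussian maxima\<close>

abbreviation lmax :: "'i set \<Rightarrow> 't set \<Rightarrow> ('t \<Rightarrow> 'i \<Rightarrow> real) \<Rightarrow> ('i \<Rightarrow> real) \<Rightarrow> real" where
  "lmax I T a x \<equiv> Max ((\<lambda>t. lin I (a t) x) ` T)"

lemma exp_lmax_le:
  assumes "finite T" "T \<noteq> {}"
  shows "exp (s * lmax I T a x) \<le> (\<Sum>t\<in>T. exp (lin I (\<lambda>i. s * a t i) x))"
proof -
  have "lmax I T a x \<in> (\<lambda>t. lin I (a t) x) ` T" using assms by (intro Max_in) auto
  then obtain t where "t \<in> T" "lmax I T a x = lin I (a t) x" by auto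
  then show ?thesis
    using member_le_sum[of t T "\<lambda>t. exp (lin I (\<lambda>i. s * a t i) x)"] assms by (simp add: lin_scale)
qed

lemma integrable_exp_lin: "finite I \<Longrightarrow> integrable (gauss I) (\<lambda>x. exp (lin I b x))"
  using lin_has_bochner_integral_exp[of I b] by (simp add: has_bochner_integral_iff)

lemma integral_exp_lin: "finite I \<Longrightarrow> (\<integral>x. exp (lin I b x) \<partial>gauss I) = exp ((\<Sum>i\<in>I. (b i)\<^sup>2) / 2)"
  using lin_has_bochner_integral_exp[of I b] by (simp add: has_bochner_integral_iff)

lemma lmax_measurable: "finite T \<Longrightarrow> lmax I T a \<in> borel_measurable (gauss I)"
  by measurable

lemma integrable_exp_lmax:
  assumes "finite I" "finite T" "T \<noteq> {}"
  shows "integrable (gauss I) (\<lambda>x. exp (s * lmax I T a x))"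
proof (rule Bochner_Integration.integrable_bound)
  show "integrable (gauss I) (\<lambda>x. \<Sum>t\<in>T. exp (lin I (\<lambda>i. s * a t i) x))"
    by (intro Bochner_Integration.integrable_sum integrable_exp_lin assms)
  show "(\<lambda>x. exp (s * lmax I T a x)) \<in> borel_measurable (gauss I)"
    using lmax_measurable[OF assms(2), of I a] by measurable
  show "AE x in gauss I. norm (exp (s * lmax I T a x)) \<le> norm (\<Sum>t\<in>T. exp (lin I (\<lambda>i. s * a t i) x))"
    using exp_lmax_le[OF assms(2,3), of s I a] by (intro AE_I2) (simp add: sum_nonneg abs_of_nonneg)
qed

lemma integral_exp_lmax_le:
  assumes "finite I" "finite T" "T \<noteq> {}" and v: "\<And>t. t \<in> T \<Longrightarrow> (\<Sum>i\<in>I. (a t i)\<^sup>2) \<le> v"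
  shows "(\<integral>x. exp (s * lmax I T a x) \<partial>gauss I) \<le> card T * exp (s\<^sup>2 * v / 2)"
proof -
  have "(\<integral>x. exp (s * lmax I T a x) \<partial>gauss I) \<le> (\<integral>x. (\<Sum>t\<in>T. exp (lin I (\<lambda>i. s * a t i) x)) \<partial>gauss I)"
    by (intro integral_mono integrable_exp_lmax Bochner_Integration.integrable_sum integrable_exp_lin
        assms exp_lmax_le)
  also have "\<dots> = (\<Sum>t\<in>T. exp (s\<^sup>2 * (\<Sum>i\<in>I. (a t i)\<^sup>2) / 2))"
    using assms(1) by (simp add: integrable_exp_lin integral_exp_lin power_mult_distrib sum_distrib_left)
  also have "\<dots> \<le> (\<Sum>t\<in>T. exp (s\<^sup>2 * v / 2))"
    by (intro sum_mono) (simp add: mult_left_mono v)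
  finally show ?thesis by simp
qed

text \<open>First moment method: the exponential moment of the maximum is at most the sum over
  \<open>T\<close>. The parameter \<open>s\<close> stays free so that each application can balance
  entropy against variance.\<close>

lemma gmax_le:
  assumes "finite I" "finite T" "T \<noteq> {}" and v: "\<And>t. t \<in> T \<Longrightarrow> (\<Sum>i\<in>I. (a t i)\<^sup>2) \<le> v" and "0 < s"
  shows "gmax I T a (\<lambda>_. 0) \<le> ln (card T) / s + s * v / 2"
proof -
  interpret G: prob_space "gauss I" by (rule prob_space_gauss)
  define \<Lambda> where "\<Lambda> = card T * exp (s\<^sup>2 * v / 2)"
  have \<Lambda>: "0 < \<Lambda>" "ln \<Lambda> = ln (card T) + s\<^sup>2 * v / 2"
    using assms(2,3) by (simp_all add: \<Lambda>_def card_gt_0_iff ln_mult)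
  have int: "integrable (gauss I) (lmax I T a)"
    using integrable_Max_lin[OF assms(1-3), of a "\<lambda>_. 0"] by simp
  \<comment> \<open>Jensen's inequality in pointwise form: the tangent of \<open>exp\<close> at
    \<open>ln \<Lambda>\<close>.\<close>
  have pt: "s * lmax I T a x \<le> ln \<Lambda> + exp (s * lmax I T a x) / \<Lambda> - 1" for x
    using exp_ge_add_one_self[of "s * lmax I T a x - ln \<Lambda>"] \<Lambda>(1) by (simp add: exp_diff)
  have "s * gmax I T a (\<lambda>_. 0) = (\<integral>x. s * lmax I T a x \<partial>gauss I)"
    by (simp add: gmax_def)
  also have "\<dots> \<le> (\<integral>x. ln \<Lambda> + exp (s * lmax I T a x) / \<Lambda> - 1 \<partial>gauss I)"
    using int integrable_exp_lmax[OF assms(1-3), of s a] pt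
    by (intro integral_mono) auto
  also have "\<dots> = ln \<Lambda> + (\<integral>x. exp (s * lmax I T a x) \<partial>gauss I) / \<Lambda> - 1"
    using integrable_exp_lmax[OF assms(1-3), of s a] by (simp add: G.prob_space)
  also have "\<dots> \<le> ln \<Lambda>"
    using integral_exp_lmax_le[OF assms(1-4), where s = s] \<Lambda>(1) by (simp add: \<Lambda>_def[symmetric])
  finally show ?thesis using \<Lambda>(2) \<open>0 < s\<close> by (simp add: field_simps power2_eq_square)
qed

lemma lmax_cong: "(\<And>i. i \<in> I \<Longrightarrow> x i = y i) \<Longrightarrow> lmax I T a x = lmax I T a y"
  using lin_cong[of I x y] by (simp cong: image_cong_simp)

text \<open>The maximiser for \<open>x\<close> still competes after the rotation, so the drop of the
  maximum is bounded by a linear functional of \<open>y\<close> whose exponential moment is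
  explicit. The other term carries \<open>1 - cos \<delta>\<close>, which is of second order in the
  angle.\<close>

lemma lmax_rotation_step:
  assumes "finite I" "finite T" "T \<noteq> {}" and v: "\<And>t. t \<in> T \<Longrightarrow> (\<Sum>i\<in>I. (a t i)\<^sup>2) \<le> v"
    and r: "0 \<le> r"
  shows "(\<integral>\<^sup>+y. ennreal (exp (r * (lmax I T a x - lmax I T a (\<lambda>i\<in>I. cos \<delta> * x i - sin \<delta> * y i)))) \<partial>gauss I)
    \<le> ennreal (exp (r * (1 - cos \<delta>) * lmax I T a x) * exp ((r * sin \<delta>)\<^sup>2 * v / 2))"
proof -
  have "lmax I T a x \<in> (\<lambda>t. lin I (a t) x) ` T" using assms by (intro Max_in) auto
  then obtain t where t: "t \<in> T" "lmax I T a x = lin I (a t) x" by auto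
  have le: "lmax I T a x - lmax I T a (\<lambda>i\<in>I. cos \<delta> * x i - sin \<delta> * y i)
    \<le> (1 - cos \<delta>) * lmax I T a x + sin \<delta> * lin I (a t) y" for y
  proof -
    have "lin I (a t) (\<lambda>i\<in>I. cos \<delta> * x i - sin \<delta> * y i) \<le> lmax I T a (\<lambda>i\<in>I. cos \<delta> * x i - sin \<delta> * y i)"
      using t(1) assms by (intro Max_ge) auto
    moreover have "lin I (a t) (\<lambda>i\<in>I. cos \<delta> * x i - sin \<delta> * y i) = cos \<delta> * lin I (a t) x - sin \<delta> * lin I (a t) y"
      using lin_comb[of I "a t" "cos \<delta>" x "- sin \<delta>" y] by simp
    ultimately show ?thesis by (simp add: t(2) algebra_simps)
  qed
  have "(\<integral>\<^sup>+y. ennreal (exp (r * (lmax I T a x - lmax I T a (\<lambda>i\<in>I. cos \<delta> * x i - sin \<delta> * y i)))) \<partial>gauss I)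
    \<le> (\<integral>\<^sup>+y. ennreal (exp (r * (1 - cos \<delta>) * lmax I T a x)) * ennreal (exp (lin I (\<lambda>i. r * sin \<delta> * a t i) y)) \<partial>gauss I)"
  proof (rule nn_integral_mono)
    fix y
    have "r * (lmax I T a x - lmax I T a (\<lambda>i\<in>I. cos \<delta> * x i - sin \<delta> * y i))
      \<le> r * (1 - cos \<delta>) * lmax I T a x + lin I (\<lambda>i. r * sin \<delta> * a t i) y"
      using mult_left_mono[OF le[of y] r] by (simp add: lin_scale distrib_left mult.assoc)
    then show "ennreal (exp (r * (lmax I T a x - lmax I T a (\<lambda>i\<in>I. cos \<delta> * x i - sin \<delta> * y i))))
      \<le> ennreal (exp (r * (1 - cos \<delta>) * lmax I T a x)) * ennreal (exp (lin I (\<lambda>i. r * sin \<delta> * a t i) y))"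
      by (simp add: ennreal_mult[symmetric] exp_add[symmetric] ennreal_leI)
  qed
  also have "\<dots> = ennreal (exp (r * (1 - cos \<delta>) * lmax I T a x)) * ennreal (exp ((\<Sum>i\<in>I. (r * sin \<delta> * a t i)\<^sup>2) / 2))"
    using integrable_exp_lin[OF assms(1), of "\<lambda>i. r * sin \<delta> * a t i"]
      integral_exp_lin[OF assms(1), of "\<lambda>i. r * sin \<delta> * a t i"]
    by (simp add: nn_integral_cmult nn_integral_eq_integral)
  also have "\<dots> \<le> ennreal (exp (r * (1 - cos \<delta>) * lmax I T a x)) * ennreal (exp ((r * sin \<delta>)\<^sup>2 * v / 2))"
    using mult_left_mono[OF v[OF t(1)], of "(r * sin \<delta>)\<^sup>2"]
    by (intro mult_left_mono ennreal_leI) (simp_all add: power_mult_distrib sum_distrib_left)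
  finally show ?thesis by (simp add: ennreal_mult)
qed

lemma one_minus_cos_le: "1 - cos x \<le> x\<^sup>2 / 2" for x :: real
proof -
  have "1 - cos x = 2 * (sin (x / 2))\<^sup>2"
    using cos_double_sin[of "x / 2"] by simp
  also have "\<dots> \<le> 2 * (x / 2)\<^sup>2"
    using abs_sin_x_le_abs_x[of "x / 2"] by (subst (asm) abs_le_square_iff) simp
  finally show ?thesis by (simp add: power2_eq_square)
qed

lemma exp_mean_le_mean_exp:
  fixes p :: "nat \<Rightarrow> real"
  assumes "0 < n"
  shows "exp (\<Sum>j<n. p j) \<le> (\<Sum>j<n. exp (n * p j)) / n"
proof -
  define m where "m = (\<Sum>j<n. p j)"
  have "(\<Sum>j<n. exp m * (1 + (n * p j - m))) \<le> (\<Sum>j<n. exp (n * p j))"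
  proof (rule sum_mono)
    fix j
    have "exp m * (1 + (n * p j - m)) \<le> exp m * exp (n * p j - m)"
      using exp_ge_add_one_self by (intro mult_left_mono) auto
    then show "exp m * (1 + (n * p j - m)) \<le> exp (n * p j)" by (simp add: exp_diff)
  qed
  also have "(\<Sum>j<n. exp m * (1 + (n * p j - m))) = n * exp m"
    by (simp add: sum_distrib_left[symmetric] sum.distrib sum_subtractf m_def[symmetric])
  finally show ?thesis using assms by (simp add: m_def field_simps)
qed

text \<open>The Maurey-Pisier argument in discrete form. A quarter turn carries one copy to the
  other; it is cut into \<open>n\<close> equal rotations, convexity averages the exponential of the
  telescoping sum, and rotation invariance gives all steps the same mean. As
  \<open>n * \<delta> = pi / 2\<close>, the quadratic part of the exponent becomes
  \<open>pi\<^sup>2 * s\<^sup>2 * v / 8\<close>.\<close>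

lemma exp_lmax_difference_steps:
  fixes n :: nat and s :: real
  assumes I: "finite I" and T: "finite T" "T \<noteq> {}" and v: "\<And>t. t \<in> T \<Longrightarrow> (\<Sum>i\<in>I. (a t i)\<^sup>2) \<le> v" "0 \<le> v"
    and s: "0 \<le> s" and n: "0 < n" "s * pi\<^sup>2 / 8 \<le> n"
  shows "(\<integral>\<^sup>+x. \<integral>\<^sup>+y. ennreal (exp (s * (lmax I T a y - lmax I T a x))) \<partial>gauss I \<partial>gauss I)
    \<le> ennreal (exp (pi\<^sup>2 * s\<^sup>2 * v / 8) * (1 + s * pi\<^sup>2 / (8 * real n) * (card T * exp (v / 2))))"
proof -
  interpret G: prob_space "gauss I" by (rule prob_space_gauss)
  define \<delta> where "\<delta> = pi / (2 * n)"
  have [measurable]: "lmax I T a \<in> borel_measurable (gauss I)" by (rule lmax_measurable[OF T(1)])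
  let ?F = "lmax I T a" and ?P = "gauss I \<Otimes>\<^sub>M gauss I"
  \<comment> \<open>The second-order loss of one step, amplified by the factor \<open>n * s\<close>
    from the averaging. The lower bound on \<open>n\<close> makes it at most 1, so that convexity
    gives \<open>exp (\<epsilon> * F) \<le> 1 + \<epsilon> * exp F\<close>.\<close>
  define \<epsilon> where "\<epsilon> = n * s * (1 - cos \<delta>)"
  have ns: "0 \<le> real n * s" using s by (intro mult_nonneg_nonneg) auto
  have "\<epsilon> \<le> n * s * (\<delta>\<^sup>2 / 2)"
    unfolding \<epsilon>_def by (intro mult_left_mono one_minus_cos_le ns)
  also have "\<dots> = s * pi\<^sup>2 / (8 * real n)"
    using n by (simp add: \<delta>_def power2_eq_square)
  finally have \<epsilon>: "\<epsilon> \<le> s * pi\<^sup>2 / (8 * real n)" .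
  have \<epsilon>0: "0 \<le> \<epsilon>" using s by (simp add: \<epsilon>_def)
  have "s * pi\<^sup>2 / (8 * real n) \<le> 1" using n by (simp add: field_simps)
  with \<epsilon> have \<epsilon>1: "\<epsilon> \<le> 1" by linarith
  define R where "R j = gauss_rot I (cos (real j * \<delta>)) (sin (real j * \<delta>))" for j
  have [measurable]: "R j \<in> ?P \<rightarrow>\<^sub>M ?P" for j unfolding R_def by measurable
  have Rd: "distr ?P ?P (R j) = ?P" for j
    unfolding R_def by (rule distr_gauss_rot[OF I]) (simp add: sin_cos_squared_add2)
  define H where "H q = ennreal (exp (n * s * (?F (fst q) - ?F (\<lambda>i\<in>I. cos \<delta> * fst q i - sin \<delta> * snd q i))))" for q
  have [measurable]: "H \<in> borel_measurable ?P"
  proof -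
    have [measurable]: "(\<lambda>q. \<lambda>i\<in>I. cos \<delta> * fst q i - sin \<delta> * snd q i) \<in> ?P \<rightarrow>\<^sub>M gauss I"
      by measurable
    show ?thesis unfolding H_def by measurable
  qed
  \<comment> \<open>Each state is seen from its successor, rotated back by \<delta>: this is the
    form treated in \<open>lmax_rotation_step\<close>.\<close>
  have prev: "?F (fst (R j p)) = ?F (\<lambda>i\<in>I. cos \<delta> * fst (R (Suc j) p) i - sin \<delta> * snd (R (Suc j) p) i)" for j p
  proof (rule lmax_cong)
    fix i assume i: "i \<in> I"
    have e: "real j * \<delta> = real (Suc j) * \<delta> - \<delta>" by (simp add: algebra_simps)
    show "fst (R j p) i = (\<lambda>i\<in>I. cos \<delta> * fst (R (Suc j) p) i - sin \<delta> * snd (R (Suc j) p) i) i"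
      using i unfolding R_def gauss_rot_def case_prod_beta e cos_diff sin_diff
      by (simp add: algebra_simps)
  qed
  have ends: "?F (fst (R 0 p)) = ?F (fst p)" "?F (fst (R n p)) = ?F (snd p)" for p
    using n by (auto intro!: lmax_cong simp: R_def gauss_rot_def case_prod_beta \<delta>_def)
  have pt: "ennreal (exp (s * (?F (snd p) - ?F (fst p)))) \<le> (\<Sum>j<n. ennreal (1 / n) * H (R (Suc j) p))" for p
  proof -
    define f where "f j = ?F (fst (R j p))" for j
    have "(\<Sum>j<n. s * (f (Suc j) - f j)) = s * (f n - f 0)"
      by (simp add: sum_distrib_left[symmetric] sum_lessThan_telescope)
    then have "exp (s * (?F (snd p) - ?F (fst p))) = exp (\<Sum>j<n. s * (f (Suc j) - f j))"
      by (simp add: f_def ends)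
    also have "\<dots> \<le> (\<Sum>j<n. exp (n * (s * (f (Suc j) - f j)))) / n"
      by (rule exp_mean_le_mean_exp[OF n(1)])
    also have "\<dots> = (\<Sum>j<n. 1 / n * exp (n * s * (f (Suc j) - f j)))"
      by (simp add: sum_divide_distrib mult.assoc)
    finally have "ennreal (exp (s * (?F (snd p) - ?F (fst p))))
       \<le> ennreal (\<Sum>j<n. 1 / n * exp (n * s * (f (Suc j) - f j)))" by (rule ennreal_leI)
    also have "\<dots> = (\<Sum>j<n. ennreal (1 / n) * H (R (Suc j) p))"
      unfolding H_def prev[symmetric] f_def by (subst sum_ennreal[symmetric]) (simp_all add: ennreal_mult[symmetric])
    finally show ?thesis .
  qed
  have HR: "(\<integral>\<^sup>+p. H (R j p) \<partial>?P) = (\<integral>\<^sup>+p. H p \<partial>?P)" for j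
    using nn_integral_distr[of "R j" ?P ?P H] by (simp add: Rd)
  have "(\<integral>\<^sup>+x. \<integral>\<^sup>+y. ennreal (exp (s * (?F y - ?F x))) \<partial>gauss I \<partial>gauss I)
     = (\<integral>\<^sup>+p. ennreal (exp (s * (?F (snd p) - ?F (fst p)))) \<partial>?P)"
    by (subst G.nn_integral_fst[symmetric]) simp_all
  also have "\<dots> \<le> (\<integral>\<^sup>+p. (\<Sum>j<n. ennreal (1 / n) * H (R (Suc j) p)) \<partial>?P)"
    by (rule nn_integral_mono) (rule pt)
  also have "\<dots> = (\<Sum>j<n. ennreal (1 / n) * (\<integral>\<^sup>+p. H p \<partial>?P))"
    by (simp add: nn_integral_sum nn_integral_cmult HR)
  also have "\<dots> = (\<integral>\<^sup>+p. H p \<partial>?P)"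
    using n by (simp add: mult.assoc[symmetric] ennreal_of_nat_eq_real_of_nat ennreal_mult[symmetric])
  also have "\<dots> = (\<integral>\<^sup>+x. \<integral>\<^sup>+y. H (x, y) \<partial>gauss I \<partial>gauss I)"
    by (rule G.nn_integral_fst[symmetric]) measurable
  also have "\<dots> \<le> (\<integral>\<^sup>+x. ennreal (exp (\<epsilon> * ?F x) * exp ((n * s * sin \<delta>)\<^sup>2 * v / 2)) \<partial>gauss I)"
    unfolding H_def fst_conv snd_conv \<epsilon>_def
    by (intro nn_integral_mono lmax_rotation_step I T v ns)
  also have "\<dots> \<le> (\<integral>\<^sup>+x. ennreal ((1 + \<epsilon> * exp (?F x)) * exp (pi\<^sup>2 * s\<^sup>2 * v / 8)) \<partial>gauss I)"
  proof (intro nn_integral_mono ennreal_leI mult_mono)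
    show "exp (\<epsilon> * ?F x) \<le> 1 + \<epsilon> * exp (?F x)" for x
    proof -
      have "exp ((1 - \<epsilon>) *\<^sub>R 0 + \<epsilon> *\<^sub>R ?F x) \<le> (1 - \<epsilon>) * exp 0 + \<epsilon> * exp (?F x)"
        using \<epsilon>0 \<epsilon>1 by (intro convex_onD[OF exp_convex]) auto
      then show ?thesis using \<epsilon>0 by simp
    qed
    have "\<bar>n * s * sin \<delta>\<bar> \<le> n * s * \<delta>"
    proof -
      have "0 \<le> \<delta>" by (simp add: \<delta>_def)
      then show ?thesis
        using mult_left_mono[OF abs_sin_x_le_abs_x[of \<delta>] ns] ns unfolding abs_mult[of "n * s"] by simp
    qed
    then have "(n * s * sin \<delta>)\<^sup>2 \<le> (n * s * \<delta>)\<^sup>2"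
      using abs_le_square_iff by fastforce
    also have "\<dots> = pi\<^sup>2 * s\<^sup>2 / 4" using n by (simp add: \<delta>_def power2_eq_square)
    finally show "exp ((n * s * sin \<delta>)\<^sup>2 * v / 2) \<le> exp (pi\<^sup>2 * s\<^sup>2 * v / 8)"
      using mult_right_mono[OF _ v(2), of "(n * s * sin \<delta>)\<^sup>2" "pi\<^sup>2 * s\<^sup>2 / 4"] by (simp add: mult_ac)
  qed (use \<epsilon>0 in auto)
  also have "\<dots> = ennreal (\<integral>x. (1 + \<epsilon> * exp (?F x)) * exp (pi\<^sup>2 * s\<^sup>2 * v / 8) \<partial>gauss I)"
    using integrable_exp_lmax[OF I T, of 1 a] \<epsilon>0
    by (intro nn_integral_eq_integral) (auto intro!: AE_I2 mult_nonneg_nonneg add_nonneg_nonneg)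
  also have "(\<integral>x. (1 + \<epsilon> * exp (?F x)) * exp (pi\<^sup>2 * s\<^sup>2 * v / 8) \<partial>gauss I)
     = (1 + \<epsilon> * (\<integral>x. exp (?F x) \<partial>gauss I)) * exp (pi\<^sup>2 * s\<^sup>2 * v / 8)"
    using integrable_exp_lmax[OF I T, of 1 a] by (simp add: G.prob_space)
  also have "ennreal \<dots> \<le> ennreal (exp (pi\<^sup>2 * s\<^sup>2 * v / 8) * (1 + s * pi\<^sup>2 / (8 * real n) * (card T * exp (v / 2))))"
  proof (rule ennreal_leI)
    have "\<epsilon> * (\<integral>x. exp (?F x) \<partial>gauss I) \<le> s * pi\<^sup>2 / (8 * real n) * (card T * exp (v / 2))"
      using integral_exp_lmax_le[OF I T v(1), where s = 1] \<epsilon> s by (intro mult_mono) auto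
    then show "(1 + \<epsilon> * (\<integral>x. exp (?F x) \<partial>gauss I)) * exp (pi\<^sup>2 * s\<^sup>2 * v / 8)
      \<le> exp (pi\<^sup>2 * s\<^sup>2 * v / 8) * (1 + s * pi\<^sup>2 / (8 * real n) * (card T * exp (v / 2)))"
      by (simp add: mult.commute)
  qed
  finally show ?thesis .
qed

lemma (in prob_space) exp_integral_le_integral_exp:
  fixes f :: "'a \<Rightarrow> real"
  assumes "integrable M f" "integrable M (\<lambda>x. exp (f x))"
  shows "exp (\<integral>x. f x \<partial>M) \<le> (\<integral>x. exp (f x) \<partial>M)"
proof -
  define m where "m = (\<integral>x. f x \<partial>M)"
  have "exp m = (\<integral>x. exp m * (1 + (f x - m)) \<partial>M)"
    using assms(1) by (simp add: prob_space m_def)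
  also have "\<dots> \<le> (\<integral>x. exp (f x) \<partial>M)"
  proof (rule integral_mono)
    fix x
    have "exp m * (1 + (f x - m)) \<le> exp m * exp (f x - m)"
      by (intro mult_left_mono exp_ge_add_one_self) simp
    then show "exp m * (1 + (f x - m)) \<le> exp (f x)" by (simp add: exp_diff)
  qed (use assms in auto)
  finally show ?thesis by (simp add: m_def)
qed

text \<open>Independence splits the exponential moment of the difference of two copies into this
  product, and the error of the discrete rotation path vanishes as \<open>n\<close> grows.\<close>

lemma exp_lmax_two_sided:
  assumes I: "finite I" and T: "finite T" "T \<noteq> {}" and v: "\<And>t. t \<in> T \<Longrightarrow> (\<Sum>i\<in>I. (a t i)\<^sup>2) \<le> v" "0 \<le> v"
    and s: "0 \<le> s"
  shows "(\<integral>x. exp (s * lmax I T a x) \<partial>gauss I) * (\<integral>x. exp (- s * lmax I T a x) \<partial>gauss I) \<le> exp (pi\<^sup>2 * s\<^sup>2 * v / 8)"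
    (is "?A * ?B \<le> ?E")
proof (rule LIMSEQ_le_const)
  show "(\<lambda>n. ?E * (1 + s * pi\<^sup>2 / (8 * real n) * (card T * exp (v / 2)))) \<longlonglongrightarrow> ?E"
  proof -
    have "(\<lambda>n. s * pi\<^sup>2 / (8 * real n)) \<longlonglongrightarrow> 0" by real_asymp
    then have "(\<lambda>n. ?E * (1 + s * pi\<^sup>2 / (8 * real n) * (card T * exp (v / 2))))
      \<longlonglongrightarrow> ?E * (1 + 0 * (card T * exp (v / 2)))"
      by (intro tendsto_intros)
    then show ?thesis by simp
  qed
  have A0: "0 \<le> ?A" "0 \<le> ?B" by (simp_all add: integral_nonneg_AE)
  obtain n0 :: nat where n0: "s * pi\<^sup>2 / 8 \<le> n0" using real_arch_simple by blast
  show "\<exists>N. \<forall>n\<ge>N. ?A * ?B \<le> ?E * (1 + s * pi\<^sup>2 / (8 * real n) * (card T * exp (v / 2)))"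
  proof (intro exI allI impI)
    fix n assume n: "Suc n0 \<le> n"
    note [measurable] = lmax_measurable[OF T(1), of I a]
    have nn: "(\<integral>\<^sup>+y. ennreal (exp (r * lmax I T a y)) \<partial>gauss I) = ennreal (\<integral>y. exp (r * lmax I T a y) \<partial>gauss I)" for r
      using integrable_exp_lmax[OF I T, of r a] by (intro nn_integral_eq_integral) auto
    have "ennreal (?A * ?B) = (\<integral>\<^sup>+x. ennreal (exp (- s * lmax I T a x)) * (\<integral>\<^sup>+y. ennreal (exp (s * lmax I T a y)) \<partial>gauss I) \<partial>gauss I)"
      unfolding nn by (subst nn_integral_multc) (simp_all only: nn ennreal_mult[OF A0] mult.commute, measurable)
    also have "\<dots> = (\<integral>\<^sup>+x. \<integral>\<^sup>+y. ennreal (exp (s * (lmax I T a y - lmax I T a x))) \<partial>gauss I \<partial>gauss I)"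
      by (subst nn_integral_cmult[symmetric])
         (simp_all add: ennreal_mult[symmetric] exp_add[symmetric] algebra_simps)
    also have "\<dots> \<le> ennreal (?E * (1 + s * pi\<^sup>2 / (8 * real n) * (card T * exp (v / 2))))"
      by (rule exp_lmax_difference_steps) (use I T v s n n0 in auto)
    finally show "?A * ?B \<le> ?E * (1 + s * pi\<^sup>2 / (8 * real n) * (card T * exp (v / 2)))"
      using s by (subst (asm) ennreal_le_iff) (auto intro!: mult_nonneg_nonneg add_nonneg_nonneg)
  qed
qed

lemma gaussian_tail_bound:
  assumes "prob_space M" and [measurable]: "X \<in> borel_measurable M"
    and int: "\<And>s. 0 \<le> s \<Longrightarrow> integrable M (\<lambda>x. exp (s * X x))"
    and bound: "\<And>s. 0 \<le> s \<Longrightarrow> (\<integral>x. exp (s * X x) \<partial>M) \<le> exp (s * m + pi\<^sup>2 * s\<^sup>2 * v / 8)"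
    and "0 < v" "0 \<le> u"
  shows "measure M {x \<in> space M. m + u \<le> X x} \<le> exp (- (2 * u\<^sup>2 / (pi\<^sup>2 * v)))"
proof -
  interpret prob_space M by fact
  \<comment> \<open>The minimiser of the Chernoff exponent
    \<open>pi\<^sup>2 * s\<^sup>2 * v / 8 - s * u\<close>.\<close>
  define s where "s = 4 * u / (pi\<^sup>2 * v)"
  have s: "0 \<le> s" using assms by (simp add: s_def)
  have "measure M {x \<in> space M. m + u \<le> X x} \<le> measure M {x \<in> space M. exp (s * (m + u)) \<le> exp (s * X x)}"
    using s by (intro finite_measure_mono) (auto simp: mult_left_mono)
  also have "\<dots> \<le> (\<integral>x. exp (s * X x) \<partial>M) / exp (s * (m + u))"
    using int[OF s] by (intro integral_Markov_inequality_measure[where A = "{}"]) auto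
  also have "\<dots> \<le> exp (s * m + pi\<^sup>2 * s\<^sup>2 * v / 8) / exp (s * (m + u))"
    using bound[OF s] by (simp add: divide_right_mono)
  also have "\<dots> = exp (pi\<^sup>2 * s\<^sup>2 * v / 8 - s * u)"
    by (simp add: exp_diff[symmetric] algebra_simps)
  also have "pi\<^sup>2 * s\<^sup>2 * v / 8 - s * u = - (2 * u\<^sup>2 / (pi\<^sup>2 * v))"
    using assms(5) by (simp add: s_def power2_eq_square field_simps)
  finally show ?thesis .
qed

text \<open>Jensen bounds one factor of the two-sided estimate from below by
  \<open>exp (- s * m)\<close>, with \<open>m\<close> the mean. What remains is a sub-Gaussian
  moment bound around the mean, valid for both signs of \<open>s\<close>.\<close>

theorem gaussian_concentration_lmax:
  assumes I: "finite I" and T: "finite T" "T \<noteq> {}" and v: "\<And>t. t \<in> T \<Longrightarrow> (\<Sum>i\<in>I. (a t i)\<^sup>2) \<le> v" "0 < v"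
    and u: "0 \<le> u"
  shows "measure (gauss I) {x \<in> space (gauss I). u \<le> \<bar>lmax I T a x - gmax I T a (\<lambda>_. 0)\<bar>}
    \<le> 2 * exp (- (2 * u\<^sup>2 / (pi\<^sup>2 * v)))"
proof -
  interpret G: prob_space "gauss I" by (rule prob_space_gauss)
  note [measurable] = lmax_measurable[OF T(1), of I a]
  let ?F = "lmax I T a" and ?m = "gmax I T a (\<lambda>_. 0)"
  have m: "?m = (\<integral>x. ?F x \<partial>gauss I)" by (simp add: gmax_def)
  have Fint: "integrable (gauss I) ?F" using integrable_Max_lin[OF I T, of a "\<lambda>_. 0"] by simp
  have jensen: "exp (r * ?m) \<le> (\<integral>x. exp (r * ?F x) \<partial>gauss I)" for r
    using G.exp_integral_le_integral_exp[of "\<lambda>x. r * ?F x"] Fint integrable_exp_lmax[OF I T, of r a]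
    by (simp add: m)
  have bnd: "(\<integral>x. exp (s * ?F x) \<partial>gauss I) \<le> exp (s * ?m + pi\<^sup>2 * s\<^sup>2 * v / 8)" for s
  proof -
    have two: "(\<integral>x. exp (s * ?F x) \<partial>gauss I) * (\<integral>x. exp (- s * ?F x) \<partial>gauss I) \<le> exp (pi\<^sup>2 * s\<^sup>2 * v / 8)"
      using exp_lmax_two_sided[OF I T v(1), where s = "\<bar>s\<bar>"] v(2) by (cases "0 \<le> s") (auto simp: mult.commute)
    have "(\<integral>x. exp (s * ?F x) \<partial>gauss I) * exp (- s * ?m) \<le> exp (pi\<^sup>2 * s\<^sup>2 * v / 8)"
      by (rule order_trans[OF mult_left_mono two]) (use jensen[of "- s"] in \<open>auto simp: integral_nonneg_AE\<close>)
    from mult_right_mono[OF this, of "exp (s * ?m)"]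
    have "(\<integral>x. exp (s * ?F x) \<partial>gauss I) * (exp (- s * ?m) * exp (s * ?m)) \<le> exp (pi\<^sup>2 * s\<^sup>2 * v / 8) * exp (s * ?m)"
      by (simp add: mult.assoc)
    then show ?thesis by (simp only: exp_add[symmetric]) (simp add: add.commute)
  qed
  have up: "measure (gauss I) {x \<in> space (gauss I). ?m + u \<le> ?F x} \<le> exp (- (2 * u\<^sup>2 / (pi\<^sup>2 * v)))"
    by (rule gaussian_tail_bound[OF prob_space_gauss _ integrable_exp_lmax[OF I T] bnd v(2) u]) measurable
  have down: "measure (gauss I) {x \<in> space (gauss I). - ?m + u \<le> - ?F x} \<le> exp (- (2 * u\<^sup>2 / (pi\<^sup>2 * v)))"
    using integrable_exp_lmax[OF I T, of "- s" a for s] bnd[of "- s" for s]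
    by (intro gaussian_tail_bound[OF prob_space_gauss _ _ _ v(2) u]) auto
  have "measure (gauss I) {x \<in> space (gauss I). u \<le> \<bar>?F x - ?m\<bar>}
    \<le> measure (gauss I) ({x \<in> space (gauss I). ?m + u \<le> ?F x} \<union> {x \<in> space (gauss I). - ?m + u \<le> - ?F x})"
    by (intro G.finite_measure_mono) auto
  also have "\<dots> \<le> measure (gauss I) {x \<in> space (gauss I). ?m + u \<le> ?F x}
      + measure (gauss I) {x \<in> space (gauss I). - ?m + u \<le> - ?F x}"
    by (intro measure_Un_le) measurable
  also have "\<dots> \<le> 2 * exp (- (2 * u\<^sup>2 / (pi\<^sup>2 * v)))" using up down by simp
  finally show ?thesis .
qed

text \<open>The density \<open>Z\<close> of the shifted law is truncated at \<open>K\<close>: below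
  the level it contributes at most \<open>K\<close> times the measure of \<open>A\<close>, above it
  at most \<open>Z ^ 3 / K\<^sup>2\<close>. The third power matters. Against a probability of order
  \<rho> it allows the total \<rho>^(2/3), while a second moment would allow only
  \<rho>^(1/2).\<close>

lemma measure_gauss_shift_le:
  assumes I: "finite I" and [measurable]: "A \<in> sets (gauss I)" and "0 < K"
  shows "measure (gauss I) {x \<in> space (gauss I). (\<lambda>i\<in>I. x i + r i) \<in> A}
    \<le> K * measure (gauss I) A + exp (3 * (\<Sum>i\<in>I. (r i)\<^sup>2)) / K\<^sup>2"
proof -
  interpret G: prob_space "gauss I" by (rule prob_space_gauss)
  define R where "R = (\<Sum>i\<in>I. (r i)\<^sup>2)"
  have [measurable]: "(\<lambda>x. \<lambda>i\<in>I. x i + r i) \<in> gauss I \<rightarrow>\<^sub>M gauss I" by measurable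
  let ?Z = "\<lambda>x. exp (lin I r x - R / 2)"
  have Z3: "?Z x ^ 3 = exp (- (3 * R / 2)) * exp (lin I (\<lambda>i. 3 * r i) x)" for x
    unfolding lin_scale by (simp add: exp_of_nat_mult[symmetric] exp_add[symmetric] algebra_simps)
  have Z3int: "integrable (gauss I) (\<lambda>x. ?Z x ^ 3)"
    unfolding Z3 by (intro integrable_mult_right integrable_exp_lin I)
  have Z3val: "(\<integral>x. ?Z x ^ 3 \<partial>gauss I) = exp (3 * R)"
  proof -
    have "(\<Sum>i\<in>I. (3 * r i)\<^sup>2) = 9 * R"
      by (simp add: R_def power_mult_distrib sum_distrib_left)
    then have "(\<integral>x. exp (lin I (\<lambda>i. 3 * r i) x) \<partial>gauss I) = exp (9 * R / 2)"
      by (simp add: integral_exp_lin[OF I])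
    then have "(\<integral>x. ?Z x ^ 3 \<partial>gauss I) = exp (- (3 * R / 2)) * exp (9 * R / 2)"
      unfolding Z3 by simp
    then show ?thesis by (simp add: exp_add[symmetric])
  qed
  have young: "indicator A x * ?Z x \<le> K * indicator A x + ?Z x ^ 3 / K\<^sup>2" for x
  proof (cases "?Z x \<le> K")
    case True
    have nonneg: "0 \<le> ?Z x ^ 3 / K\<^sup>2" by simp
    show ?thesis
      using add_increasing2[OF nonneg True] nonneg by (cases "x \<in> A") simp_all
  next
    case False
    have "K\<^sup>2 \<le> (?Z x)\<^sup>2" using False assms(3) by (intro power_mono) auto
    then have "?Z x * K\<^sup>2 \<le> ?Z x * (?Z x)\<^sup>2" by (intro mult_left_mono) auto
    then have "?Z x \<le> ?Z x ^ 3 / K\<^sup>2"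
      using assms(3) by (simp add: field_simps power3_eq_cube power2_eq_square)
    moreover have "indicator A x * ?Z x \<le> ?Z x" by (auto simp: indicator_def)
    moreover have "0 \<le> K * indicator A x" using assms(3) by simp
    ultimately show ?thesis by linarith
  qed
  have bint: "integrable (gauss I) (\<lambda>x. K * indicator A x + ?Z x ^ 3 / K\<^sup>2)"
    by (intro Bochner_Integration.integrable_add integrable_mult_right integrable_divide Z3int
        integrable_real_indicator) (simp_all add: G.emeasure_eq_measure)
  have "ennreal (measure (gauss I) {x \<in> space (gauss I). (\<lambda>i\<in>I. x i + r i) \<in> A})
    = (\<integral>\<^sup>+x. indicator A (\<lambda>i\<in>I. x i + r i) \<partial>gauss I)"
  proof -
    have "(\<integral>\<^sup>+x. indicator A (\<lambda>i\<in>I. x i + r i) \<partial>gauss I)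
      = (\<integral>\<^sup>+x. indicator {x \<in> space (gauss I). (\<lambda>i\<in>I. x i + r i) \<in> A} x \<partial>gauss I)"
      by (intro nn_integral_cong) (auto simp: indicator_def)
    then show ?thesis by (simp add: G.emeasure_eq_measure)
  qed
  also have "\<dots> = (\<integral>\<^sup>+x. indicator A x * ennreal (?Z x) \<partial>gauss I)"
    unfolding R_def by (rule nn_integral_gauss_shift[OF I]) measurable
  also have "\<dots> \<le> (\<integral>\<^sup>+x. ennreal (K * indicator A x + ?Z x ^ 3 / K\<^sup>2) \<partial>gauss I)"
  proof (rule nn_integral_mono)
    fix x
    have "indicator A x * ennreal (?Z x) = ennreal (indicator A x * ?Z x)"
      by (auto simp: indicator_def)
    then show "indicator A x * ennreal (?Z x) \<le> ennreal (K * indicator A x + ?Z x ^ 3 / K\<^sup>2)"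
      using ennreal_leI[OF young[of x]] by simp
  qed
  also have "\<dots> = ennreal (\<integral>x. K * indicator A x + ?Z x ^ 3 / K\<^sup>2 \<partial>gauss I)"
    using assms(3) by (intro nn_integral_eq_integral bint) (auto intro!: AE_I2 add_nonneg_nonneg)
  also have "(\<integral>x. K * indicator A x + ?Z x ^ 3 / K\<^sup>2 \<partial>gauss I) = K * measure (gauss I) A + exp (3 * R) / K\<^sup>2"
    by (subst Bochner_Integration.integral_add)
       (auto intro!: integrable_mult_right integrable_divide Z3int integrable_real_indicator
         simp: G.emeasure_eq_measure Z3val simp del: integral_mult_right_zero)
  finally show ?thesis
    using assms(3) by (subst (asm) ennreal_le_iff) (auto simp: R_def)
qed

section \<open>Sparse sets and their covariance\<close>

definition pairs :: "nat \<Rightarrow> (nat \<times> nat) set" where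
  "pairs n = {(i, j). i \<le> j \<and> j < n}"

text \<open>The coefficients of \<open>sqrt n\<close> times the Hamiltonian of the indicator of
  \<open>A\<close> in standard normal entries: an off-diagonal entry is counted twice, a diagonal
  one has doubled variance. With these weights the covariance is exactly
  \<open>2 * (card (A \<inter> B))\<^sup>2\<close>, without a diagonal correction.\<close>

definition coef :: "nat set \<Rightarrow> nat \<times> nat \<Rightarrow> real" where
  "coef A = (\<lambda>(i, j). if i \<in> A \<and> j \<in> A then if i = j then sqrt 2 else 2 else 0)"

lemma finite_pairs [simp, intro]: "finite (pairs n)"
  by (rule finite_subset[of _ "{..<n} \<times> {..<n}"]) (auto simp: pairs_def)

lemma sum_pairs_symmetric:
  fixes f :: "nat \<Rightarrow> nat \<Rightarrow> real"
  assumes "\<And>i j. f i j = f j i"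
  shows "(\<Sum>i<n. \<Sum>j<n. f i j) = (\<Sum>(i, j)\<in>pairs n. if i = j then f i j else 2 * f i j)"
proof -
  let ?L = "{(i, j). i < j \<and> j < n}" and ?U = "{(i, j). j < i \<and> i < n}" and ?D = "{(i, j). i = j \<and> j < n}"
  have fin: "finite ?L" "finite ?U" "finite ?D"
    by (rule finite_subset[of _ "{..<n} \<times> {..<n}"]; auto)+
  have "(\<Sum>i<n. \<Sum>j<n. f i j) = (\<Sum>(i, j)\<in>{..<n} \<times> {..<n}. f i j)"
    by (simp add: sum.cartesian_product)
  also have "{..<n} \<times> {..<n} = (?L \<union> ?U) \<union> ?D" by auto
  also have "(\<Sum>(i, j)\<in>(?L \<union> ?U) \<union> ?D. f i j)
    = (\<Sum>(i, j)\<in>?L. f i j) + (\<Sum>(i, j)\<in>?U. f i j) + (\<Sum>(i, j)\<in>?D. f i j)"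
    using fin by (subst sum.union_disjoint; (subst sum.union_disjoint)?) auto
  also have "(\<Sum>(i, j)\<in>?U. f i j) = (\<Sum>(i, j)\<in>?L. f i j)"
    by (rule sum.reindex_bij_witness[of _ prod.swap prod.swap]) (auto simp: assms)
  also have "(\<Sum>(i, j)\<in>?L. f i j) + (\<Sum>(i, j)\<in>?L. f i j) = (\<Sum>(i, j)\<in>?L. if i = j then f i j else 2 * f i j)"
    unfolding sum.distrib[symmetric] by (rule sum.cong) auto
  also have "(\<Sum>(i, j)\<in>?D. f i j) = (\<Sum>(i, j)\<in>?D. if i = j then f i j else 2 * f i j)"
    by (rule sum.cong) auto
  also have "(\<Sum>(i, j)\<in>?L. if i = j then f i j else 2 * f i j) + \<dots>
    = (\<Sum>(i, j)\<in>?L \<union> ?D. if i = j then f i j else 2 * f i j)"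
    using fin by (subst sum.union_disjoint) auto
  also have "?L \<union> ?D = pairs n" by (auto simp: pairs_def)
  finally show ?thesis .
qed

lemma coef_inner:
  assumes "A \<subseteq> {..<n}" "B \<subseteq> {..<n}"
  shows "(\<Sum>e\<in>pairs n. coef A e * coef B e) = 2 * (real (card (A \<inter> B)))\<^sup>2"
proof -
  let ?\<chi> = "\<lambda>i. if i \<in> A \<inter> B then 1 else 0 :: real"
  have "(\<Sum>e\<in>pairs n. coef A e * coef B e)
    = (\<Sum>(i, j)\<in>pairs n. if i = j then 2 * ?\<chi> i * ?\<chi> j else 2 * (2 * ?\<chi> i * ?\<chi> j))"
    by (rule sum.cong) (auto simp: coef_def)
  also have "\<dots> = (\<Sum>i<n. \<Sum>j<n. 2 * ?\<chi> i * ?\<chi> j)"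
    by (rule sum_pairs_symmetric[symmetric]) simp
  also have "\<dots> = 2 * ((\<Sum>i<n. ?\<chi> i) * (\<Sum>j<n. ?\<chi> j))"
    by (simp add: sum_product sum_distrib_left mult_ac)
  also have "(\<Sum>i<n. ?\<chi> i) = card (A \<inter> B)"
  proof -
    have "{..<n} \<inter> {i. i \<in> A \<inter> B} = A \<inter> B" using assms by auto
    then show ?thesis by (simp add: sum.If_cases)
  qed
  finally show ?thesis by (simp add: power2_eq_square)
qed

lemma sum_coef_square: "A \<subseteq> {..<n} \<Longrightarrow> (\<Sum>e\<in>pairs n. (coef A e)\<^sup>2) = 2 * (real (card A))\<^sup>2"
  using coef_inner[of A n A] by (simp add: power2_eq_square)

lemma incr_coef:
  assumes "A \<subseteq> {..<n}" "B \<subseteq> {..<n}"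
  shows "incr (pairs n) coef A B
    = 2 * (real (card A))\<^sup>2 + 2 * (real (card B))\<^sup>2 - 4 * (real (card (A \<inter> B)))\<^sup>2"
  using sum_coef_square[OF assms(1)] sum_coef_square[OF assms(2)] coef_inner[OF assms]
  unfolding incr_def power2_diff
  by (simp add: sum.distrib sum_subtractf sum_distrib_left[symmetric] mult.assoc)

lemma gmax_reindex: "gmax I (p ` T) a c = gmax I T (\<lambda>t. a (p t)) (\<lambda>t. c (p t))"
  by (simp add: gmax_def image_image)

lemma gmax_cong:
  assumes "\<And>t. t \<in> T \<Longrightarrow> c t = d t" shows "gmax I T a c = gmax I T a d"
  unfolding gmax_def using assms by (simp cong: image_cong_simp)

lemma gmax_scale:
  assumes "finite T" "T \<noteq> {}" "0 \<le> r"
  shows "gmax I T (\<lambda>t i. r * a t i) (\<lambda>t. r * c t) = r * gmax I T a c"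
proof -
  have "Max ((\<lambda>t. lin I (\<lambda>i. r * a t i) x + r * c t) ` T) = r * Max ((\<lambda>t. lin I (a t) x + c t) ` T)" for x
  proof -
    have "r * Max ((\<lambda>t. lin I (a t) x + c t) ` T) = Max ((\<lambda>y. r * y) ` (\<lambda>t. lin I (a t) x + c t) ` T)"
      using assms by (intro mono_Max_commute) (auto intro!: monoI mult_left_mono)
    then show ?thesis by (simp add: image_image lin_scale distrib_left)
  qed
  then show ?thesis by (simp add: gmax_def)
qed

lemma gmax_mono_subset:
  assumes "finite I" "finite T'" "T \<subseteq> T'" "T \<noteq> {}"
  shows "gmax I T a c \<le> gmax I T' a c"
  unfolding gmax_def
proof (rule integral_mono)
  show "integrable (gauss I) (\<lambda>x. Max ((\<lambda>t. lin I (a t) x + c t) ` T))"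
    using assms by (intro integrable_Max_lin) (auto intro: finite_subset)
  show "integrable (gauss I) (\<lambda>x. Max ((\<lambda>t. lin I (a t) x + c t) ` T'))"
    using assms by (intro integrable_Max_lin) auto
qed (use assms in \<open>auto intro!: Max_mono\<close>)

lemma gmax_nonneg:
  assumes "finite I" "finite T" "T \<noteq> {}"
  shows "0 \<le> gmax I T a (\<lambda>_. 0)"
proof -
  obtain t where t: "t \<in> T" using assms by auto
  have "gmax I {t} a (\<lambda>_. 0) \<le> gmax I T a (\<lambda>_. 0)"
    using assms t by (intro gmax_mono_subset) auto
  then show ?thesis by (simp add: gmax_def integral_lin[OF assms(1)])
qed

text \<open>The increments depend only on the sizes of intersections, so Sudakov-Fernique applied in
  both directions gives equality. No measure-preserving map of the disorder has to be
  constructed.\<close>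

lemma gmax_coef_invariant:
  assumes "finite T" "T \<noteq> {}" "T \<subseteq> Pow {..<n}" "p ` T \<subseteq> Pow {..<n'}"
    and p: "\<And>A B. A \<in> T \<Longrightarrow> B \<in> T \<Longrightarrow> card (p A \<inter> p B) = card (A \<inter> B)"
  shows "gmax (pairs n') (p ` T) coef c = gmax (pairs n) T coef (\<lambda>A. c (p A))"
proof -
  have "incr (pairs n') (\<lambda>A. coef (p A)) A B = incr (pairs n) coef A B" if "A \<in> T" "B \<in> T" for A B
  proof -
    have "incr (pairs n') (\<lambda>A. coef (p A)) A B = incr (pairs n') coef (p A) (p B)"
      by (simp add: incr_def)
    moreover have "p A \<subseteq> {..<n'}" "p B \<subseteq> {..<n'}" "A \<subseteq> {..<n}" "B \<subseteq> {..<n}"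
      using that assms(3,4) by auto
    ultimately show ?thesis
      using p[of A A] p[of B B] p[OF that] that by (simp add: incr_coef)
  qed
  then have "gmax (pairs n') T (\<lambda>A. coef (p A)) (\<lambda>A. c (p A)) = gmax (pairs n) T coef (\<lambda>A. c (p A))"
    using assms by (intro antisym sudakov_fernique) auto
  then show ?thesis by (simp add: gmax_reindex)
qed

definition emax :: "nat \<Rightarrow> nat set set \<Rightarrow> real" where
  "emax n T = gmax (pairs n) T coef (\<lambda>_. 0)"

definition symdist :: "'a set \<Rightarrow> 'a set \<Rightarrow> nat" where
  "symdist A B = card (A - B) + card (B - A)"

text \<open>The increment is a sum of differences of squares, each with a factor of at most
  \<open>2 * n\<close>. Hence the variance of a difference grows only linearly in the distance of
  the sets.\<close>

lemma incr_coef_le_symdist: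
  assumes "A \<subseteq> {..<n}" "B \<subseteq> {..<n}"
  shows "incr (pairs n) coef A B \<le> 4 * real n * symdist A B"
proof -
  have fin: "finite A" "finite B" using assms finite_subset by blast+
  have "card A \<le> n" "card B \<le> n" using assms card_mono[of "{..<n}"] by fastforce+
  have dA: "real (card A) = real (card (A \<inter> B)) + real (card (A - B))"
    using card_Int_Diff[OF fin(1), of B] by simp
  have dB: "real (card B) = real (card (A \<inter> B)) + real (card (B - A))"
    using card_Int_Diff[OF fin(2), of A] by (simp add: Int_commute)
  have step: "x\<^sup>2 - r\<^sup>2 \<le> 2 * real n * d" if "x = r + d" "x \<le> n" "0 \<le> d" for x r d :: real
  proof -
    have "x\<^sup>2 - r\<^sup>2 = (x + r) * d" using that by (simp add: power2_eq_square algebra_simps)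
    also have "\<dots> \<le> (2 * real n) * d" using that by (intro mult_right_mono) auto
    finally show ?thesis .
  qed
  have "incr (pairs n) coef A B = 2 * ((real (card A))\<^sup>2 - (real (card (A \<inter> B)))\<^sup>2)
    + 2 * ((real (card B))\<^sup>2 - (real (card (A \<inter> B)))\<^sup>2)"
    unfolding incr_coef[OF assms] by simp
  also have "\<dots> \<le> 2 * (2 * real n * card (A - B)) + 2 * (2 * real n * card (B - A))"
    using step[OF dA] step[OF dB] \<open>card A \<le> n\<close> \<open>card B \<le> n\<close> by simp
  finally show ?thesis by (simp add: symdist_def algebra_simps)
qed

text \<open>The uniform modulus of continuity of the noise. There are at most \<open>4 ^ n\<close>
  pairs, each of variance at most \<open>4 * n * d\<close>, and \<open>s = 1 / sqrt d\<close>
  balances entropy against variance.\<close>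

lemma gmax_coef_diff_le:
  fixes d :: real
  assumes P: "P \<subseteq> Pow {..<n} \<times> Pow {..<n}" "P \<noteq> {}" and d: "0 < d" "\<And>A B. (A, B) \<in> P \<Longrightarrow> symdist A B \<le> d"
  shows "gmax (pairs n) P (\<lambda>(A, B) e. coef A e - coef B e) (\<lambda>_. 0) \<le> 4 * real n * sqrt d"
proof -
  have fin: "finite P" using P finite_subset by blast
  have "card P \<le> card (Pow {..<n} \<times> Pow {..<n})" using P by (intro card_mono) auto
  also have "\<dots> = 4 ^ n" by (simp add: card_Pow card_cartesian_product power_mult_distrib[symmetric])
  finally have "real (card P) \<le> 4 ^ n" by (metis of_nat_le_iff of_nat_numeral of_nat_power)
  moreover have "0 < card P" using fin P by (simp add: card_gt_0_iff)
  ultimately have "ln (card P) \<le> ln (4 ^ n)" by (subst ln_le_cancel_iff) auto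
  also have "\<dots> = n * ln (2 ^ 2)" by (simp add: ln_realpow)
  also have "ln (2 ^ 2) = 2 * ln (2 :: real)" by (subst ln_realpow) auto
  also have "real n * (2 * ln 2) \<le> real n * 2" using ln_2_less_1 by (intro mult_left_mono) auto
  finally have ln: "ln (card P) \<le> 2 * real n" by simp
  have "gmax (pairs n) P (\<lambda>(A, B) e. coef A e - coef B e) (\<lambda>_. 0)
    \<le> ln (card P) / (1 / sqrt d) + 1 / sqrt d * (4 * real n * d) / 2"
  proof (rule gmax_le[OF finite_pairs fin P(2)])
    fix t assume t: "t \<in> P"
    obtain A B where AB: "t = (A, B)" by force
    have "(\<Sum>e\<in>pairs n. (coef A e - coef B e)\<^sup>2) \<le> 4 * real n * symdist A B"
      using incr_coef_le_symdist[of A n B] t AB P by (auto simp: incr_def)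
    also have "\<dots> \<le> 4 * real n * d"
      using d(2)[of A B] t AB by (intro mult_left_mono) auto
    finally show "(\<Sum>e\<in>pairs n. ((case t of (A, B) \<Rightarrow> \<lambda>e. coef A e - coef B e) e)\<^sup>2) \<le> 4 * real n * d"
      by (simp add: AB)
  qed (use d in simp)
  also have "1 / sqrt d * (4 * real n * d) / 2 = 2 * real n * sqrt d"
    using d by (simp add: field_simps)
  also have "ln (card P) / (1 / sqrt d) \<le> 2 * real n * sqrt d"
    using ln d by (simp add: mult_right_mono)
  finally show ?thesis by simp
qed

text \<open>Every candidate may be moved by distance \<open>d\<close> at the price of the uniform
  modulus of continuity. After division by \<open>n * sqrt n\<close> the price is negligible as soon
  as \<open>d\<close> is small compared with \<open>n\<close>.\<close>

lemma emax_le_emax_neighbour: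
  fixes d :: real
  assumes "T \<subseteq> Pow {..<n}" "T' \<subseteq> Pow {..<n}" "T \<noteq> {}" "0 < d"
    and near: "\<And>A. A \<in> T \<Longrightarrow> \<exists>B\<in>T'. symdist A B \<le> d"
  shows "emax n T \<le> emax n T' + 4 * real n * sqrt d"
proof -
  let ?P = "{(A, B). A \<in> T \<and> B \<in> T' \<and> real (symdist A B) \<le> d}" and ?D = "\<lambda>(A, B) e. coef A e - coef B e"
  have fin: "finite T" "finite T'" using assms finite_subset by blast+
  have P: "?P \<subseteq> Pow {..<n} \<times> Pow {..<n}" "?P \<noteq> {}" using assms by fastforce+
  then have finP: "finite ?P" by (meson finite_Pow_iff finite_SigmaI finite_lessThan finite_subset)
  have "T' \<noteq> {}" using assms by fastforce
  note int = integrable_Max_lin[OF finite_pairs, of _ n coef "\<lambda>_. 0", simplified]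
  have "emax n T \<le> (\<integral>x. lmax (pairs n) T' coef x + lmax (pairs n) ?P ?D x \<partial>gauss (pairs n))"
    unfolding emax_def gmax_def add_0_right
  proof (rule integral_mono)
    show "integrable (gauss (pairs n)) (\<lambda>x. lmax (pairs n) T' coef x + lmax (pairs n) ?P ?D x)"
      using integrable_Max_lin[OF finite_pairs finP P(2), of n ?D "\<lambda>_. 0"] int[OF fin(2) \<open>T' \<noteq> {}\<close>]
      by (simp del: lin_diff)
    fix x
    have "lmax (pairs n) T coef x \<in> (\<lambda>A. lin (pairs n) (coef A) x) ` T"
      using fin assms by (intro Max_in) auto
    then obtain A where A: "A \<in> T" "lmax (pairs n) T coef x = lin (pairs n) (coef A) x" by auto
    obtain B where B: "B \<in> T'" "symdist A B \<le> d" using near[OF A(1)] by auto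
    have "lin (pairs n) (?D (A, B)) x \<le> lmax (pairs n) ?P ?D x"
      using A B finP by (intro Max_ge finite_imageI imageI) auto
    moreover have "lin (pairs n) (coef B) x \<le> lmax (pairs n) T' coef x"
      using B fin by (intro Max_ge) auto
    ultimately show "lmax (pairs n) T coef x \<le> lmax (pairs n) T' coef x + lmax (pairs n) ?P ?D x"
      using A(2) by (simp add: lin_diff)
  qed (use int fin assms in simp)
  also have "\<dots> = emax n T' + gmax (pairs n) ?P ?D (\<lambda>_. 0)"
    using integrable_Max_lin[OF finite_pairs finP P(2), of n ?D "\<lambda>_. 0"] int[OF fin(2) \<open>T' \<noteq> {}\<close>]
    by (simp add: emax_def gmax_def)
  also have "\<dots> \<le> emax n T' + 4 * real n * sqrt d"
    using gmax_coef_diff_le[OF P assms(4)] by simp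
  finally show ?thesis .
qed

section \<open>Block systems\<close>

definition concat_blocks :: "nat \<Rightarrow> nat \<Rightarrow> (nat \<Rightarrow> nat set) \<Rightarrow> nat set" where
  "concat_blocks m b f = (\<Union>i<b. (\<lambda>j. i * m + j) ` f i)"

lemma block_index_inj:
  fixes j j' m :: nat
  assumes "i * m + j = i' * m + j'" "j < m" "j' < m" shows "i = i' \<and> j = j'"
proof -
  have "(i * m + j) div m = i" using assms(2) by simp
  moreover have "(i' * m + j') div m = i'" using assms(3) by simp
  ultimately have "i = i'" using assms(1) by metis
  then show ?thesis using assms(1) by simp
qed

lemma concat_blocks_subset:
  assumes "\<And>i. i < b \<Longrightarrow> f i \<subseteq> {..<m}" shows "concat_blocks m b f \<subseteq> {..<m * b}"
proof
  fix x assume "x \<in> concat_blocks m b f"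
  then obtain i j where ij: "i < b" "j \<in> f i" "x = i * m + j" by (auto simp: concat_blocks_def)
  then have "j < m" using assms by auto
  then have "x < (i + 1) * m" using ij by simp
  also have "\<dots> \<le> b * m" using ij by (intro mult_right_mono) auto
  finally show "x \<in> {..<m * b}" by (simp add: mult.commute)
qed

lemma concat_blocks_Int:
  assumes "\<And>i. i < b \<Longrightarrow> f i \<subseteq> {..<m}" "\<And>i. i < b \<Longrightarrow> g i \<subseteq> {..<m}"
  shows "concat_blocks m b f \<inter> concat_blocks m b g = concat_blocks m b (\<lambda>i. f i \<inter> g i)"
proof
  show "concat_blocks m b f \<inter> concat_blocks m b g \<subseteq> concat_blocks m b (\<lambda>i. f i \<inter> g i)"
  proof
    fix x assume "x \<in> concat_blocks m b f \<inter> concat_blocks m b g"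
    then obtain i j i' j' where x: "i < b" "j \<in> f i" "x = i * m + j" "i' < b" "j' \<in> g i'" "x = i' * m + j'"
      unfolding concat_blocks_def by blast
    have "i = i' \<and> j = j'" using x assms by (intro block_index_inj[of i m j i' j']) auto
    then show "x \<in> concat_blocks m b (\<lambda>i. f i \<inter> g i)" using x by (auto simp: concat_blocks_def)
  qed
qed (auto simp: concat_blocks_def)

lemma card_concat_blocks:
  assumes "\<And>i. i < b \<Longrightarrow> f i \<subseteq> {..<m}"
  shows "card (concat_blocks m b f) = (\<Sum>i<b. card (f i))"
proof -
  have "card (concat_blocks m b f) = (\<Sum>i<b. card ((\<lambda>j. i * m + j) ` f i))"
    unfolding concat_blocks_def
  proof (rule card_UN_disjoint)
    show "\<forall>i\<in>{..<b}. finite ((\<lambda>j. i * m + j) ` f i)"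
      using assms by (auto intro!: finite_imageI intro: finite_subset)
    show "\<forall>i\<in>{..<b}. \<forall>j\<in>{..<b}. i \<noteq> j \<longrightarrow> (\<lambda>k. i * m + k) ` f i \<inter> (\<lambda>k. j * m + k) ` f j = {}"
      using assms block_index_inj by blast
  qed simp
  also have "\<dots> = (\<Sum>i<b. card (f i))" by (intro sum.cong card_image) (auto simp: inj_on_def)
  finally show ?thesis .
qed

text \<open>The covariance \<open>2 * card (A \<inter> B)\<^sup>2\<close> is convex in the overlap, so \<open>b\<close> independent systems of size
  \<open>m\<close> have larger increments than the concatenated system of size \<open>m * b\<close>.\<close>

lemma emax_concat_blocks:
  assumes T: "T \<subseteq> Pow {..<m}" "T \<noteq> {}" "\<And>A. A \<in> T \<Longrightarrow> card A = k" and b: "0 < b"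
  shows "real b * sqrt b * emax m T \<le> emax (m * b) (concat_blocks m b ` ({..<b} \<rightarrow>\<^sub>E T))"
proof -
  let ?F = "{..<b} \<rightarrow>\<^sub>E T" and ?J = "{..<b} \<times> pairs m" and ?I = "pairs (m * b)"
  have fin: "finite T" "finite ?F" using T finite_subset by (blast, intro finite_PiE, auto intro: finite_subset)
  have Fne: "?F \<noteq> {}" using T(2) by (simp add: PiE_eq_empty_iff)
  define y where "y f = (\<lambda>(i, e). coef (f i) e)" for f :: "nat \<Rightarrow> nat set"
  \<comment> \<open>The factor \<open>1 / sqrt b\<close> equalises the variances: both processes
    have variance \<open>2 * b * k\<^sup>2\<close>. The increments then differ only through the
    overlaps, which Cauchy-Schwarz compares.\<close>
  define x where "x f e = 1 / sqrt b * coef (concat_blocks m b f) e" for f e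
  have Fsub: "f i \<subseteq> {..<m}" "card (f i) = k" if "f \<in> ?F" "i < b" for f i
  proof -
    have "f i \<in> T" using that by auto
    then show "f i \<subseteq> {..<m}" "card (f i) = k" using T by auto
  qed
  have incr_y: "incr ?J y f g = (\<Sum>i<b. 4 * (real k)\<^sup>2 - 4 * (real (card (f i \<inter> g i)))\<^sup>2)"
    if "f \<in> ?F" "g \<in> ?F" for f g
  proof -
    have "incr ?J y f g = (\<Sum>i<b. incr (pairs m) coef (f i) (g i))"
      by (simp add: incr_def y_def sum.cartesian_product case_prod_unfold)
    also have "\<dots> = (\<Sum>i<b. 4 * (real k)\<^sup>2 - 4 * (real (card (f i \<inter> g i)))\<^sup>2)"
      using that Fsub by (intro sum.cong refl) (simp add: incr_coef)
    finally show ?thesis .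
  qed
  have incr_x: "incr ?I x f g = 4 * real b * (real k)\<^sup>2 - 4 / real b * (\<Sum>i<b. real (card (f i \<inter> g i)))\<^sup>2"
    if "f \<in> ?F" "g \<in> ?F" for f g
  proof -
    have "incr ?I x f g = 1 / real b * incr ?I coef (concat_blocks m b f) (concat_blocks m b g)"
      by (simp add: incr_def x_def sum_distrib_left right_diff_distrib[symmetric] power_mult_distrib
          power_divide diff_divide_distrib[symmetric])
    also have "incr ?I coef (concat_blocks m b f) (concat_blocks m b g)
      = 4 * (real b * real k)\<^sup>2 - 4 * (\<Sum>i<b. real (card (f i \<inter> g i)))\<^sup>2"
      using that Fsub
      by (subst incr_coef) (simp_all add: concat_blocks_subset concat_blocks_Int card_concat_blocks Int_subset_iff le_infI1)
    finally show ?thesis using b by (simp add: field_simps power2_eq_square)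
  qed
  have le: "incr ?J y f g \<le> incr ?I x f g" if "f \<in> ?F" "g \<in> ?F" for f g
  proof -
    have "(\<Sum>i<b. real (card (f i \<inter> g i)))\<^sup>2 \<le> real b * (\<Sum>i<b. (real (card (f i \<inter> g i)))\<^sup>2)"
      using sum_squared_le_sum_of_squares[of "\<lambda>i. real (card (f i \<inter> g i))" "{..<b}"] by (simp add: mult.commute)
    then have "4 / real b * (\<Sum>i<b. real (card (f i \<inter> g i)))\<^sup>2 \<le> 4 / real b * (real b * (\<Sum>i<b. (real (card (f i \<inter> g i)))\<^sup>2))"
      by (intro mult_left_mono) auto
    also have "\<dots> = 4 * (\<Sum>i<b. (real (card (f i \<inter> g i)))\<^sup>2)" using b by simp
    finally show ?thesis
      unfolding incr_x[OF that] incr_y[OF that] by (simp add: sum_subtractf sum_distrib_left[symmetric])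
  qed
  \<comment> \<open>The process of block \<open>i\<close> alone, placed on the common index set. The
    maximum over \<open>?F\<close> dominates the sum of the block maxima because the sets in the
    blocks are chosen independently.\<close>
  define z where "z i A = (\<lambda>(i', e). if i' = i then coef A e else 0)" for i :: nat and A
  have z: "gmax ?J T (z i) (\<lambda>_. 0) = emax m T" if "i < b" for i
    unfolding emax_def
  proof -
    have "incr ?J (z i) A B = incr (pairs m) coef A B" for A B
    proof -
      have "incr ?J (z i) A B = (\<Sum>i'<b. \<Sum>e\<in>pairs m. (if i' = i then (coef A e - coef B e)\<^sup>2 else 0))"
        unfolding incr_def z_def sum.cartesian_product by (intro sum.cong) auto
      also have "\<dots> = (\<Sum>i'<b. if i' = i then incr (pairs m) coef A B else 0)"
        by (intro sum.cong) (auto simp: incr_def)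
      finally show ?thesis using that by simp
    qed
    then show "gmax ?J T (z i) (\<lambda>_. 0) = gmax (pairs m) T coef (\<lambda>_. 0)"
      using fin T(2) by (intro antisym sudakov_fernique) auto
  qed
  have lin_y: "lin ?J (y f) w = (\<Sum>i<b. lin ?J (z i (f i)) w)" for f w
  proof -
    have "(\<Sum>i<b. lin ?J (z i (f i)) w) = (\<Sum>q\<in>?J. \<Sum>i<b. z i (f i) q * w q)"
      unfolding lin_def by (rule sum.swap)
    also have "\<dots> = lin ?J (y f) w"
      unfolding lin_def
    proof (rule sum.cong[OF refl])
      fix q assume "q \<in> ?J"
      then have "(\<Sum>i<b. z i (f i) q * w q) = (\<Sum>i<b. if i = fst q then coef (f i) (snd q) * w q else 0)"
        by (intro sum.cong) (auto simp: z_def case_prod_beta)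
      then show "(\<Sum>i<b. z i (f i) q * w q) = y f q * w q"
        using \<open>q \<in> ?J\<close> by (auto simp: y_def)
    qed
    finally show ?thesis ..
  qed
  have finJ: "finite ?J" by simp
  have int: "integrable (gauss ?J) (lmax ?J T (z i))" for i
    using integrable_Max_lin[OF finJ fin(1) T(2), of "z i" "\<lambda>_. 0"] by simp
  have "real b * emax m T = (\<Sum>i<b. gmax ?J T (z i) (\<lambda>_. 0))" by (simp add: z)
  also have "\<dots> = (\<integral>w. (\<Sum>i<b. lmax ?J T (z i) w) \<partial>gauss ?J)"
    by (simp add: gmax_def int)
  also have "\<dots> \<le> gmax ?J ?F y (\<lambda>_. 0)"
    unfolding gmax_def add_0_right
  proof (rule integral_mono)
    show "integrable (gauss ?J) (\<lambda>w. lmax ?J ?F y w)"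
      using integrable_Max_lin[OF finJ fin(2) Fne, of y "\<lambda>_. 0"] by simp
    fix w
    have "\<exists>A. A \<in> T \<and> lmax ?J T (z i) w = lin ?J (z i A) w" for i
    proof -
      have "lmax ?J T (z i) w \<in> (\<lambda>A. lin ?J (z i A) w) ` T" using fin T by (intro Max_in) auto
      then show ?thesis by auto
    qed
    then obtain f0 where f0: "\<And>i. f0 i \<in> T \<and> lmax ?J T (z i) w = lin ?J (z i (f0 i)) w" by metis
    let ?f = "restrict f0 {..<b}"
    have "(\<Sum>i<b. lmax ?J T (z i) w) = lin ?J (y ?f) w"
      unfolding lin_y using f0 by (intro sum.cong) auto
    also have "\<dots> \<le> lmax ?J ?F y w"
      using fin f0 by (intro Max_ge finite_imageI imageI) auto
    finally show "(\<Sum>i<b. lmax ?J T (z i) w) \<le> lmax ?J ?F y w" .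
  qed (use int in auto)
  also have "\<dots> \<le> gmax ?I ?F x (\<lambda>_. 0)"
    using fin Fne le by (intro sudakov_fernique) auto
  also have "\<dots> = 1 / sqrt b * emax (m * b) (concat_blocks m b ` ?F)"
    using gmax_scale[OF fin(2) Fne, of "1 / sqrt b" ?I "\<lambda>f. coef (concat_blocks m b f)" "\<lambda>_. 0"]
    by (simp add: emax_def gmax_reindex x_def[abs_def])
  finally show ?thesis using b by (simp add: field_simps)
qed

lemma emax_cong_index:
  assumes "T \<subseteq> Pow {..<n}" "n \<le> n'" "T \<noteq> {}"
  shows "emax n' T = emax n T"
proof -
  have "finite T" by (rule finite_subset[OF assms(1)]) simp
  moreover have "Pow {..<n} \<subseteq> Pow {..<n'}" using assms(2) by auto
  then have "T \<subseteq> Pow {..<n'}" using assms(1) by (rule subset_trans[rotated])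
  ultimately have "finite T" "T \<subseteq> Pow {..<n'}" by blast+
  then show ?thesis
    using gmax_coef_invariant[of T n "\<lambda>A. A" n' "\<lambda>_. 0"] assms by (simp add: emax_def)
qed

section \<open>Relabelling of sites and sets with prescribed overlap\<close>

lemma gmax_permute:
  assumes p: "bij_betw p {..<n} {..<n}" and T: "T \<subseteq> Pow {..<n}" "T \<noteq> {}"
  shows "gmax (pairs n) ((`) p ` T) coef c = gmax (pairs n) T coef (\<lambda>A. c (p ` A))"
proof (rule gmax_coef_invariant)
  show "finite T" using T finite_subset by blast
  show "(`) p ` T \<subseteq> Pow {..<n}" using T p by (fastforce simp: bij_betw_def)
  show "card (p ` A \<inter> p ` B) = card (A \<inter> B)" if "A \<in> T" "B \<in> T" for A B
  proof -
    have "A \<union> B \<subseteq> {..<n}" using T(1) that by blast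
    then have inj: "inj_on p (A \<union> B)" by (rule inj_on_subset[OF bij_betw_imp_inj_on[OF p]])
    then have "p ` A \<inter> p ` B = p ` (A \<inter> B)" by (simp add: inj_on_image_Int[of p "A \<union> B"])
    then show ?thesis using inj by (simp add: card_image inj_on_subset[OF inj] le_infI1)
  qed
qed (use T in auto)

lemma permutation_between_subsets:
  assumes "V \<subseteq> {..<n::nat}" "V' \<subseteq> {..<n}" "card V = card V'"
  obtains p where "bij_betw p {..<n} {..<n}" "p ` V = V'" "\<And>A. A \<subseteq> {..<n} \<Longrightarrow> card (p ` A \<inter> V') = card (A \<inter> V)"
proof -
  have fin: "finite V" "finite V'" using assms finite_subset by blast+
  obtain f where f: "bij_betw f V V'" using finite_same_card_bij[OF fin assms(3)] by auto
  have "card ({..<n} - V) = card ({..<n} - V')" using assms fin by (simp add: card_Diff_subset)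
  then obtain g where g: "bij_betw g ({..<n} - V) ({..<n} - V')"
    using finite_same_card_bij[of "{..<n} - V" "{..<n} - V'"] by auto
  define p where "p i = (if i \<in> V then f i else g i)" for i
  have pV: "bij_betw p V V'" using f by (subst bij_betw_cong[of _ _ f]) (auto simp: p_def)
  have pW: "bij_betw p ({..<n} - V) ({..<n} - V')" using g by (subst bij_betw_cong[of _ _ g]) (auto simp: p_def)
  have "bij_betw p (V \<union> ({..<n} - V)) (V' \<union> ({..<n} - V'))"
    by (rule bij_betw_combine[OF pV pW]) auto
  moreover have "V \<union> ({..<n} - V) = {..<n}" "V' \<union> ({..<n} - V') = {..<n}" using assms by auto
  ultimately have p: "bij_betw p {..<n} {..<n}" by simp
  have im: "p ` V = V'" using pV by (simp add: bij_betw_def)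
  have "card (p ` A \<inter> V') = card (A \<inter> V)" if "A \<subseteq> {..<n}" for A
  proof -
    have "A \<union> V \<subseteq> {..<n}" using that assms(1) by blast
    then have inj: "inj_on p (A \<union> V)" by (rule inj_on_subset[OF bij_betw_imp_inj_on[OF p]])
    then have "p ` A \<inter> V' = p ` (A \<inter> V)" unfolding im[symmetric] by (simp add: inj_on_image_Int[of p "A \<union> V"])
    then show ?thesis using inj by (simp add: card_image inj_on_subset[OF inj] le_infI1)
  qed
  with p im show ?thesis by (rule that)
qed

definition overlap_sets :: "nat \<Rightarrow> nat set \<Rightarrow> nat \<Rightarrow> nat \<Rightarrow> nat set set" where
  "overlap_sets n V k l = {A. A \<subseteq> {..<n} \<and> card A = k \<and> card (A \<inter> V) = l}"

definition ksets :: "nat \<Rightarrow> nat \<Rightarrow> nat set set" where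
  "ksets n k = {A. A \<subseteq> {..<n} \<and> card A = k}"

lemma overlap_sets_subset: "overlap_sets n V k l \<subseteq> Pow {..<n}"
  by (auto simp: overlap_sets_def)

lemma ksets_subset: "ksets n k \<subseteq> Pow {..<n}"
  by (auto simp: ksets_def)

lemma finite_overlap_sets [simp]: "finite (overlap_sets n V k l)"
  by (rule finite_subset[OF overlap_sets_subset]) simp

lemma finite_ksets [simp]: "finite (ksets n k)"
  by (rule finite_subset[OF ksets_subset]) simp

lemma bij_image_subset_card:
  assumes "bij_betw p S S" "A \<subseteq> S" shows "p ` A \<subseteq> S" "card (p ` A) = card A"
proof -
  have "p ` S = S" "inj_on p S" using assms(1) by (simp_all add: bij_betw_def)
  then show "p ` A \<subseteq> S" "card (p ` A) = card A"
    using assms(2) by (blast, intro card_image inj_on_subset[of p S A])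
qed

lemma bij_image_ksets:
  assumes "bij_betw p {..<n} {..<n}"
  shows "(`) p ` ksets n k = ksets n k"
proof (rule endo_inj_surj)
  show "(`) p ` ksets n k \<subseteq> ksets n k"
    using bij_image_subset_card[OF assms] unfolding ksets_def by blast
  show "inj_on ((`) p) (ksets n k)"
    by (rule inj_on_subset[OF inj_on_image_Pow[OF bij_betw_imp_inj_on[OF assms]] ksets_subset])
qed simp

text \<open>A permutation carrying \<open>V\<close> to \<open>V'\<close> preserves all intersection
  sizes and hence the mean maximum. This allows any convenient planted set, and also averaging over
  all of them.\<close>

lemma emax_overlap_sets_exchangeable:
  assumes "V \<subseteq> {..<n}" "V' \<subseteq> {..<n}" "card V = card V'" "overlap_sets n V k l \<noteq> {}"
  shows "emax n (overlap_sets n V' k l) = emax n (overlap_sets n V k l)"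
proof -
  obtain p where p: "bij_betw p {..<n} {..<n}" "\<And>A. A \<subseteq> {..<n} \<Longrightarrow> card (p ` A \<inter> V') = card (A \<inter> V)"
    using permutation_between_subsets[OF assms(1-3)] by metis
  have "(`) p ` overlap_sets n V k l = overlap_sets n V' k l"
  proof
    show "(`) p ` overlap_sets n V k l \<subseteq> overlap_sets n V' k l"
    proof
      fix B assume "B \<in> (`) p ` overlap_sets n V k l"
      then obtain A where "A \<subseteq> {..<n}" "card A = k" "card (A \<inter> V) = l" "B = p ` A"
        by (auto simp: overlap_sets_def)
      then show "B \<in> overlap_sets n V' k l"
        using bij_image_subset_card[OF p(1), of A] p(2)[of A] by (simp add: overlap_sets_def)
    qed
    show "overlap_sets n V' k l \<subseteq> (`) p ` overlap_sets n V k l"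
    proof
      fix B assume B: "B \<in> overlap_sets n V' k l"
      then have "B \<in> (`) p ` ksets n k"
        unfolding bij_image_ksets[OF p(1)] by (simp add: overlap_sets_def ksets_def)
      then obtain A where "A \<in> ksets n k" "B = p ` A" by auto
      moreover have "A \<in> overlap_sets n V k l"
        using B p(2)[of A] calculation by (simp add: overlap_sets_def ksets_def)
      ultimately show "B \<in> (`) p ` overlap_sets n V k l" by blast
    qed
  qed
  then show ?thesis
    using gmax_permute[OF p(1) overlap_sets_subset assms(4), of "\<lambda>_. 0"] by (simp add: emax_def)
qed

lemma subset_of_card_near:
  assumes "finite U" "X \<subseteq> U" "l \<le> card U"
  obtains Y where "Y \<subseteq> U" "card Y = l" "real (symdist X Y) = \<bar>real (card X) - real l\<bar>"
proof (cases "l \<le> card X")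
  case True
  have "finite X" using assms finite_subset by blast
  obtain Y where Y: "Y \<subseteq> X" "card Y = l" using obtain_subset_with_card_n[OF True] by metis
  then have "symdist X Y = card X - l"
    using \<open>finite X\<close> by (simp add: symdist_def card_Diff_subset finite_subset Diff_eq_empty_iff[THEN iffD2])
  then show ?thesis using that[of Y] Y True assms by (simp add: of_nat_diff subset_trans)
next
  case False
  have fX: "finite X" using assms finite_subset by blast
  then have "l - card X \<le> card (U - X)" using assms False by (simp add: card_Diff_subset)
  then obtain Z where Z: "Z \<subseteq> U - X" "card Z = l - card X" using obtain_subset_with_card_n by metis
  have fZ: "finite Z" using Z assms finite_subset by (metis finite_Diff)
  have "card (X \<union> Z) = l" using Z fX fZ False by (subst card_Un_disjoint) auto
  moreover have "symdist X (X \<union> Z) = l - card X"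
  proof -
    have "X \<union> Z - X = Z" using Z by auto
    moreover have e: "X - (X \<union> Z) = {}" by auto
    ultimately show ?thesis using Z(2) unfolding symdist_def e by simp
  qed
  moreover have "X \<union> Z \<subseteq> U" using Z(1) assms(2) by blast
  ultimately show ?thesis using that[of "X \<union> Z"] False by (simp add: of_nat_diff)
qed

text \<open>The parts of \<open>A\<close> inside and outside \<open>V\<close> are corrected
  separately, so the distance is exactly the sum of the two discrepancies.\<close>

lemma overlap_set_near:
  assumes "A \<subseteq> {..<n}" "V \<subseteq> {..<n}" "l \<le> card V" "l \<le> k" "k - l \<le> n - card V"
  obtains B where "B \<in> overlap_sets n V k l"
    "real (symdist A B) = \<bar>real (card (A \<inter> V)) - real l\<bar> + \<bar>real (card (A - V)) - real (k - l)\<bar>"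
proof -
  have fV: "finite V" using assms finite_subset by blast
  obtain Y where Y: "Y \<subseteq> V" "card Y = l" "real (symdist (A \<inter> V) Y) = \<bar>real (card (A \<inter> V)) - real l\<bar>"
    using subset_of_card_near[OF fV _ assms(3), of "A \<inter> V"] by auto
  have "k - l \<le> card ({..<n} - V)" using assms fV by (simp add: card_Diff_subset)
  then obtain Z where Z: "Z \<subseteq> {..<n} - V" "card Z = k - l"
    "real (symdist (A - V) Z) = \<bar>real (card (A - V)) - real (k - l)\<bar>"
    using subset_of_card_near[of "{..<n} - V" "A - V" "k - l"] assms(1) by auto
  have fin: "finite Y" "finite Z" "finite A"
    using finite_subset[OF Y(1) fV] finite_subset[OF Z(1)] finite_subset[OF assms(1)] by auto
  have "card (Y \<union> Z) = k" using Y Z fin assms(4) by (subst card_Un_disjoint) auto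
  moreover have "(Y \<union> Z) \<inter> V = Y" using Y Z by auto
  ultimately have mem: "Y \<union> Z \<in> overlap_sets n V k l" using Y Z assms(2) by (auto simp: overlap_sets_def)
  have "A - (Y \<union> Z) = (A \<inter> V - Y) \<union> (A - V - Z)" "(Y \<union> Z) - A = (Y - A \<inter> V) \<union> (Z - (A - V))"
    using Y Z by auto
  moreover have "card ((A \<inter> V - Y) \<union> (A - V - Z)) = card (A \<inter> V - Y) + card (A - V - Z)"
    "card ((Y - A \<inter> V) \<union> (Z - (A - V))) = card (Y - A \<inter> V) + card (Z - (A - V))"
    using fin Y Z by (auto intro!: card_Un_disjoint)
  ultimately have "symdist A (Y \<union> Z) = symdist (A \<inter> V) Y + symdist (A - V) Z"
    by (simp add: symdist_def)
  with mem Y(3) Z(3) show ?thesis by (intro that) auto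
qed

lemma overlap_sets_nonempty:
  assumes "V \<subseteq> {..<n}" "l \<le> card V" "l \<le> k" "k - l \<le> n - card V"
  shows "overlap_sets n V k l \<noteq> {}"
  using overlap_set_near[OF _ assms, of "{}"] by auto

lemma card_Int_le_symdist:
  assumes "finite V" "finite V'"
  shows "\<bar>real (card (A \<inter> V')) - real (card (A \<inter> V))\<bar> \<le> symdist V V'"
proof -
  have "card (A \<inter> V') \<le> card ((A \<inter> V) \<union> (V' - V))" "card (A \<inter> V) \<le> card ((A \<inter> V') \<union> (V - V'))"
    using assms by (auto intro!: card_mono)
  moreover have "card ((A \<inter> V) \<union> (V' - V)) \<le> card (A \<inter> V) + card (V' - V)"
    "card ((A \<inter> V') \<union> (V - V')) \<le> card (A \<inter> V') + card (V - V')"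
    by (rule card_Un_le)+
  ultimately show ?thesis unfolding symdist_def by linarith
qed

text \<open>Concatenated block sets are only almost admissible at size \<open>n\<close>, and
  \<open>d\<close> bounds their repair. Errors in the planted set and in the overlap count twice,
  since a correction inside the planted set has to be compensated outside.\<close>

lemma emax_superadditive:
  fixes d :: real
  assumes m: "U \<subseteq> {..<m}" "overlap_sets m U km lm \<noteq> {}" and b: "0 < b" "m * b \<le> n"
    and V: "V \<subseteq> {..<n}" "l \<le> card V" "l \<le> k" "k - l \<le> n - card V"
    and d: "2 * \<bar>real (card V) - real b * card U\<bar> + 2 * \<bar>real l - real b * lm\<bar> + \<bar>real k - real b * km\<bar> \<le> d" "0 < d"
  shows "real b * sqrt b * emax m (overlap_sets m U km lm) \<le> emax n (overlap_sets n V k l) + 4 * real n * sqrt d"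
proof -
  let ?T = "overlap_sets m U km lm" and ?U = "concat_blocks m b (\<lambda>_. U)"
  let ?S = "concat_blocks m b ` ({..<b} \<rightarrow>\<^sub>E ?T)"
  have sub: "concat_blocks m b f \<subseteq> {..<m * b}" if "f \<in> {..<b} \<rightarrow>\<^sub>E ?T" for f
    using that overlap_sets_subset by (intro concat_blocks_subset) blast
  have Ssub: "?S \<subseteq> Pow {..<m * b}" using sub by auto
  have Sne: "?S \<noteq> {}" using m(2) by (simp add: PiE_eq_empty_iff)
  have Usub: "?U \<subseteq> {..<n}" using concat_blocks_subset[of b "\<lambda>_. U" m] m(1) b(2) by force
  have cU: "card ?U = b * card U" using card_concat_blocks[of b "\<lambda>_. U" m] m(1) by simp
  have "card V \<le> card {..<n}" using V(1) by (intro card_mono) auto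
  \<comment> \<open>The concatenated planted set, corrected to the cardinality of \<open>V\<close>.
    Exchangeability replaces it by \<open>V\<close> at the end.\<close>
  then obtain V' where V': "V' \<subseteq> {..<n}" "card V' = card V" "real (symdist ?U V') = \<bar>real (card ?U) - real (card V)\<bar>"
    using subset_of_card_near[OF _ Usub, of "card V"] by auto
  have "real b * sqrt b * emax m ?T \<le> emax (m * b) ?S"
    using m overlap_sets_subset b by (intro emax_concat_blocks[where k = km]) (auto simp: overlap_sets_def)
  also have "\<dots> = emax n ?S"
    using Ssub b Sne by (intro emax_cong_index[symmetric]) auto
  also have "\<dots> \<le> emax n (overlap_sets n V' k l) + 4 * real n * sqrt d"
  proof (rule emax_le_emax_neighbour[OF _ overlap_sets_subset Sne d(2)])
    have mbn: "{..<m * b} \<subseteq> {..<n}" using b(2) by simp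
    show "?S \<subseteq> Pow {..<n}" by (rule subset_trans[OF Ssub Pow_mono[OF mbn]])
    fix A assume "A \<in> ?S"
    then obtain f where f: "f \<in> {..<b} \<rightarrow>\<^sub>E ?T" "A = concat_blocks m b f" by auto
    have fi: "f i \<subseteq> {..<m}" "card (f i) = km" "card (f i \<inter> U) = lm" if "i < b" for i
      using that f(1) by (auto simp: overlap_sets_def PiE_iff)
    have cA: "card A = b * km" unfolding f(2) by (subst card_concat_blocks) (use fi in auto)
    have An: "A \<subseteq> {..<n}" unfolding f(2) by (rule subset_trans[OF sub[OF f(1)] mbn])
    then have fA: "finite A" using finite_subset by blast
    have "A \<inter> ?U = concat_blocks m b (\<lambda>i. f i \<inter> U)"
      unfolding f(2) using fi m(1) by (intro concat_blocks_Int) auto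
    then have "card (A \<inter> ?U) = (\<Sum>i<b. card (f i \<inter> U))"
      using fi by (simp add: card_concat_blocks le_infI1)
    then have cAU: "card (A \<inter> ?U) = b * lm" using fi by simp
    have lV': "l \<le> card V'" "k - l \<le> n - card V'" using V V' by auto
    obtain B where B: "B \<in> overlap_sets n V' k l"
      "real (symdist A B) = \<bar>real (card (A \<inter> V')) - real l\<bar> + \<bar>real (card (A - V')) - real (k - l)\<bar>"
      using overlap_set_near[OF An V'(1) lV'(1) V(3) lV'(2)] by metis
    have "\<bar>real (card (A \<inter> V')) - real (card (A \<inter> ?U))\<bar> \<le> symdist ?U V'"
      using Usub V'(1) finite_subset by (intro card_Int_le_symdist) blast+
    then have 1: "\<bar>real (card (A \<inter> V')) - real b * lm\<bar> \<le> \<bar>real (card V) - real b * card U\<bar>"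
      unfolding V'(3) cU cAU by (simp add: abs_minus_commute)
    have "card A = card (A \<inter> V') + card (A - V')" using card_Int_Diff[OF fA] by simp
    then have "real (b * km) = real (card (A \<inter> V')) + real (card (A - V'))" unfolding cA by simp
    then have 2: "real (card (A - V')) = real b * km - real (card (A \<inter> V'))" by simp
    have 3: "real (k - l) = real k - real l" using V(3) by simp
    define x where "x = real (card (A \<inter> V'))"
    have "\<bar>x - real l\<bar> \<le> \<bar>x - real b * lm\<bar> + \<bar>real l - real b * lm\<bar>" by linarith
    moreover have "\<bar>real b * km - x - (real k - real l)\<bar> \<le> \<bar>x - real l\<bar> + \<bar>real k - real b * km\<bar>" by linarith
    ultimately have "\<bar>x - real l\<bar> + \<bar>real b * km - x - (real k - real l)\<bar>
      \<le> 2 * \<bar>x - real b * lm\<bar> + 2 * \<bar>real l - real b * lm\<bar> + \<bar>real k - real b * km\<bar>"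
      by argo
    also have "\<dots> \<le> d" using 1 d(1) unfolding x_def by argo
    finally have "real (symdist A B) \<le> d" using B(2) unfolding 2 3 x_def by simp
    then show "\<exists>B\<in>overlap_sets n V' k l. real (symdist A B) \<le> d" using B(1) by blast
  qed
  also have "emax n (overlap_sets n V' k l) = emax n (overlap_sets n V k l)"
    using V V' overlap_sets_nonempty[OF V] by (intro emax_overlap_sets_exchangeable) auto
  finally show ?thesis .
qed

section \<open>Existence of the limiting energy\<close>

definition npts :: "nat \<Rightarrow> real \<Rightarrow> nat" where
  "npts n r = nat (round (real n * r))"

lemma npts_approx: "0 \<le> r \<Longrightarrow> \<bar>real (npts n r) - real n * r\<bar> \<le> 1 / 2"
proof -
  assume "0 \<le> r"
  then have "0 \<le> round (real n * r)" using round_mono[of 0 "real n * r"] by simp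
  then have "real (npts n r) = of_int (round (real n * r))" by (simp add: npts_def)
  then show ?thesis using of_int_round_abs_le[of "real n * r"] by simp
qed

lemma npts_mono: "q \<le> r \<Longrightarrow> npts n q \<le> npts n r"
  unfolding npts_def by (intro nat_mono round_mono mult_left_mono) auto

lemma npts_tendsto:
  assumes "0 \<le> r" shows "(\<lambda>n. real (npts n r) / real n) \<longlonglongrightarrow> r"
proof (rule tendsto_sandwich)
  show "eventually (\<lambda>n. r - 1 / real n \<le> real (npts n r) / real n) sequentially"
    using eventually_gt_at_top[of 0]
  proof eventually_elim
    case (elim n)
    have "real n * r - 1 \<le> npts n r" using npts_approx[OF assms, of n] by linarith
    then have "(real n * r - 1) / n \<le> npts n r / n" using elim by (intro divide_right_mono) auto
    then show ?case using elim by (simp add: diff_divide_distrib)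
  qed
  show "eventually (\<lambda>n. real (npts n r) / real n \<le> r + 1 / real n) sequentially"
    using eventually_gt_at_top[of 0]
  proof eventually_elim
    case (elim n)
    have "npts n r \<le> real n * r + 1" using npts_approx[OF assms, of n] by linarith
    then have "npts n r / n \<le> (real n * r + 1) / n" using elim by (intro divide_right_mono) auto
    then show ?case using elim by (simp add: add_divide_distrib)
  qed
  show "(\<lambda>n. r - 1 / real n) \<longlonglongrightarrow> r" "(\<lambda>n. r + 1 / real n) \<longlonglongrightarrow> r"
    by real_asymp+
qed

lemma eventually_npts_double_le:
  assumes "0 \<le> r" "r < 1 / 2"
  shows "eventually (\<lambda>n. 2 * npts n r \<le> n) sequentially"
proof -
  have "eventually (\<lambda>n. real (npts n r) / real n < 1 / 2) sequentially"
    using npts_tendsto[OF assms(1)] assms(2) by (rule order_tendstoD)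
  with eventually_gt_at_top[of 0] show ?thesis
    by eventually_elim (simp add: field_simps flip: of_nat_mult)
qed

text \<open>An initial segment stands in for the planted set; by exchangeability the mean maximum is
  the same.\<close>

definition planted_sets :: "real \<Rightarrow> real \<Rightarrow> nat \<Rightarrow> nat set set" where
  "planted_sets \<rho> q n = overlap_sets n {..<npts n \<rho>} (npts n \<rho>) (npts n q)"

text \<open>The linear functional is \<open>sqrt n\<close> times the Hamiltonian, and the energy is
  taken per site; hence the normalisation \<open>n * sqrt n\<close>.\<close>

definition noise_energy :: "real \<Rightarrow> real \<Rightarrow> nat \<Rightarrow> real" where
  "noise_energy \<rho> q n = emax n (planted_sets \<rho> q n) / (real n * sqrt n)"

lemma emax_crude_bound:
  assumes "T \<subseteq> Pow {..<n}" "T \<noteq> {}" "0 < n"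
  shows "emax n T \<le> 2 * (real n * sqrt n)"
proof -
  have fin: "finite T" using assms finite_subset by blast
  have "card T \<le> card (Pow {..<n})" using assms by (intro card_mono) auto
  then have "real (card T) \<le> 2 ^ n" by (simp add: card_Pow flip: of_nat_le_iff)
  moreover have "0 < card T" using fin assms by (simp add: card_gt_0_iff)
  ultimately have "ln (card T) \<le> ln (2 ^ n)" by (subst ln_le_cancel_iff) auto
  also have "\<dots> = n * ln 2" by (simp add: ln_realpow)
  also have "\<dots> \<le> real n * 1" using ln_2_less_1 by (intro mult_left_mono) auto
  finally have ln: "ln (card T) \<le> real n" by simp
  have "emax n T \<le> ln (card T) / (1 / sqrt n) + 1 / sqrt n * (2 * (real n)\<^sup>2) / 2"
    unfolding emax_def
  proof (rule gmax_le[OF finite_pairs fin assms(2)])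
    fix A assume A: "A \<in> T"
    then have "card A \<le> n" using assms(1) card_mono[of "{..<n}" A] by auto
    then have "(real (card A))\<^sup>2 \<le> (real n)\<^sup>2" by (intro power_mono) auto
    then show "(\<Sum>e\<in>pairs n. (coef A e)\<^sup>2) \<le> 2 * (real n)\<^sup>2"
      using A assms(1) by (subst sum_coef_square) auto
  qed (use assms in simp)
  also have "1 / sqrt n * (2 * (real n)\<^sup>2) / 2 = real n * sqrt n"
    using assms(3) by (simp add: field_simps power2_eq_square)
  also have "ln (card T) / (1 / sqrt n) \<le> real n * sqrt n"
    using ln by (simp add: mult_right_mono)
  finally show ?thesis by simp
qed

text \<open>A variant of Fekete's argument. The supremum of \<open>S\<close> is the lower limit, and
  a value \<open>g m\<close> well above it, with \<open>\<delta> m\<close> small, would itself yield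
  a larger eventual lower bound.\<close>

lemma convergent_of_almost_superadditive:
  fixes g :: "nat \<Rightarrow> real"
  assumes bound: "eventually (\<lambda>n. g n \<le> B) sequentially" and lower: "eventually (\<lambda>n. A \<le> g n) sequentially"
    and \<delta>: "\<delta> \<longlonglongrightarrow> 0"
    and almost: "eventually (\<lambda>m. \<forall>\<epsilon>>0. eventually (\<lambda>n. g m - \<delta> m - \<epsilon> \<le> g n) sequentially) sequentially"
  shows "convergent g"
proof -
  define S where "S = {c. eventually (\<lambda>n. c \<le> g n) sequentially}"
  have "A \<in> S" using lower by (simp add: S_def)
  have Sle: "c \<le> B" if "c \<in> S" for c
  proof -
    have "eventually (\<lambda>n. c \<le> B) sequentially"
      using that bound unfolding S_def mem_Collect_eq by eventually_elim simp
    then show ?thesis by simp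
  qed
  then have bdd: "bdd_above S" by (intro bdd_aboveI[of _ B])
  define L where "L = Sup S"
  have "g \<longlonglongrightarrow> L"
  proof (rule order_tendstoI)
    fix a assume "a < L"
    then obtain c where "c \<in> S" "a < c"
      using less_cSup_iff[of S a] bdd \<open>A \<in> S\<close> by (auto simp: L_def)
    then show "eventually (\<lambda>n. a < g n) sequentially"
      unfolding S_def mem_Collect_eq by (auto elim: eventually_mono)
  next
    fix a assume "L < a"
    then have "eventually (\<lambda>m. \<delta> m < (a - L) / 2) sequentially"
      using \<delta> by (intro order_tendstoD(2)[of \<delta> 0]) auto
    with almost show "eventually (\<lambda>n. g n < a) sequentially"
    proof eventually_elim
      case (elim m)
      show "g m < a"
      proof (rule ccontr)
        assume "\<not> g m < a"
        define \<epsilon> where "\<epsilon> = ((a - L) / 2 - \<delta> m) / 2"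
        have "0 < \<epsilon>" using elim(2) by (simp add: \<epsilon>_def)
        then have "g m - \<delta> m - \<epsilon> \<in> S" using elim(1) by (simp add: S_def)
        then have "g m - \<delta> m - \<epsilon> \<le> L" unfolding L_def by (intro cSup_upper bdd)
        moreover have "2 * \<epsilon> = (a - L) / 2 - \<delta> m" by (simp add: \<epsilon>_def)
        ultimately show False using \<open>0 < \<epsilon>\<close> \<open>L < a\<close> \<open>\<not> g m < a\<close> by argo
      qed
    qed
  qed
  then show ?thesis by (rule convergentI)
qed

lemma planted_sets_facts:
  assumes "0 \<le> q" "q \<le> \<rho>" "2 * npts n \<rho> \<le> n"
  shows "planted_sets \<rho> q n \<noteq> {}" "planted_sets \<rho> q n \<subseteq> Pow {..<n}" "npts n q \<le> npts n \<rho>"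
    "{..<npts n \<rho>} \<subseteq> {..<n}" "npts n \<rho> - npts n q \<le> n - npts n \<rho>"
proof -
  show l: "npts n q \<le> npts n \<rho>" by (rule npts_mono[OF assms(2)])
  show V: "{..<npts n \<rho>} \<subseteq> {..<n}" using assms(3) by auto
  show k: "npts n \<rho> - npts n q \<le> n - npts n \<rho>" using assms(3) by simp
  show "planted_sets \<rho> q n \<noteq> {}"
    unfolding planted_sets_def using l k by (intro overlap_sets_nonempty[OF V]) auto
  show "planted_sets \<rho> q n \<subseteq> Pow {..<n}" unfolding planted_sets_def by (rule overlap_sets_subset)
qed

text \<open>Discarding the remainder \<open>n mod m\<close> costs the factor with exponent 3/2.
  Rounding costs at most half a site per block, and the remainder at most \<open>m\<close> sites, so
  the relative distance is of order \<open>1 / m + m / n\<close>.\<close>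

lemma noise_energy_superadditive:
  assumes q: "0 \<le> q" "q \<le> \<rho>" "\<rho> < 1 / 2" and m: "0 < m" "2 * npts m \<rho> \<le> m" and n: "m \<le> n" "2 * npts n \<rho> \<le> n"
  shows "(1 - real m / n) * sqrt (1 - real m / n) * noise_energy \<rho> q m
    \<le> noise_energy \<rho> q n + 4 * sqrt (5 * (1 / real m + real m / n))"
proof -
  define b where "b = n div m"
  have b: "0 < b" "m * b \<le> n" using m n by (auto simp: b_def div_greater_zero_iff)
  have nm: "n = m * b + n mod m" by (simp add: b_def)
  have "n mod m < m" using m by simp
  then have r: "0 \<le> real n - real m * real b" "real n - real m * real b \<le> m"
    using nm by (simp_all flip: of_nat_mult)
  have close: "\<bar>real (npts n s) - real b * npts m s\<bar> \<le> b + real m" if s: "0 \<le> s" "s < 1 / 2" for s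
  proof -
    have "\<bar>real (npts n s) - n * s\<bar> \<le> 1 / 2" by (rule npts_approx[OF s(1)])
    moreover have "\<bar>real b * npts m s - real b * (m * s)\<bar> \<le> real b * (1 / 2)"
      unfolding right_diff_distrib[symmetric] abs_mult
      using mult_left_mono[OF npts_approx[OF s(1), of m], of "real b"] by simp
    moreover have "0 \<le> (real n - real m * real b) * s" "(real n - real m * real b) * s \<le> real m * 1"
      using r s mult_mono[of "real n - real m * real b" "real m" s 1] by simp_all
    moreover have "real n * s - real b * (m * s) = (real n - real m * real b) * s" by (simp add: algebra_simps)
    moreover have "1 \<le> real b" using b by simp
    ultimately show ?thesis by linarith
  qed
  \<comment> \<open>Here 5 = 2 + 2 + 1 adds up the weights of the three discrepancies in
    \<open>emax_superadditive\<close>.\<close>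
  define d where "d = 5 * (real b + real m)"
  note fm = planted_sets_facts[OF q(1,2) m(2)] and fn = planted_sets_facts[OF q(1,2) n(2)]
  have "real b * sqrt b * emax m (planted_sets \<rho> q m) \<le> emax n (planted_sets \<rho> q n) + 4 * real n * sqrt d"
    unfolding planted_sets_def
  proof (rule emax_superadditive)
    show "2 * \<bar>real (card {..<npts n \<rho>}) - real b * card {..<npts m \<rho>}\<bar>
      + 2 * \<bar>real (npts n q) - real b * npts m q\<bar> + \<bar>real (npts n \<rho>) - real b * npts m \<rho>\<bar> \<le> d"
      using close[of \<rho>] close[of q] q by (simp add: d_def)
    show "0 < d" using m by (simp add: d_def)
  qed (use fm fn b in \<open>auto simp: planted_sets_def\<close>)
  then have main: "real b * sqrt b * (real m * sqrt m * noise_energy \<rho> q m)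
     \<le> real n * sqrt n * noise_energy \<rho> q n + 4 * real n * sqrt d"
    using m n by (simp add: noise_energy_def)
  define t where "t = real m * b"
  have g0: "0 \<le> noise_energy \<rho> q m"
    using gmax_nonneg[OF finite_pairs _ fm(1)] finite_subset[OF fm(2)] m by (simp add: noise_energy_def emax_def)
  have n0: "0 < real n" using m n by simp
  have "(1 - real m / n) * sqrt (1 - real m / n) \<le> (t / n) * sqrt (t / n)"
  proof -
    have "0 \<le> 1 - real m / n" using n n0 by simp
    moreover have "(real n - real m) / n \<le> t / n" using r n0 by (intro divide_right_mono) (auto simp: t_def)
    then have "1 - real m / n \<le> t / n" using n0 by (simp add: diff_divide_distrib)
    ultimately have "0 \<le> 1 - real m / n" "1 - real m / n \<le> t / n" by blast+
    then show ?thesis by (intro mult_mono real_sqrt_le_mono) auto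
  qed
  then have "(1 - real m / n) * sqrt (1 - real m / n) * noise_energy \<rho> q m \<le> (t / n) * sqrt (t / n) * noise_energy \<rho> q m"
    using g0 by (rule mult_right_mono)
  also have "\<dots> = (real b * sqrt b * (real m * sqrt m * noise_energy \<rho> q m)) / (n * sqrt n)"
    by (simp add: t_def real_sqrt_divide real_sqrt_mult)
  also have "\<dots> \<le> (real n * sqrt n * noise_energy \<rho> q n + 4 * real n * sqrt d) / (n * sqrt n)"
    using main n0 by (intro divide_right_mono) auto
  also have "\<dots> = noise_energy \<rho> q n + 4 * sqrt (d / n)"
    using n0 by (simp add: add_divide_distrib real_sqrt_divide)
  also have "d / n \<le> 5 * (1 / real m + real m / n)"
    using r m n0 by (simp add: d_def field_simps)
  finally show ?thesis by simp
qed

lemma convergent_noise_energy: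
  assumes q: "0 \<le> q" "q \<le> \<rho>" "\<rho> < 1 / 2"
  shows "convergent (noise_energy \<rho> q)"
proof (rule convergent_of_almost_superadditive)
  have ev: "eventually (\<lambda>n. 2 * npts n \<rho> \<le> n) sequentially"
    using q by (intro eventually_npts_double_le) auto
  show "eventually (\<lambda>n. noise_energy \<rho> q n \<le> 2) sequentially"
    using ev eventually_gt_at_top[of 0]
  proof eventually_elim
    case (elim n)
    note f = planted_sets_facts[OF q(1,2) elim(1)]
    show ?case using emax_crude_bound[OF f(2,1) elim(2)] elim(2) by (simp add: noise_energy_def field_simps)
  qed
  show "eventually (\<lambda>n. 0 \<le> noise_energy \<rho> q n) sequentially"
    using ev
  proof eventually_elim
    case (elim n)
    note f = planted_sets_facts[OF q(1,2) elim]
    show ?case using gmax_nonneg[OF finite_pairs _ f(1)] finite_subset[OF f(2)] by (simp add: noise_energy_def emax_def)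
  qed
  show "(\<lambda>m. 4 * sqrt (5 * (1 / real m))) \<longlonglongrightarrow> 0" by real_asymp
  show "eventually (\<lambda>m. \<forall>\<epsilon>>0. eventually (\<lambda>n. noise_energy \<rho> q m - 4 * sqrt (5 * (1 / real m)) - \<epsilon> \<le> noise_energy \<rho> q n)
     sequentially) sequentially"
    using ev eventually_gt_at_top[of 0]
  proof eventually_elim
    case (elim m)
    show ?case
    proof (intro allI impI)
      fix \<epsilon> :: real assume "0 < \<epsilon>"
      have c: "(\<lambda>n. real m / real n) \<longlonglongrightarrow> 0" by real_asymp
      have "(\<lambda>n. (1 - real m / n) * sqrt (1 - real m / n) * noise_energy \<rho> q m - 4 * sqrt (5 * (1 / real m + real m / n)))
        \<longlonglongrightarrow> (1 - 0) * sqrt (1 - 0) * noise_energy \<rho> q m - 4 * sqrt (5 * (1 / real m + 0))"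
        by (intro tendsto_intros c)
      then have "eventually (\<lambda>n. noise_energy \<rho> q m - 4 * sqrt (5 * (1 / real m)) - \<epsilon>
        < (1 - real m / n) * sqrt (1 - real m / n) * noise_energy \<rho> q m - 4 * sqrt (5 * (1 / real m + real m / n))) sequentially"
        using \<open>0 < \<epsilon>\<close> by (intro order_tendstoD(1)) auto
      with ev eventually_ge_at_top[of m]
      show "eventually (\<lambda>n. noise_energy \<rho> q m - 4 * sqrt (5 * (1 / real m)) - \<epsilon> \<le> noise_energy \<rho> q n) sequentially"
      proof eventually_elim
        case (elim n)
        show ?case
          using noise_energy_superadditive[OF q \<open>0 < m\<close> \<open>2 * npts m \<rho> \<le> m\<close> elim(2,1)] elim(3) by linarith
      qed
    qed
  qed
qed

section \<open>Overlap bounds at finite size\<close>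

lemma card_supersets:
  assumes S: "finite S" "B \<subseteq> S" and k: "card B \<le> k"
  shows "card {V. V \<subseteq> S \<and> card V = k \<and> B \<subseteq> V} = (card S - card B) choose (k - card B)"
proof -
  have fB: "finite B" using S finite_subset by blast
  have "bij_betw (\<lambda>V. V - B) {V. V \<subseteq> S \<and> card V = k \<and> B \<subseteq> V} {W. W \<subseteq> S - B \<and> card W = k - card B}"
  proof (rule bij_betwI[where g = "\<lambda>W. W \<union> B"])
    show "(\<lambda>V. V - B) \<in> {V. V \<subseteq> S \<and> card V = k \<and> B \<subseteq> V} \<rightarrow> {W. W \<subseteq> S - B \<and> card W = k - card B}"
      using fB by (auto simp: card_Diff_subset)
    show "(\<lambda>W. W \<union> B) \<in> {W. W \<subseteq> S - B \<and> card W = k - card B} \<rightarrow> {V. V \<subseteq> S \<and> card V = k \<and> B \<subseteq> V}"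
    proof
      fix W assume "W \<in> {W. W \<subseteq> S - B \<and> card W = k - card B}"
      then have W: "W \<subseteq> S - B" "card W = k - card B" by auto
      have "finite W" using finite_subset[OF W(1)] S(1) by simp
      then have "card (W \<union> B) = k" using W fB k by (subst card_Un_disjoint) auto
      then show "W \<union> B \<in> {V. V \<subseteq> S \<and> card V = k \<and> B \<subseteq> V}" using W(1) S(2) by blast
    qed
  qed auto
  then have "card {V. V \<subseteq> S \<and> card V = k \<and> B \<subseteq> V} = card {W. W \<subseteq> S - B \<and> card W = k - card B}"
    by (rule bij_betw_same_card)
  also have "\<dots> = card (S - B) choose (k - card B)" using S(1) by (intro n_subsets) simp
  finally show ?thesis using S fB by (simp add: card_Diff_subset)
qed

lemma card_ksets: "card (ksets n k) = n choose k"
  using n_subsets[of "{..<n}" k] by (simp add: ksets_def)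

lemma card_ksets_containing:
  assumes "i < n" "1 \<le> k"
  shows "real n * real (card {V \<in> ksets n k. i \<in> V}) = real k * real (n choose k)"
proof -
  have "{V \<in> ksets n k. i \<in> V} = {V. V \<subseteq> {..<n} \<and> card V = k \<and> {i} \<subseteq> V}" by (auto simp: ksets_def)
  then have "card {V \<in> ksets n k. i \<in> V} = (n - 1) choose (k - 1)"
    using card_supersets[of "{..<n}" "{i}" k] assms by simp
  moreover have "k * (n choose k) = n * ((n - 1) choose (k - 1))"
    using binomial_absorption[of "k - 1" n] assms by (simp del: binomial_Suc_Suc)
  ultimately show ?thesis by (metis of_nat_mult)
qed

text \<open>Sampling without replacement is negatively correlated, by
  \<open>(k - 1) / (n - 1) \<le> k / n\<close>.\<close>

lemma card_ksets_containing_two: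
  assumes "i < n" "j < n" "i \<noteq> j" "2 \<le> k" "k \<le> n"
  shows "real (card {V \<in> ksets n k. i \<in> V \<and> j \<in> V}) \<le> (real k / real n)\<^sup>2 * real (n choose k)"
proof -
  have "{V \<in> ksets n k. i \<in> V \<and> j \<in> V} = {V. V \<subseteq> {..<n} \<and> card V = k \<and> {i, j} \<subseteq> V}" by (auto simp: ksets_def)
  then have c: "card {V \<in> ksets n k. i \<in> V \<and> j \<in> V} = (n - 2) choose (k - 2)"
    using card_supersets[of "{..<n}" "{i, j}" k] assms by (simp add: numeral_2_eq_2)
  have "k * (n choose k) = n * ((n - 1) choose (k - 1))"
    using binomial_absorption[of "k - 1" n] assms by (simp del: binomial_Suc_Suc)
  then have b1: "real k * real (n choose k) = real n * real ((n - 1) choose (k - 1))"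
    by (simp only: of_nat_mult[symmetric])
  have "(k - 1) * ((n - 1) choose (k - 1)) = (n - 1) * ((n - 2) choose (k - 2))"
  proof -
    have e: "Suc (k - 2) = k - 1" "n - 1 - 1 = n - 2" using assms by auto
    show ?thesis using binomial_absorption[of "k - 2" "n - 1"] unfolding e .
  qed
  then have "real (k - 1) * real ((n - 1) choose (k - 1)) = real (n - 1) * real ((n - 2) choose (k - 2))"
    by (simp only: of_nat_mult[symmetric])
  moreover have "real (k - 1) = real k - 1" "real (n - 1) = real n - 1" using assms by (simp_all add: of_nat_diff)
  ultimately have b2: "(real k - 1) * real ((n - 1) choose (k - 1)) = (real n - 1) * real ((n - 2) choose (k - 2))"
    by simp
  have "real n * (real n - 1) * real ((n - 2) choose (k - 2)) = real n * ((real k - 1) * real ((n - 1) choose (k - 1)))"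
    unfolding b2 by simp
  also have "\<dots> = (real k - 1) * (real k * real (n choose k))" unfolding b1 by simp
  finally have "real n * (real n - 1) * real ((n - 2) choose (k - 2)) = real k * (real k - 1) * real (n choose k)"
    by simp
  then have "real ((n - 2) choose (k - 2)) * (real n * (real n - 1)) = real k * (real k - 1) * real (n choose k)"
    by (simp only: mult_ac)
  moreover have n0: "0 < real n" "0 < real n - 1" using assms by simp_all
  ultimately have "real ((n - 2) choose (k - 2)) = real k * (real k - 1) * real (n choose k) / (real n * (real n - 1))"
    by (intro eq_divide_imp) auto
  also have "\<dots> = (real k / real n) * ((real k - 1) / (real n - 1)) * real (n choose k)" by simp
  also have "\<dots> \<le> (real k / real n)\<^sup>2 * real (n choose k)"
    unfolding power2_eq_square
  proof (intro mult_right_mono mult_left_mono)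
    have "real k / real n \<le> 1" using assms n0 by simp
    moreover have "real k / real n * (real n - 1) = real k - real k / real n"
      using n0 by (simp add: right_diff_distrib)
    ultimately show "(real k - 1) / (real n - 1) \<le> real k / real n"
      using n0(2) by (subst pos_divide_le_eq) auto
  qed auto
  finally show ?thesis by (simp add: c)
qed

text \<open>The variance of a hypergeometric overlap in counting form. Negative correlation leaves
  only the diagonal terms, which give at most \<open>k\<^sup>2 / n\<close>; this is relaxed to
  \<open>n\<close>.\<close>

lemma sum_overlap_deviation:
  assumes A: "A \<in> ksets n k" and k: "1 \<le> k" "k \<le> n"
  shows "(\<Sum>V\<in>ksets n k. (real (card (A \<inter> V)) - (real k)\<^sup>2 / real n)\<^sup>2) \<le> real n * real (n choose k)"
proof -
  let ?K = "ksets n k" and ?C = "real (n choose k)"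
  have fA: "finite A" "A \<subseteq> {..<n}" "card A = k" using A finite_subset by (auto simp: ksets_def)
  have n0: "0 < real n" using k by simp
  have ind: "real (card (A \<inter> V)) = (\<Sum>i\<in>A. of_bool (i \<in> V))" for V
    using fA(1) by (simp add: Int_def)
  have cnt: "(\<Sum>V\<in>?K. of_bool (P V)) = real (card {V \<in> ?K. P V})" for P
    by (simp add: Int_def)
  have S1: "(\<Sum>V\<in>?K. real (card (A \<inter> V))) = (real k)\<^sup>2 / real n * ?C"
  proof -
    have "(\<Sum>V\<in>?K. real (card (A \<inter> V))) = (\<Sum>i\<in>A. \<Sum>V\<in>?K. of_bool (i \<in> V))"
      unfolding ind by (rule sum.swap)
    also have "\<dots> = (\<Sum>i\<in>A. real k / real n * ?C)"
    proof (rule sum.cong[OF refl])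
      fix i assume "i \<in> A"
      then have "i < n" using fA(2) by auto
      then show "(\<Sum>V\<in>?K. of_bool (i \<in> V)) = real k / real n * ?C"
        using card_ksets_containing[OF _ k(1), of i n] n0 by (simp only: cnt) (simp add: field_simps)
    qed
    also have "\<dots> = (real k)\<^sup>2 / real n * ?C" by (simp add: fA(3) power2_eq_square)
    finally show ?thesis .
  qed
  have S2: "(\<Sum>V\<in>?K. (real (card (A \<inter> V)))\<^sup>2) \<le> ((real k)\<^sup>2 / real n + ((real k)\<^sup>2 / real n)\<^sup>2) * ?C"
  proof -
    have "(\<Sum>V\<in>?K. (real (card (A \<inter> V)))\<^sup>2) = (\<Sum>V\<in>?K. \<Sum>i\<in>A. \<Sum>j\<in>A. of_bool (i \<in> V \<and> j \<in> V))"
      unfolding ind power2_eq_square sum_product by (simp add: of_bool_conj)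
    also have "\<dots> = (\<Sum>i\<in>A. \<Sum>j\<in>A. \<Sum>V\<in>?K. of_bool (i \<in> V \<and> j \<in> V))"
      by (subst sum.swap, rule sum.cong[OF refl], rule sum.swap)
    also have "\<dots> \<le> (\<Sum>i\<in>A. \<Sum>j\<in>A. (if i = j then real k / real n * ?C else 0) + (real k / real n)\<^sup>2 * ?C)"
    proof (intro sum_mono)
      fix i j assume ij: "i \<in> A" "j \<in> A"
      then have lt: "i < n" "j < n" using fA(2) by auto
      show "(\<Sum>V\<in>?K. of_bool (i \<in> V \<and> j \<in> V)) \<le> (if i = j then real k / real n * ?C else 0) + (real k / real n)\<^sup>2 * ?C"
      proof (cases "i = j")
        case True
        have "real (card {V \<in> ?K. i \<in> V}) = real k / real n * ?C"
          using card_ksets_containing[OF lt(1) k(1)] n0 by (simp add: field_simps)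
        then show ?thesis unfolding cnt using True by simp
      next
        case False
        have "card {i, j} \<le> card A" using ij fA by (intro card_mono) auto
        then have "2 \<le> k" using False fA by simp
        then show ?thesis unfolding cnt using card_ksets_containing_two[OF lt False _ k(2)] False by simp
      qed
    qed
    also have "\<dots> = real k * (real k / real n * ?C) + real k * (real k * ((real k / real n)\<^sup>2 * ?C))"
      using fA by (simp add: sum.distrib distrib_left)
    also have "\<dots> = ((real k)\<^sup>2 / real n + ((real k)\<^sup>2 / real n)\<^sup>2) * ?C"
    proof -
      have "real k * (real k * ((real k / real n)\<^sup>2 * ?C)) = ((real k)\<^sup>2 / real n)\<^sup>2 * ?C"
        by (simp add: power2_eq_square)
      then show ?thesis by (simp add: distrib_right power2_eq_square)
    qed
    finally show ?thesis .
  qed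
  define a where "a = (real k)\<^sup>2 / real n"
  have "(\<Sum>V\<in>?K. (real (card (A \<inter> V)) - a)\<^sup>2)
    = (\<Sum>V\<in>?K. (real (card (A \<inter> V)))\<^sup>2) - (\<Sum>V\<in>?K. 2 * a * real (card (A \<inter> V))) + (\<Sum>V\<in>?K. a\<^sup>2)"
    unfolding sum_subtractf[symmetric] sum.distrib[symmetric]
    by (intro sum.cong refl) (simp add: power2_diff mult_ac)
  also have "(\<Sum>V\<in>?K. 2 * a * real (card (A \<inter> V))) = 2 * a * (a * ?C)"
    using S1 unfolding sum_distrib_left[symmetric] a_def by simp
  also have "(\<Sum>V\<in>?K. a\<^sup>2) = a\<^sup>2 * ?C" by (simp add: card_ksets)
  finally have "(\<Sum>V\<in>?K. (real (card (A \<inter> V)) - a)\<^sup>2) \<le> (a + a\<^sup>2) * ?C - 2 * a * (a * ?C) + a\<^sup>2 * ?C"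
    using S2 unfolding a_def by linarith
  also have "\<dots> = a * ?C" by (simp add: algebra_simps power2_eq_square)
  finally have "(\<Sum>V\<in>?K. (real (card (A \<inter> V)) - (real k)\<^sup>2 / real n)\<^sup>2) \<le> (real k)\<^sup>2 / real n * ?C"
    unfolding a_def .
  also have "\<dots> \<le> real n * ?C"
  proof (rule mult_right_mono)
    have "(real k)\<^sup>2 \<le> (real n)\<^sup>2" using k by (intro power_mono) auto
    then show "(real k)\<^sup>2 / real n \<le> real n" using n0 by (simp add: field_simps power2_eq_square)
  qed simp
  finally show ?thesis .
qed

lemma card_atypical_overlap:
  assumes A: "A \<in> ksets n k" and k: "1 \<le> k" "k \<le> n" and "0 < d"
  shows "real (card {V \<in> ksets n k. d < \<bar>real (card (A \<inter> V)) - (real k)\<^sup>2 / real n\<bar>}) \<le> real n / d\<^sup>2 * real (n choose k)"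
proof -
  let ?B = "{V \<in> ksets n k. d < \<bar>real (card (A \<inter> V)) - (real k)\<^sup>2 / real n\<bar>}"
  have "real (card ?B) * d\<^sup>2 = (\<Sum>V\<in>?B. d\<^sup>2)" by simp
  also have "\<dots> \<le> (\<Sum>V\<in>?B. (real (card (A \<inter> V)) - (real k)\<^sup>2 / real n)\<^sup>2)"
    using assms(4) by (intro sum_mono) (auto simp flip: abs_le_square_iff)
  also have "\<dots> \<le> (\<Sum>V\<in>ksets n k. (real (card (A \<inter> V)) - (real k)\<^sup>2 / real n)\<^sup>2)"
    by (intro sum_mono2) auto
  also have "\<dots> \<le> real n * real (n choose k)" by (rule sum_overlap_deviation[OF A k])
  finally show ?thesis using assms(4) by (simp add: field_simps)
qed

text \<open>One term of the expansion of \<open>(1 + t) ^ n\<close> at \<open>t = k / n\<close>,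
  together with \<open>1 + t \<le> exp t\<close>.\<close>

lemma binomial_le_exp:
  assumes "0 < k" "k \<le> n"
  shows "ln (real (n choose k)) \<le> real k * (1 + ln (real n / real k))"
proof -
  define t where "t = real k / real n"
  have t: "0 < t" using assms by (simp add: t_def)
  have C: "0 < real (n choose k)" using assms by (simp add: zero_less_binomial)
  have "real (n choose k) * t ^ k \<le> (\<Sum>i\<le>n. real (n choose i) * t ^ i * 1 ^ (n - i))"
    using assms t member_le_sum[of k "{..n}" "\<lambda>i. real (n choose i) * t ^ i * 1 ^ (n - i)"] by simp
  also have "\<dots> = (t + 1) ^ n" by (simp add: binomial_ring)
  also have "\<dots> \<le> exp t ^ n" using t exp_ge_add_one_self[of t] by (intro power_mono) (auto simp: add.commute)
  also have "\<dots> = exp (real k)" using assms by (simp add: exp_of_nat_mult[symmetric] t_def)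
  finally have le: "real (n choose k) * t ^ k \<le> exp (real k)" .
  have "ln (real (n choose k) * t ^ k) \<le> real k"
  proof -
    have "0 < real (n choose k) * t ^ k" using C t by simp
    then have "ln (real (n choose k) * t ^ k) \<le> ln (exp (real k))"
      using le by (subst ln_le_cancel_iff) auto
    then show ?thesis by simp
  qed
  then have "ln (real (n choose k)) + real k * ln t \<le> real k"
    using C t by (simp add: ln_mult ln_realpow)
  moreover have "ln t = - ln (real n / real k)" using assms by (simp add: t_def ln_div)
  ultimately show ?thesis by (simp add: algebra_simps)
qed

lemma ksets_nonempty: "k \<le> n \<Longrightarrow> ksets n k \<noteq> {}"
  using card_ksets[of n k] by (auto simp: card_gt_0_iff[symmetric] zero_less_binomial)

text \<open>The entropy bound \<open>X\<close> and the variance \<open>2 * k\<^sup>2\<close> are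
  balanced by \<open>s = sqrt X / k\<close>. The resulting constant 2 is the one that
  \<open>C\<^sub>1\<close> has to exceed.\<close>

lemma emax_ksets_first_moment:
  assumes "0 < k" "k \<le> n"
  shows "emax n (ksets n k) \<le> 2 * real k * sqrt (real k * (1 + ln (real n / real k)))"
proof -
  define X where "X = real k * (1 + ln (real n / real k))"
  have "0 \<le> ln (real n / real k)" using assms by simp
  then have X: "0 < X" using assms by (simp add: X_def add_pos_nonneg)
  have "emax n (ksets n k) \<le> ln (card (ksets n k)) / (sqrt X / k) + sqrt X / k * (2 * (real k)\<^sup>2) / 2"
    unfolding emax_def
  proof (rule gmax_le[OF finite_pairs finite_ksets ksets_nonempty[OF assms(2)]])
    fix A assume "A \<in> ksets n k"
    then show "(\<Sum>e\<in>pairs n. (coef A e)\<^sup>2) \<le> 2 * (real k)\<^sup>2"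
      by (subst sum_coef_square) (auto simp: ksets_def)
  qed (use X assms in simp)
  also have "sqrt X / k * (2 * (real k)\<^sup>2) / 2 = real k * sqrt X"
    using assms by (simp add: power2_eq_square)
  also have "ln (card (ksets n k)) / (sqrt X / k) \<le> X / (sqrt X / k)"
    using binomial_le_exp[OF assms] X assms by (intro divide_right_mono) (auto simp: X_def card_ksets)
  also have "X / (sqrt X / k) = real k * sqrt X"
  proof -
    have "X / (sqrt X / k) = real k * (X / sqrt X)" by simp
    then show ?thesis using real_div_sqrt[of X] X by simp
  qed
  finally show ?thesis by (simp add: X_def)
qed

lemma overlap_sets_subset_ksets: "overlap_sets n V k l \<subseteq> ksets n k"
  by (auto simp: overlap_sets_def ksets_def)

lemma emax_mono:
  assumes "T \<subseteq> T'" "T \<noteq> {}" "finite T'" shows "emax n T \<le> emax n T'"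
  unfolding emax_def using assms by (intro gmax_mono_subset) auto

text \<open>A fixed maximiser has overlap close to \<open>k\<^sup>2 / real n\<close> with most planted sets, and the constrained maximum has the
  same mean for all planted sets.\<close>

lemma emax_ksets_le_typical_overlap:
  assumes k: "1 \<le> k" "k \<le> n" and l: "l \<le> k" "k - l \<le> n - k" and V: "V \<subseteq> {..<n}" "card V = k"
    and d: "0 < d0" "\<bar>real l - (real k)\<^sup>2 / real n\<bar> + d0 \<le> d"
  shows "emax n (ksets n k) \<le> emax n (overlap_sets n V k l) + 4 * real n * sqrt (2 * d)
    + real n / d0\<^sup>2 * (4 * real n * sqrt (2 * real n))"
proof -
  let ?K = "ksets n k" and ?O = "\<lambda>V. overlap_sets n V k l" and ?I = "pairs n"
  \<comment> \<open>Pairs at small distance serve the typical planted sets; \<open>?Q\<close>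
    contains all pairs and gives the crude bound for the few atypical ones.\<close>
  let ?P = "{(A, B). A \<in> ?K \<and> B \<in> ?K \<and> real (symdist A B) \<le> 2 * d}"
  let ?Q = "{(A, B). A \<in> ?K \<and> B \<in> ?K \<and> real (symdist A B) \<le> 2 * real n}"
  let ?D = "\<lambda>(A, B) e. coef A e - coef B e"
  have d0: "0 < d" using d by linarith
  have Kne: "?K \<noteq> {}" by (rule ksets_nonempty[OF k(2)])
  have PQ: "?P \<subseteq> ?K \<times> ?K" "?Q \<subseteq> ?K \<times> ?K" by auto
  have KP: "?K \<times> ?K \<subseteq> Pow {..<n} \<times> Pow {..<n}" using ksets_subset[of n k] by blast
  have finPQ: "finite ?P" "finite ?Q" by (rule finite_subset[OF PQ(1)], simp, rule finite_subset[OF PQ(2)], simp)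
  have diagP: "(A, A) \<in> ?P" "(A, A) \<in> ?Q" if "A \<in> ?K" for A using that d0 by (auto simp: symdist_def)
  then have nePQ: "?P \<noteq> {}" "?Q \<noteq> {}" using Kne by blast+
  have all_Q: "(A, B) \<in> ?Q" if "A \<in> ?K" "B \<in> ?K" for A B
  proof -
    have "card (A - B) \<le> card {..<n}" "card (B - A) \<le> card {..<n}"
      using that by (intro card_mono; auto simp: ksets_def)+
    then show ?thesis using that by (simp add: symdist_def)
  qed
  have DP: "gmax ?I ?P ?D (\<lambda>_. 0) \<le> 4 * real n * sqrt (2 * d)"
    using d0 by (intro gmax_coef_diff_le subset_trans[OF PQ(1) KP] nePQ) auto
  have DQ: "gmax ?I ?Q ?D (\<lambda>_. 0) \<le> 4 * real n * sqrt (2 * real n)"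
    using k by (intro gmax_coef_diff_le subset_trans[OF PQ(2) KP] nePQ) auto
  have One: "?O U \<noteq> {}" if "U \<in> ?K" for U
    using that l by (intro overlap_sets_nonempty) (auto simp: ksets_def)
  have eqO: "emax n (?O U) = emax n (?O V)" if "U \<in> ?K" for U
    using that V One[of V] by (intro emax_overlap_sets_exchangeable) (auto simp: ksets_def)
  have intD: "integrable (gauss ?I) (lmax ?I ?P ?D)" "integrable (gauss ?I) (lmax ?I ?Q ?D)"
    using integrable_Max_lin[OF finite_pairs finPQ(1) nePQ(1), of n ?D "\<lambda>_. 0"]
      integrable_Max_lin[OF finite_pairs finPQ(2) nePQ(2), of n ?D "\<lambda>_. 0"] by simp_all
  have int: "integrable (gauss ?I) (lmax ?I T coef)" if "finite T" "T \<noteq> {}" for T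
    using integrable_Max_lin[OF finite_pairs that, of n coef "\<lambda>_. 0"] by simp
  let ?C = "real (n choose k)"
  have C0: "0 < ?C" using k by (simp add: zero_less_binomial)
  \<comment> \<open>For one realisation of the disorder the maximiser \<open>A\<close> is fixed, and
    only the fraction \<open>n / d0\<^sup>2\<close> of all planted sets is atypical for it. The
    bound is the same for every \<open>A\<close>, so the dependence of \<open>A\<close> on the
    disorder does no harm.\<close>
  have pt: "?C * (lmax ?I ?K coef x - lmax ?I ?P ?D x) - real n / d0\<^sup>2 * ?C * lmax ?I ?Q ?D x
    \<le> (\<Sum>U\<in>?K. lmax ?I (?O U) coef x)" for x
  proof -
    have "lmax ?I ?K coef x \<in> (\<lambda>A. lin ?I (coef A) x) ` ?K" using Kne by (intro Max_in) auto
    then obtain A where A: "A \<in> ?K" "lmax ?I ?K coef x = lin ?I (coef A) x" by auto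
    let ?B = "{U \<in> ?K. d0 < \<bar>real (card (A \<inter> U)) - (real k)\<^sup>2 / real n\<bar>}"
    have Dle: "lin ?I (coef A) x - lin ?I (coef B) x \<le> lmax ?I S ?D x" if "(A, B) \<in> S" "finite S" for B S
    proof -
      have "lin ?I (?D (A, B)) x \<le> lmax ?I S ?D x" using that by (intro Max_ge finite_imageI imageI) auto
      then show ?thesis by (simp add: lin_diff)
    qed
    have D0: "0 \<le> lmax ?I ?P ?D x" "0 \<le> lmax ?I ?Q ?D x"
      using Dle[OF diagP(1)[OF A(1)] finPQ(1)] Dle[OF diagP(2)[OF A(1)] finPQ(2)] by auto
    have Ole: "lin ?I (coef B) x \<le> lmax ?I (?O U) coef x" if "B \<in> ?O U" for B U
      using that by (intro Max_ge) auto
    have An: "A \<subseteq> {..<n}" "card A = k" using A by (auto simp: ksets_def)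
    then have fA: "finite A" using finite_subset by blast
    have one: "lmax ?I ?K coef x - lmax ?I ?P ?D x - (if U \<in> ?B then lmax ?I ?Q ?D x else 0) \<le> lmax ?I (?O U) coef x"
      if U: "U \<in> ?K" for U
    proof (cases "U \<in> ?B")
      case True
      obtain B where B: "B \<in> ?O U" using One[OF U] by auto
      then have "(A, B) \<in> ?Q" using A(1) subsetD[OF overlap_sets_subset_ksets] by (intro all_Q) auto
      from Dle[OF this finPQ(2)] Ole[OF B] True D0 A(2) show ?thesis by simp
    next
      case False
      have Un: "U \<subseteq> {..<n}" "l \<le> card U" "k - l \<le> n - card U" using U l by (auto simp: ksets_def)
      obtain B where B: "B \<in> ?O U" "real (symdist A B)
          = \<bar>real (card (A \<inter> U)) - real l\<bar> + \<bar>real (card (A - U)) - real (k - l)\<bar>"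
        using overlap_set_near[OF An(1) Un(1,2) l(1) Un(3)] by metis
      have "card A = card (A \<inter> U) + card (A - U)" using card_Int_Diff[OF fA] by simp
      then have "real (card (A - U)) - real (k - l) = - (real (card (A \<inter> U)) - real l)"
        using An(2) l(1) by (simp add: of_nat_diff)
      then have "real (symdist A B) = 2 * \<bar>real (card (A \<inter> U)) - real l\<bar>" using B(2) by simp
      also have "\<bar>real (card (A \<inter> U)) - real l\<bar> \<le> d"
      proof -
        have "\<bar>real (card (A \<inter> U)) - (real k)\<^sup>2 / real n\<bar> \<le> d0" using False U by simp
        then show ?thesis using d(2) by linarith
      qed
      finally have "(A, B) \<in> ?P" using A(1) subsetD[OF overlap_sets_subset_ksets B(1)] by auto
      from Dle[OF this finPQ(1)] Ole[OF B(1)] A(2) show ?thesis unfolding if_not_P[OF False] by linarith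
    qed
    have "?C * (lmax ?I ?K coef x - lmax ?I ?P ?D x) - real (card ?B) * lmax ?I ?Q ?D x
      = (\<Sum>U\<in>?K. lmax ?I ?K coef x - lmax ?I ?P ?D x - (if U \<in> ?B then lmax ?I ?Q ?D x else 0))"
      by (simp add: sum_subtractf card_ksets sum.If_cases Int_def)
    also have "\<dots> \<le> (\<Sum>U\<in>?K. lmax ?I (?O U) coef x)" by (intro sum_mono one)
    finally have "?C * (lmax ?I ?K coef x - lmax ?I ?P ?D x) - real (card ?B) * lmax ?I ?Q ?D x
      \<le> (\<Sum>U\<in>?K. lmax ?I (?O U) coef x)" .
    moreover have "real (card ?B) * lmax ?I ?Q ?D x \<le> real n / d0\<^sup>2 * ?C * lmax ?I ?Q ?D x"
      by (rule mult_right_mono[OF card_atypical_overlap[OF A(1) k d(1)] D0(2)])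
    ultimately show ?thesis by linarith
  qed
  have "?C * (emax n ?K - gmax ?I ?P ?D (\<lambda>_. 0)) - real n / d0\<^sup>2 * ?C * gmax ?I ?Q ?D (\<lambda>_. 0)
    = (\<integral>x. ?C * (lmax ?I ?K coef x - lmax ?I ?P ?D x) - real n / d0\<^sup>2 * ?C * lmax ?I ?Q ?D x \<partial>gauss ?I)"
    using intD int[OF finite_ksets Kne] by (simp add: emax_def gmax_def)
  also have "\<dots> \<le> (\<integral>x. (\<Sum>U\<in>?K. lmax ?I (?O U) coef x) \<partial>gauss ?I)"
    using intD int One Kne by (intro integral_mono pt) auto
  also have "\<dots> = (\<Sum>U\<in>?K. emax n (?O U))"
    using int One by (simp add: emax_def gmax_def)
  also have "\<dots> = ?C * emax n (?O V)" by (simp add: eqO card_ksets)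
  finally have "?C * (emax n ?K - gmax ?I ?P ?D (\<lambda>_. 0) - real n / d0\<^sup>2 * gmax ?I ?Q ?D (\<lambda>_. 0)) \<le> ?C * emax n (?O V)"
    by (simp add: algebra_simps)
  then have "emax n ?K - gmax ?I ?P ?D (\<lambda>_. 0) - real n / d0\<^sup>2 * gmax ?I ?Q ?D (\<lambda>_. 0) \<le> emax n (?O V)"
    using C0 by (simp only: mult_le_cancel_left_pos)
  moreover have "real n / d0\<^sup>2 * gmax ?I ?Q ?D (\<lambda>_. 0) \<le> real n / d0\<^sup>2 * (4 * real n * sqrt (2 * real n))"
    using DQ by (intro mult_left_mono) auto
  ultimately show ?thesis using DP by linarith
qed

section \<open>Fields in the planted direction\<close>

definition field_max :: "nat \<Rightarrow> nat \<Rightarrow> (nat set \<Rightarrow> real) \<Rightarrow> (nat \<times> nat \<Rightarrow> real) \<Rightarrow> real" where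
  "field_max n k c x = Max ((\<lambda>A. lin (pairs n) (coef A) x + c A) ` ksets n k)"

lemma field_max_attained:
  assumes "k \<le> n"
  obtains A where "A \<in> ksets n k" "field_max n k c x = lin (pairs n) (coef A) x + c A"
proof -
  have "field_max n k c x \<in> (\<lambda>A. lin (pairs n) (coef A) x + c A) ` ksets n k"
    unfolding field_max_def using ksets_nonempty[OF assms] by (intro Max_in) auto
  then show ?thesis using that by auto
qed

lemma field_max_ge: "A \<in> ksets n k \<Longrightarrow> lin (pairs n) (coef A) x + c A \<le> field_max n k c x"
  unfolding field_max_def by (intro Max_ge) auto

lemma integrable_field_max: "k \<le> n \<Longrightarrow> integrable (gauss (pairs n)) (field_max n k c)"
  unfolding field_max_def[abs_def] by (intro integrable_Max_lin ksets_nonempty) auto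

lemma gmax_field_max: "gmax (pairs n) (ksets n k) coef c = (\<integral>x. field_max n k c x \<partial>gauss (pairs n))"
  by (simp add: gmax_def field_max_def)

text \<open>The diagonal entry is left alone, so a set of size \<open>k\<close> containing
  \<open>i\<close> gains through its other \<open>k - 1\<close> sites only.\<close>

definition row :: "real \<Rightarrow> nat \<Rightarrow> nat \<times> nat \<Rightarrow> real" where
  "row \<tau> i = (\<lambda>(a, b). if a \<noteq> b \<and> (a = i \<or> b = i) then \<tau> else 0)"

lemma lin_coef_row:
  assumes A: "A \<subseteq> {..<n}"
  shows "lin (pairs n) (coef A) (row \<tau> i) = (if i \<in> A then 2 * \<tau> * (real (card A) - 1) else 0)"
proof (cases "i \<in> A")
  case False
  then have zero: "coef A e * row \<tau> i e = 0" for e by (cases e) (auto simp: coef_def row_def)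
  show ?thesis unfolding lin_def zero using False by simp
next
  case True
  have fA: "finite A" using A finite_subset by blast
  let ?f = "\<lambda>a b. if a \<in> A \<and> b \<in> A \<and> a \<noteq> b \<and> (a = i \<or> b = i) then \<tau> else 0"
  have "lin (pairs n) (coef A) (row \<tau> i) = (\<Sum>(a, b)\<in>pairs n. if a = b then ?f a b else 2 * ?f a b)"
    unfolding lin_def
  proof (rule sum.cong[OF refl])
    fix e :: "nat \<times> nat"
    obtain a b where "e = (a, b)" by force
    then show "coef A e * row \<tau> i e = (case e of (a, b) \<Rightarrow> if a = b then ?f a b else 2 * ?f a b)"
      by (simp add: coef_def row_def)
  qed
  also have "\<dots> = (\<Sum>a<n. \<Sum>b<n. ?f a b)"
    by (rule sum_pairs_symmetric[symmetric]) auto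
  also have "\<dots> = (\<Sum>a<n. \<Sum>b<n. (if a = i then if b \<in> A - {i} then \<tau> else 0 else 0)
      + (if b = i then if a \<in> A - {i} then \<tau> else 0 else 0))"
  proof (intro sum.cong refl)
    fix a b
    show "?f a b = (if a = i then if b \<in> A - {i} then \<tau> else 0 else 0) + (if b = i then if a \<in> A - {i} then \<tau> else 0 else 0)"
      using True by (cases "a = i"; cases "b = i") simp_all
  qed
  also have "\<dots> = (\<Sum>a<n. if a = i then \<Sum>b<n. if b \<in> A - {i} then \<tau> else 0 else 0)
      + (\<Sum>a<n. if a \<in> A - {i} then \<tau> else 0)"
    unfolding sum.distrib
  proof (intro arg_cong2[where f = "(+)"] sum.cong refl)
    fix a
    show "(\<Sum>b<n. if a = i then if b \<in> A - {i} then \<tau> else 0 else 0)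
      = (if a = i then \<Sum>b<n. if b \<in> A - {i} then \<tau> else 0 else 0)" by (cases "a = i") simp_all
    have "i \<in> {..<n}" using True A by blast
    then show "(\<Sum>b<n. if b = i then if a \<in> A - {i} then \<tau> else 0 else 0) = (if a \<in> A - {i} then \<tau> else 0)"
      by (simp add: sum.delta)
  qed
  also have "\<dots> = 2 * (\<Sum>b<n. if b \<in> A - {i} then \<tau> else 0)"
  proof -
    have "i \<in> {..<n}" using True A by blast
    then show ?thesis by (simp add: sum.delta)
  qed
  also have "(\<Sum>b<n. if b \<in> A - {i} then \<tau> else 0) = (\<Sum>b\<in>A - {i}. \<tau>)"
    using A by (intro sum.mono_neutral_cong_right) auto
  also have "\<dots> = \<tau> * (real (card A) - 1)"
    using True fA card_gt_0_iff[of A] by (subst sum_constant) (auto simp: card_Diff_singleton of_nat_diff Suc_le_eq)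
  finally show ?thesis using True by simp
qed

lemma sum_row_square: "(\<Sum>e\<in>pairs n. (row \<tau> i e)\<^sup>2) \<le> \<tau>\<^sup>2 * real n"
proof -
  let ?R = "{e \<in> pairs n. fst e \<noteq> snd e \<and> (fst e = i \<or> snd e = i)}"
  have row: "(row \<tau> i e)\<^sup>2 = (if fst e \<noteq> snd e \<and> (fst e = i \<or> snd e = i) then \<tau>\<^sup>2 else 0)" for e
    by (cases e) (simp add: row_def)
  have "(\<Sum>e\<in>pairs n. (row \<tau> i e)\<^sup>2) = (\<Sum>e\<in>?R. \<tau>\<^sup>2)"
    unfolding row by (rule sum.inter_filter[symmetric]) simp
  also have "\<dots> = \<tau>\<^sup>2 * real (card ?R)" by simp
  also have "\<dots> \<le> \<tau>\<^sup>2 * real n"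
  proof -
    have "?R \<subseteq> (\<lambda>j. (min i j, max i j)) ` {..<n}"
    proof
      fix e assume "e \<in> ?R"
      then obtain a b where e: "e = (a, b)" "a \<le> b" "b < n" "a = i \<or> b = i" by (auto simp: pairs_def)
      from e(4) show "e \<in> (\<lambda>j. (min i j, max i j)) ` {..<n}"
      proof
        assume "a = i" then show ?thesis using e by (intro image_eqI[of _ _ b]) auto
      next
        assume "b = i" then show ?thesis using e by (intro image_eqI[of _ _ a]) auto
      qed
    qed
    then have "card ?R \<le> card {..<n}" by (rule surj_card_le[rotated]) simp
    then show ?thesis by (simp add: mult_left_mono)
  qed
  finally show ?thesis .
qed

abbreviation overlap_field :: "real \<Rightarrow> nat set \<Rightarrow> nat set \<Rightarrow> real" where
  "overlap_field \<eta> S \<equiv> \<lambda>A. \<eta> * real (card (A \<inter> S))"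

text \<open>A penalty at \<open>i\<close> opposite to the reward given by the field on
  \<open>insert i S\<close>. The two differ by \<open>2 * \<eta>\<close> on sets containing
  \<open>i\<close>, which is exactly what the row shift adds.\<close>

abbreviation punctured_field :: "real \<Rightarrow> nat set \<Rightarrow> nat \<Rightarrow> nat set \<Rightarrow> real" where
  "punctured_field \<eta> S i \<equiv> \<lambda>A. \<eta> * real (card (A \<inter> S)) - (if i \<in> A then \<eta> else 0)"

lemma overlap_field_insert:
  assumes "finite S" "i \<notin> S"
  shows "overlap_field \<eta> (insert i S) A = overlap_field \<eta> S A + (if i \<in> A then \<eta> else 0)"
  using assms by (simp add: Int_insert_right algebra_simps)

text \<open>Shifting row \<open>i\<close> of the disorder by \<open>\<tau>\<close> adds \<open>2 \<tau> (k - 1)\<close> to the energy of exactly those sets that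
  contain \<open>i\<close>; this trades a field at the site \<open>i\<close> for a change of measure.\<close>

lemma field_insert_implies_shifted:
  assumes S: "finite S" "i \<notin> S" and k: "k \<le> n" and \<tau>: "2 * \<tau> * (real k - 1) = 2 * \<eta>"
    and B: "field_max n k (overlap_field \<eta> S) x < field_max n k (overlap_field \<eta> (insert i S)) x"
  shows "field_max n k (punctured_field \<eta> S i) (\<lambda>e\<in>pairs n. x e + row \<tau> i e) + \<eta>
    \<le> field_max n k (overlap_field \<eta> S) (\<lambda>e\<in>pairs n. x e + row \<tau> i e)"
proof -
  let ?y = "\<lambda>e\<in>pairs n. x e + row \<tau> i e"
  have shift: "lin (pairs n) (coef A) ?y = lin (pairs n) (coef A) x + (if i \<in> A then 2 * \<eta> else 0)"
    if "A \<in> ksets n k" for A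
  proof -
    have "lin (pairs n) (coef A) ?y = lin (pairs n) (coef A) x + lin (pairs n) (coef A) (row \<tau> i)"
      using lin_comb[of "pairs n" "coef A" 1 x 1 "row \<tau> i"] by simp
    then show ?thesis using that \<tau> by (simp add: lin_coef_row ksets_def)
  qed
  obtain A where A: "A \<in> ksets n k"
    "field_max n k (overlap_field \<eta> (insert i S)) x = lin (pairs n) (coef A) x + overlap_field \<eta> (insert i S) A"
    by (rule field_max_attained[OF k])
  have iA: "i \<in> A"
  proof (rule ccontr)
    assume "i \<notin> A"
    then have "overlap_field \<eta> (insert i S) A = overlap_field \<eta> S A" by simp
    with B A(2) field_max_ge[OF A(1), of x "overlap_field \<eta> S"] show False by linarith
  qed
  have Aval: "field_max n k (overlap_field \<eta> (insert i S)) x = lin (pairs n) (coef A) x + overlap_field \<eta> S A + \<eta>"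
    using A(2) overlap_field_insert[OF S, of \<eta> A] unfolding if_P[OF iA] by linarith
  obtain D where D: "D \<in> ksets n k"
    "field_max n k (punctured_field \<eta> S i) ?y = lin (pairs n) (coef D) ?y + punctured_field \<eta> S i D"
    by (rule field_max_attained[OF k])
  have up: "lin (pairs n) (coef D) ?y + overlap_field \<eta> S D \<le> field_max n k (overlap_field \<eta> S) ?y"
    by (rule field_max_ge[OF D(1)])
  show ?thesis
  proof (cases "i \<in> D")
    case True
    then show ?thesis using D(2) up by simp
  next
    \<comment> \<open>This case is contradictory. After the shift \<open>A\<close> has under the
      penalty the value it had before under the reward, and that value exceeds
      \<open>field_max n k (overlap_field \<eta> S) x\<close>, which bounds every set avoiding
      \<open>i\<close>.\<close>
    case False
    have "lin (pairs n) (coef D) ?y + overlap_field \<eta> S D = lin (pairs n) (coef D) x + overlap_field \<eta> S D"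
      using shift[OF D(1)] False by simp
    also have "\<dots> \<le> field_max n k (overlap_field \<eta> S) x" by (rule field_max_ge[OF D(1)])
    also have "\<dots> < lin (pairs n) (coef A) x + overlap_field \<eta> S A + \<eta>" using B Aval by simp
    also have "\<dots> = lin (pairs n) (coef A) ?y + punctured_field \<eta> S i A"
      using shift[OF A(1)] iA by simp
    also have "\<dots> \<le> field_max n k (punctured_field \<eta> S i) ?y" by (rule field_max_ge[OF A(1)])
    finally show ?thesis using D(2) False by simp
  qed
qed

lemma punctured_field_exchangeable:
  assumes S: "S \<subseteq> {..<n}" and ij: "i < n" "j < n" "i \<notin> S" "j \<notin> S" and k: "k \<le> n"
  shows "gmax (pairs n) (ksets n k) coef (punctured_field \<eta> S i) = gmax (pairs n) (ksets n k) coef (punctured_field \<eta> S j)"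
proof -
  define p where "p x = (if x = i then j else if x = j then i else x)" for x
  have pp: "p (p x) = x" for x by (simp add: p_def)
  have p: "bij_betw p {..<n} {..<n}"
    using ij pp by (intro bij_betw_byWitness[where f' = p]) (auto simp: p_def)
  have inj: "inj p" by (metis injI pp)
  have "p x = x" if "x \<in> S" for x using that ij by (auto simp: p_def)
  then have pS: "p ` S = S" by simp
  have "gmax (pairs n) (ksets n k) coef (punctured_field \<eta> S i)
    = gmax (pairs n) ((`) p ` ksets n k) coef (punctured_field \<eta> S i)"
    by (simp add: bij_image_ksets[OF p])
  also have "\<dots> = gmax (pairs n) (ksets n k) coef (\<lambda>A. punctured_field \<eta> S i (p ` A))"
    by (rule gmax_permute[OF p ksets_subset ksets_nonempty[OF k]])
  also have "\<dots> = gmax (pairs n) (ksets n k) coef (punctured_field \<eta> S j)"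
  proof (rule gmax_cong)
    fix A
    have "p ` A \<inter> S = p ` (A \<inter> S)" using image_Int[OF inj, of A S] pS by simp
    then have "card (p ` A \<inter> S) = card (A \<inter> S)" using inj by (simp add: card_image inj_on_subset)
    moreover have "p j = i" by (simp add: p_def)
    then have "i \<in> p ` A \<longleftrightarrow> j \<in> A" using inj_image_mem_iff[OF inj, of j A] by metis
    ultimately show "punctured_field \<eta> S i (p ` A) = punctured_field \<eta> S j A" by simp
  qed
  finally show ?thesis .
qed

text \<open>Summed over the sites outside \<open>S\<close>, the losses are at most \<eta> times the
  size \<open>k\<close> of a maximiser. The sites are exchangeable, so each bears an equal share;
  this makes a given site relevant with probability about \<rho>.\<close>

lemma punctured_field_gain:
  assumes S: "S \<subseteq> {..<n}" and i: "i < n" "i \<notin> S" and k: "k \<le> n" and \<eta>: "0 \<le> \<eta>"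
  shows "(real n - real (card S)) * (gmax (pairs n) (ksets n k) coef (overlap_field \<eta> S)
      - gmax (pairs n) (ksets n k) coef (punctured_field \<eta> S i)) \<le> \<eta> * real k"
proof -
  interpret G: prob_space "gauss (pairs n)" by (rule prob_space_gauss)
  have fS: "finite S" using S finite_subset by blast
  let ?F = "field_max n k (overlap_field \<eta> S)" and ?R = "{..<n} - S"
  note int = integrable_field_max[OF k]
  have "(\<Sum>j\<in>?R. gmax (pairs n) (ksets n k) coef (overlap_field \<eta> S) - gmax (pairs n) (ksets n k) coef (punctured_field \<eta> S j))
    = (\<integral>x. (\<Sum>j\<in>?R. ?F x - field_max n k (punctured_field \<eta> S j) x) \<partial>gauss (pairs n))"
    unfolding gmax_field_max using int by simp
  also have "\<dots> \<le> (\<integral>x. \<eta> * real k \<partial>gauss (pairs n))"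
  proof (rule integral_mono)
    show "integrable (gauss (pairs n)) (\<lambda>x. \<Sum>j\<in>?R. ?F x - field_max n k (punctured_field \<eta> S j) x)"
      using int by auto
    fix x
    obtain A where A: "A \<in> ksets n k" "?F x = lin (pairs n) (coef A) x + overlap_field \<eta> S A"
      by (rule field_max_attained[OF k])
    have "(\<Sum>j\<in>?R. ?F x - field_max n k (punctured_field \<eta> S j) x) \<le> (\<Sum>j\<in>?R. if j \<in> A then \<eta> else 0)"
    proof (rule sum_mono)
      fix j
      show "?F x - field_max n k (punctured_field \<eta> S j) x \<le> (if j \<in> A then \<eta> else 0)"
        using field_max_ge[OF A(1), of x "punctured_field \<eta> S j"] A(2) by simp
    qed
    also have "\<dots> \<le> (\<Sum>j\<in>A. \<eta>)"
    proof -
      have "(\<Sum>j\<in>?R. if j \<in> A then \<eta> else 0) = (\<Sum>j\<in>?R \<inter> A. \<eta>)"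
        by (simp add: sum.If_cases Int_def)
      also have "\<dots> \<le> (\<Sum>j\<in>A. \<eta>)"
        using A(1) \<eta> finite_subset by (intro sum_mono2) (auto simp: ksets_def)
      finally show ?thesis .
    qed
    also have "\<dots> = \<eta> * real k" using A(1) by (simp add: ksets_def)
    finally show "(\<Sum>j\<in>?R. ?F x - field_max n k (punctured_field \<eta> S j) x) \<le> \<eta> * real k" .
  qed simp
  also have "\<dots> = \<eta> * real k" by (simp add: G.prob_space)
  also have "(\<Sum>j\<in>?R. gmax (pairs n) (ksets n k) coef (overlap_field \<eta> S) - gmax (pairs n) (ksets n k) coef (punctured_field \<eta> S j))
    = (\<Sum>j\<in>?R. gmax (pairs n) (ksets n k) coef (overlap_field \<eta> S) - gmax (pairs n) (ksets n k) coef (punctured_field \<eta> S i))"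
    using punctured_field_exchangeable[OF S i(1) _ i(2) _ k] by (intro sum.cong refl) auto
  also have "\<dots> = (real n - real (card S)) * (gmax (pairs n) (ksets n k) coef (overlap_field \<eta> S)
      - gmax (pairs n) (ksets n k) coef (punctured_field \<eta> S i))"
    using fS S card_mono[of "{..<n}" S] by (simp add: card_Diff_subset of_nat_diff)
  finally show ?thesis .
qed

text \<open>The new field raises the maximum by at most \<eta>, and only on \<open>B\<close>. The
  row shift maps \<open>B\<close> into \<open>E\<close>, where the site \<open>i\<close> is
  indispensable; the probability of \<open>E\<close> is small by \<open>punctured_field_gain\<close>
  and Markov, and the change of measure carries this over to \<open>B\<close>.\<close>

lemma overlap_field_gain:
  assumes S: "S \<subseteq> {..<n}" and i: "i < n" "i \<notin> S" and k: "2 \<le> k" "k \<le> n" and \<eta>: "0 < \<eta>" and K: "0 < K"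
    and cS: "card S < n"
  shows "gmax (pairs n) (ksets n k) coef (overlap_field \<eta> (insert i S))
    \<le> gmax (pairs n) (ksets n k) coef (overlap_field \<eta> S)
      + \<eta> * (K * (real k / (real n - real (card S))) + exp (3 * (\<eta>\<^sup>2 * real n / (real k - 1)\<^sup>2)) / K\<^sup>2)"
proof -
  interpret G: prob_space "gauss (pairs n)" by (rule prob_space_gauss)
  have fS: "finite S" using S finite_subset by blast
  let ?\<mu> = "gauss (pairs n)" and ?F = "field_max n k (overlap_field \<eta> S)"
    and ?F' = "field_max n k (overlap_field \<eta> (insert i S))" and ?H = "field_max n k (punctured_field \<eta> S i)"
  note int = integrable_field_max[OF k(2)]
  have [measurable]: "field_max n k c \<in> borel_measurable ?\<mu>" for c
    using int by (rule borel_measurable_integrable)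
  \<comment> \<open>For \<eta> = \<theta> sqrt n and \<open>k\<close> close to \<rho> n, the squared
    norm of this row shift is at most about (\<theta> / \<rho>)^2, uniformly in \<open>n\<close>. So
    the change of measure stays bounded for \<theta> of order \<rho>.\<close>
  define \<tau> where "\<tau> = \<eta> / (real k - 1)"
  have \<tau>: "2 * \<tau> * (real k - 1) = 2 * \<eta>" using k by (simp add: \<tau>_def)
  define B where "B = {x \<in> space ?\<mu>. ?F x < ?F' x}"
  define E where "E = {x \<in> space ?\<mu>. ?H x + \<eta> \<le> ?F x}"
  have [measurable]: "B \<in> sets ?\<mu>" "E \<in> sets ?\<mu>" unfolding B_def E_def by measurable
  have HF: "?H x \<le> ?F x" for x
  proof -
    obtain A where A: "A \<in> ksets n k" "?H x = lin (pairs n) (coef A) x + punctured_field \<eta> S i A"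
      by (rule field_max_attained[OF k(2)])
    then show ?thesis using field_max_ge[OF A(1), of x "overlap_field \<eta> S"] \<eta> by (auto split: if_splits)
  qed
  have nS: "0 < real n - real (card S)" using cS by simp
  have "\<eta> * G.prob E = (\<integral>x. \<eta> * indicator E x \<partial>?\<mu>)" by simp
  also have "\<dots> \<le> (\<integral>x. ?F x - ?H x \<partial>?\<mu>)"
  proof (rule integral_mono)
    show "integrable ?\<mu> (\<lambda>x. \<eta> * indicator E x)"
      by (intro integrable_mult_right integrable_real_indicator) (auto simp: G.emeasure_eq_measure)
    show "\<eta> * indicator E x \<le> ?F x - ?H x" for x
      using HF[of x] by (auto simp: E_def indicator_def)
  qed (use int in auto)
  also have "\<dots> = gmax (pairs n) (ksets n k) coef (overlap_field \<eta> S) - gmax (pairs n) (ksets n k) coef (punctured_field \<eta> S i)"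
    unfolding gmax_field_max using int by simp
  also have "\<dots> \<le> \<eta> * real k / (real n - real (card S))"
    using punctured_field_gain[OF S i k(2), of \<eta>] \<eta> nS by (simp add: pos_le_divide_eq mult.commute)
  finally have PE: "G.prob E \<le> real k / (real n - real (card S))"
    using \<eta> by (simp add: times_divide_eq_right[symmetric] del: times_divide_eq_right)
  have "B \<subseteq> {x \<in> space ?\<mu>. (\<lambda>e\<in>pairs n. x e + row \<tau> i e) \<in> E}"
    using field_insert_implies_shifted[OF fS i(2) k(2) \<tau>] by (auto simp: B_def E_def space_gauss)
  then have "G.prob B \<le> measure ?\<mu> {x \<in> space ?\<mu>. (\<lambda>e\<in>pairs n. x e + row \<tau> i e) \<in> E}"
    by (intro G.finite_measure_mono) measurable
  also have "\<dots> \<le> K * G.prob E + exp (3 * (\<Sum>e\<in>pairs n. (row \<tau> i e)\<^sup>2)) / K\<^sup>2"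
    by (rule measure_gauss_shift_le[OF finite_pairs _ K]) measurable
  also have "\<dots> \<le> K * (real k / (real n - real (card S))) + exp (3 * (\<eta>\<^sup>2 * real n / (real k - 1)\<^sup>2)) / K\<^sup>2"
    using PE K sum_row_square[where n = n and \<tau> = \<tau> and i = i]
    by (intro add_mono mult_left_mono divide_right_mono) (auto simp: \<tau>_def power_divide)
  finally have PB: "G.prob B \<le> K * (real k / (real n - real (card S))) + exp (3 * (\<eta>\<^sup>2 * real n / (real k - 1)\<^sup>2)) / K\<^sup>2" .
  have F'F: "?F' x \<le> ?F x + \<eta> * indicator B x" if "x \<in> space ?\<mu>" for x
  proof (cases "x \<in> B")
    case True
    obtain A where A: "A \<in> ksets n k" "?F' x = lin (pairs n) (coef A) x + overlap_field \<eta> (insert i S) A"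
      by (rule field_max_attained[OF k(2)])
    have "overlap_field \<eta> (insert i S) A \<le> overlap_field \<eta> S A + \<eta>"
      unfolding overlap_field_insert[OF fS i(2)] using \<eta> by simp
    then show ?thesis using A(2) field_max_ge[OF A(1), of x "overlap_field \<eta> S"] True by simp
  next
    case False
    then show ?thesis using that by (simp add: B_def)
  qed
  have "(\<integral>x. ?F' x \<partial>?\<mu>) \<le> (\<integral>x. ?F x + \<eta> * indicator B x \<partial>?\<mu>)"
  proof (rule integral_mono)
    show "integrable ?\<mu> (\<lambda>x. ?F x + \<eta> * indicator B x)"
      by (intro Bochner_Integration.integrable_add int integrable_mult_right integrable_real_indicator)
         (auto simp: G.emeasure_eq_measure)
  qed (use int F'F in auto)
  also have "\<dots> = (\<integral>x. ?F x \<partial>?\<mu>) + \<eta> * G.prob B"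
    using int by (subst Bochner_Integration.integral_add)
      (auto intro!: integrable_mult_right integrable_real_indicator simp: G.emeasure_eq_measure)
  also have "\<dots> \<le> (\<integral>x. ?F x \<partial>?\<mu>)
     + \<eta> * (K * (real k / (real n - real (card S))) + exp (3 * (\<eta>\<^sup>2 * real n / (real k - 1)\<^sup>2)) / K\<^sup>2)"
    using PB \<eta> by (intro add_left_mono mult_left_mono) auto
  finally show ?thesis unfolding gmax_field_max .
qed

text \<open>On sets of overlap exactly \<open>l\<close> the field is the constant
  \<open>\<eta> * l\<close>, while over all sets it raises the mean maximum by at most
  \<open>k\<close> single-site gains. The difference is what a large overlap costs the
  noise.\<close>

lemma emax_overlap_penalty:
  assumes V: "V \<subseteq> {..<n}" "card V = k" and k: "2 \<le> k" "k < n" and \<eta>: "0 < \<eta>" and K: "0 < K"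
    and ne: "overlap_sets n V k l \<noteq> {}"
  shows "emax n (overlap_sets n V k l) + \<eta> * real l \<le> emax n (ksets n k)
    + real k * (\<eta> * (K * (real k / (real n - real k)) + exp (3 * (\<eta>\<^sup>2 * real n / (real k - 1)\<^sup>2)) / K\<^sup>2))"
proof -
  interpret G: prob_space "gauss (pairs n)" by (rule prob_space_gauss)
  define c where "c = \<eta> * (K * (real k / (real n - real k)) + exp (3 * (\<eta>\<^sup>2 * real n / (real k - 1)\<^sup>2)) / K\<^sup>2)"
  have fV: "finite V" using V finite_subset by blast
  have "gmax (pairs n) (ksets n k) coef (overlap_field \<eta> S) \<le> emax n (ksets n k) + real (card S) * c" if "S \<subseteq> V" for S
    using finite_subset[OF that fV] that
  proof (induction S rule: finite_induct)
    case empty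
    show ?case by (simp add: emax_def)
  next
    case (insert i S)
    have iS: "i < n" "S \<subseteq> {..<n}" using insert.prems V by auto
    have "card S < card V" using insert fV by (intro psubset_card_mono) auto
    then have cS: "card S \<le> k" "card S < n" using V k by auto
    have "K * (real k / (real n - real (card S))) \<le> K * (real k / (real n - real k))"
      using K k cS by (intro mult_left_mono divide_left_mono) auto
    then have "\<eta> * (K * (real k / (real n - real (card S))) + exp (3 * (\<eta>\<^sup>2 * real n / (real k - 1)\<^sup>2)) / K\<^sup>2) \<le> c"
      unfolding c_def using \<eta> by (intro mult_left_mono) auto
    then have "gmax (pairs n) (ksets n k) coef (overlap_field \<eta> (insert i S))
      \<le> gmax (pairs n) (ksets n k) coef (overlap_field \<eta> S) + c"
      using overlap_field_gain[OF iS(2,1) insert.hyps(2) k(1) less_imp_le[OF k(2)] \<eta> K cS(2)] by linarith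
    then show ?case using insert.IH insert.prems insert.hyps by (simp add: algebra_simps)
  qed
  from this[of V] have V_le: "gmax (pairs n) (ksets n k) coef (overlap_field \<eta> V) \<le> emax n (ksets n k) + real k * c"
    using V by simp
  have "emax n (overlap_sets n V k l) + \<eta> * real l = gmax (pairs n) (overlap_sets n V k l) coef (\<lambda>_. \<eta> * real l)"
  proof -
    have int: "integrable (gauss (pairs n)) (lmax (pairs n) (overlap_sets n V k l) coef)"
      using integrable_Max_lin[OF finite_pairs finite_overlap_sets ne, of n coef "\<lambda>_. 0"] by simp
    have "Max ((\<lambda>A. lin (pairs n) (coef A) x + \<eta> * real l) ` overlap_sets n V k l)
      = lmax (pairs n) (overlap_sets n V k l) coef x + \<eta> * real l" for x
      by (rule Max_add_commute[OF finite_overlap_sets ne])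
    then show ?thesis using int by (simp add: emax_def gmax_def G.prob_space)
  qed
  also have "\<dots> = gmax (pairs n) (overlap_sets n V k l) coef (overlap_field \<eta> V)"
    by (rule gmax_cong) (simp add: overlap_sets_def)
  also have "\<dots> \<le> gmax (pairs n) (ksets n k) coef (overlap_field \<eta> V)"
    using ne by (intro gmax_mono_subset overlap_sets_subset_ksets) auto
  finally show ?thesis using V_le by (simp add: c_def)
qed

section \<open>Bounds for the limiting energy\<close>

definition total_energy :: "real \<Rightarrow> nat \<Rightarrow> real" where
  "total_energy \<rho> n = emax n (ksets n (npts n \<rho>)) / (real n * sqrt n)"

definition noise_limit :: "real \<Rightarrow> real \<Rightarrow> real" where
  "noise_limit \<rho> q = lim (noise_energy \<rho> q)"

lemma noise_limit:
  "0 \<le> q \<Longrightarrow> q \<le> \<rho> \<Longrightarrow> \<rho> < 1 / 2 \<Longrightarrow> noise_energy \<rho> q \<longlonglongrightarrow> noise_limit \<rho> q"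
  unfolding noise_limit_def using convergent_noise_energy convergent_LIMSEQ_iff by blast

lemma eventually_npts_ge:
  assumes "0 < r" shows "eventually (\<lambda>n. m \<le> npts n r) sequentially"
proof -
  have "filterlim (\<lambda>n. real n * r - 1) at_top sequentially" using assms by real_asymp
  then have "eventually (\<lambda>n. real m \<le> real n * r - 1) sequentially" by (rule filterlim_at_top[THEN iffD1, rule_format])
  then show ?thesis
  proof eventually_elim
    case (elim n)
    then have "real m \<le> real (npts n r)" using npts_approx[of r n] assms by linarith
    then show ?case by simp
  qed
qed

lemma eventually_model_facts:
  assumes "0 < \<rho>" "\<rho> < 1 / 2"
  shows "eventually (\<lambda>n. 2 \<le> npts n \<rho> \<and> 2 * npts n \<rho> \<le> n \<and> 0 < n) sequentially"
  using eventually_npts_ge[OF assms(1), of 2] eventually_npts_double_le[of \<rho>] eventually_gt_at_top[of 0] assms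
  by (auto elim: eventually_elim2)

lemma noise_energy_le_total:
  assumes "0 \<le> q" "q \<le> \<rho>" "2 * npts n \<rho> \<le> n"
  shows "noise_energy \<rho> q n \<le> total_energy \<rho> n"
  unfolding noise_energy_def total_energy_def
  using planted_sets_facts[OF assms] overlap_sets_subset_ksets
  by (intro divide_right_mono emax_mono) (auto simp: planted_sets_def)

text \<open>With tolerance \<open>n * \<delta>\<close> the modulus of continuity contributes
  \<open>8 * sqrt \<delta>\<close> after normalisation, and the atypical planted sets contribute
  only \<open>4 * sqrt 2 / (\<delta>\<^sup>2 * n)\<close>.\<close>

lemma eventually_total_energy_le:
  assumes \<rho>: "0 < \<rho>" "\<rho> < 1 / 2" and x: "0 \<le> x" "x \<le> \<rho>" and \<delta>: "\<bar>x - \<rho>\<^sup>2\<bar> < \<delta>" and "0 < \<epsilon>"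
  shows "eventually (\<lambda>n. total_energy \<rho> n \<le> noise_energy \<rho> x n + 8 * sqrt \<delta> + \<epsilon>) sequentially"
proof -
  have \<delta>0: "0 < \<delta>" using \<delta> by linarith
  have "(\<lambda>n. \<bar>real (npts n x) / real n - (real (npts n \<rho>) / real n)\<^sup>2\<bar>) \<longlonglongrightarrow> \<bar>x - \<rho>\<^sup>2\<bar>"
    using \<rho> x by (intro tendsto_intros npts_tendsto) auto
  then have e1: "eventually (\<lambda>n. \<bar>real (npts n x) / real n - (real (npts n \<rho>) / real n)\<^sup>2\<bar> < \<delta>) sequentially"
    using \<delta> by (rule order_tendstoD)
  have "(\<lambda>n. 4 * sqrt 2 / (\<delta>\<^sup>2 * real n)) \<longlonglongrightarrow> 0" using \<delta>0 by real_asymp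
  then have e2: "eventually (\<lambda>n. 4 * sqrt 2 / (\<delta>\<^sup>2 * real n) < \<epsilon>) sequentially"
    using \<open>0 < \<epsilon>\<close> by (rule order_tendstoD)
  show ?thesis
    using e1 e2 eventually_model_facts[OF \<rho>]
  proof eventually_elim
    case (elim n)
    let ?k = "npts n \<rho>" and ?l = "npts n x"
    have n0: "0 < real n" using elim by simp
    have "\<bar>real ?l - (real ?k)\<^sup>2 / real n\<bar> = real n * \<bar>real ?l / real n - (real ?k / real n)\<^sup>2\<bar>"
    proof -
      have "real ?l - (real ?k)\<^sup>2 / real n = real n * (real ?l / real n - (real ?k / real n)\<^sup>2)"
        using n0 by (simp add: right_diff_distrib power2_eq_square)
      then show ?thesis using n0 by (simp only: abs_mult)
    qed
    also have "\<dots> \<le> real n * \<delta>" using elim(1) n0 by (intro mult_left_mono) auto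
    finally have d: "\<bar>real ?l - (real ?k)\<^sup>2 / real n\<bar> + real n * \<delta> \<le> 2 * (real n * \<delta>)" by linarith
    have f: "2 * ?k \<le> n" using elim by simp
    note pf = planted_sets_facts[OF x f]
    have "emax n (ksets n ?k) \<le> emax n (planted_sets \<rho> x n) + 4 * real n * sqrt (2 * (2 * (real n * \<delta>)))
      + real n / (real n * \<delta>)\<^sup>2 * (4 * real n * sqrt (2 * real n))"
      unfolding planted_sets_def using pf elim n0 \<delta>0 d by (intro emax_ksets_le_typical_overlap) auto
    then have "total_energy \<rho> n \<le> (emax n (planted_sets \<rho> x n) + 4 * real n * sqrt (2 * (2 * (real n * \<delta>)))
      + real n / (real n * \<delta>)\<^sup>2 * (4 * real n * sqrt (2 * real n))) / (real n * sqrt n)"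
      unfolding total_energy_def using n0 by (intro divide_right_mono) auto
    also have "\<dots> = noise_energy \<rho> x n + 8 * sqrt \<delta> + 4 * sqrt 2 / (\<delta>\<^sup>2 * real n)"
    proof -
      have s: "sqrt (2 * (2 * (real n * \<delta>))) = 2 * sqrt n * sqrt \<delta>"
        by (simp add: real_sqrt_mult mult.assoc[symmetric])
      show ?thesis unfolding noise_energy_def s add_divide_distrib
        using n0 \<delta>0 by (simp add: real_sqrt_mult power2_eq_square field_simps)
    qed
    finally show ?case using elim(2) by linarith
  qed
qed

lemma noise_limit_le:
  assumes \<rho>: "0 < \<rho>" "\<rho> < 1 / 2" and q: "0 \<le> q" "q \<le> \<rho>" and x: "0 \<le> x" "x \<le> \<rho>" and \<delta>: "\<bar>x - \<rho>\<^sup>2\<bar> < \<delta>"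
  shows "noise_limit \<rho> q \<le> noise_limit \<rho> x + 8 * sqrt \<delta>"
proof (rule field_le_epsilon)
  fix \<epsilon> :: real assume "0 < \<epsilon>"
  show "noise_limit \<rho> q \<le> noise_limit \<rho> x + 8 * sqrt \<delta> + \<epsilon>"
  proof (rule tendsto_le[OF trivial_limit_sequentially _ noise_limit[OF q \<rho>(2)]])
    show "(\<lambda>n. noise_energy \<rho> x n + 8 * sqrt \<delta> + \<epsilon>) \<longlonglongrightarrow> noise_limit \<rho> x + 8 * sqrt \<delta> + \<epsilon>"
      by (intro tendsto_intros noise_limit[OF x \<rho>(2)])
    show "eventually (\<lambda>n. noise_energy \<rho> q n \<le> noise_energy \<rho> x n + 8 * sqrt \<delta> + \<epsilon>) sequentially"
      using eventually_total_energy_le[OF \<rho> x \<delta> \<open>0 < \<epsilon>\<close>] eventually_model_facts[OF \<rho>]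
    proof eventually_elim
      case (elim n)
      then show ?case using noise_energy_le_total[OF q, of n] by linarith
    qed
  qed
qed

lemma noise_limit_penalty:
  assumes \<rho>: "0 < \<rho>" "\<rho> < 1 / 2" and y: "0 \<le> y" "y \<le> \<rho>" and x: "0 \<le> x" "x \<le> \<rho>" and \<delta>: "\<bar>x - \<rho>\<^sup>2\<bar> < \<delta>"
    and \<theta>: "0 < \<theta>" and K: "0 < K"
  shows "noise_limit \<rho> y + \<theta> * y
    \<le> noise_limit \<rho> x + 8 * sqrt \<delta> + \<rho> * (\<theta> * (K * (\<rho> / (1 - \<rho>)) + exp (3 * (\<theta>\<^sup>2 / \<rho>\<^sup>2)) / K\<^sup>2))"
proof (rule field_le_epsilon)
  fix \<epsilon> :: real assume "0 < \<epsilon>"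
  let ?\<kappa> = "\<lambda>n. real (npts n \<rho>) / real n"
  have \<kappa>: "?\<kappa> \<longlonglongrightarrow> \<rho>" using \<rho> by (intro npts_tendsto) auto
  have c0: "(\<lambda>n. 1 / real n) \<longlonglongrightarrow> 0" by real_asymp
  let ?R = "\<lambda>n. ?\<kappa> n * (\<theta> * (K * (?\<kappa> n / (1 - ?\<kappa> n)) + exp (3 * (\<theta>\<^sup>2 / (?\<kappa> n - 1 / real n)\<^sup>2)) / K\<^sup>2))"
  show "noise_limit \<rho> y + \<theta> * y
    \<le> noise_limit \<rho> x + 8 * sqrt \<delta> + \<rho> * (\<theta> * (K * (\<rho> / (1 - \<rho>)) + exp (3 * (\<theta>\<^sup>2 / \<rho>\<^sup>2)) / K\<^sup>2)) + \<epsilon>"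
  proof (rule tendsto_le[OF trivial_limit_sequentially])
    have "?R \<longlonglongrightarrow> \<rho> * (\<theta> * (K * (\<rho> / (1 - \<rho>)) + exp (3 * (\<theta>\<^sup>2 / (\<rho> - 0)\<^sup>2)) / K\<^sup>2))"
      using \<rho> K by (intro tendsto_intros \<kappa> c0) auto
    then have R: "?R \<longlonglongrightarrow> \<rho> * (\<theta> * (K * (\<rho> / (1 - \<rho>)) + exp (3 * (\<theta>\<^sup>2 / \<rho>\<^sup>2)) / K\<^sup>2))" by simp
    show "(\<lambda>n. noise_energy \<rho> x n + 8 * sqrt \<delta> + ?R n + \<epsilon>)
      \<longlonglongrightarrow> noise_limit \<rho> x + 8 * sqrt \<delta> + \<rho> * (\<theta> * (K * (\<rho> / (1 - \<rho>)) + exp (3 * (\<theta>\<^sup>2 / \<rho>\<^sup>2)) / K\<^sup>2)) + \<epsilon>"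
      by (intro tendsto_add tendsto_const noise_limit[OF x \<rho>(2)] R)
    show "(\<lambda>n. noise_energy \<rho> y n + \<theta> * (real (npts n y) / real n)) \<longlonglongrightarrow> noise_limit \<rho> y + \<theta> * y"
      by (intro tendsto_intros noise_limit[OF y \<rho>(2)] npts_tendsto y)
    show "eventually (\<lambda>n. noise_energy \<rho> y n + \<theta> * (real (npts n y) / real n)
        \<le> noise_energy \<rho> x n + 8 * sqrt \<delta> + ?R n + \<epsilon>) sequentially"
      using eventually_total_energy_le[OF \<rho> x \<delta> \<open>0 < \<epsilon>\<close>] eventually_model_facts[OF \<rho>]
    proof eventually_elim
      case (elim n)
      let ?k = "npts n \<rho>" and ?l = "npts n y"
      have n0: "0 < real n" and f: "2 * ?k \<le> n" using elim by auto
      note pf = planted_sets_facts[OF y f]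
      have kn: "?k < n" using elim by simp
      \<comment> \<open>On this scale \<open>\<eta> * l\<close> divided by \<open>n * sqrt n\<close>
        is \<theta> times the normalised overlap.\<close>
      define \<eta> where "\<eta> = \<theta> * sqrt n"
      have \<eta>: "0 < \<eta>" "\<eta>\<^sup>2 = \<theta>\<^sup>2 * real n" using \<theta> n0 by (auto simp: \<eta>_def power_mult_distrib)
      have main: "emax n (planted_sets \<rho> y n) + \<eta> * real ?l \<le> emax n (ksets n ?k)
        + real ?k * (\<eta> * (K * (real ?k / (real n - real ?k)) + exp (3 * (\<eta>\<^sup>2 * real n / (real ?k - 1)\<^sup>2)) / K\<^sup>2))"
        unfolding planted_sets_def using pf elim kn \<eta> K
        by (intro emax_overlap_penalty) (auto simp: planted_sets_def)
      have a1: "real ?k / (real n - real ?k) = ?\<kappa> n / (1 - ?\<kappa> n)"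
        using n0 kn by (simp add: divide_simps)
      have a2: "\<eta>\<^sup>2 * real n / (real ?k - 1)\<^sup>2 = \<theta>\<^sup>2 / (?\<kappa> n - 1 / real n)\<^sup>2"
      proof -
        have e: "?\<kappa> n - 1 / real n = (real ?k - 1) / real n" by (simp add: diff_divide_distrib)
        show ?thesis unfolding e \<eta>(2) power_divide by (simp add: power2_eq_square)
      qed
      let ?c = "K * (?\<kappa> n / (1 - ?\<kappa> n)) + exp (3 * (\<theta>\<^sup>2 / (?\<kappa> n - 1 / real n)\<^sup>2)) / K\<^sup>2"
      have "(emax n (planted_sets \<rho> y n) + \<eta> * real ?l) / (real n * sqrt n)
        \<le> (emax n (ksets n ?k) + real ?k * (\<eta> * ?c)) / (real n * sqrt n)"
        using main n0 unfolding a1 a2 by (intro divide_right_mono) auto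
      moreover have "(emax n (planted_sets \<rho> y n) + \<eta> * real ?l) / (real n * sqrt n)
        = noise_energy \<rho> y n + \<theta> * (real ?l / real n)"
        using n0 by (simp add: noise_energy_def \<eta>_def add_divide_distrib)
      moreover have "(emax n (ksets n ?k) + real ?k * (\<eta> * ?c)) / (real n * sqrt n) = total_energy \<rho> n + ?R n"
        using n0 by (simp add: total_energy_def \<eta>_def add_divide_distrib)
      ultimately show ?case using elim(1) by linarith
    qed
  qed
qed

lemma noise_limit_first_moment:
  assumes \<rho>: "0 < \<rho>" "\<rho> < 1 / 2" and q: "0 \<le> q" "q \<le> \<rho>"
  shows "noise_limit \<rho> q \<le> 2 * \<rho> * sqrt (\<rho> * (1 + ln (1 / \<rho>)))"
proof (rule tendsto_le[OF trivial_limit_sequentially _ noise_limit[OF q \<rho>(2)]])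
  let ?\<kappa> = "\<lambda>n. real (npts n \<rho>) / real n"
  have \<kappa>: "?\<kappa> \<longlonglongrightarrow> \<rho>" using \<rho> by (intro npts_tendsto) auto
  show "(\<lambda>n. 2 * ?\<kappa> n * sqrt (?\<kappa> n * (1 + ln (1 / ?\<kappa> n)))) \<longlonglongrightarrow> 2 * \<rho> * sqrt (\<rho> * (1 + ln (1 / \<rho>)))"
    using \<rho> by (intro tendsto_intros \<kappa>) auto
  show "eventually (\<lambda>n. noise_energy \<rho> q n \<le> 2 * ?\<kappa> n * sqrt (?\<kappa> n * (1 + ln (1 / ?\<kappa> n)))) sequentially"
    using eventually_model_facts[OF \<rho>]
  proof eventually_elim
    case (elim n)
    let ?k = "npts n \<rho>"
    have n0: "0 < real n" and f: "2 * ?k \<le> n" using elim by auto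
    have "noise_energy \<rho> q n \<le> total_energy \<rho> n" by (rule noise_energy_le_total[OF q f])
    also have "\<dots> \<le> (2 * real ?k * sqrt (real ?k * (1 + ln (real n / real ?k)))) / (real n * sqrt n)"
      unfolding total_energy_def using elim by (intro divide_right_mono emax_ksets_first_moment) auto
    also have "\<dots> = 2 * ?\<kappa> n * sqrt (?\<kappa> n * (1 + ln (1 / ?\<kappa> n)))"
      by (simp add: real_sqrt_mult real_sqrt_divide)
    finally show ?case .
  qed
qed

text \<open>At full overlap only the planted set itself is admissible, and a single centred Gaussian
  has mean zero.\<close>

lemma noise_limit_full_overlap:
  assumes \<rho>: "0 < \<rho>" "\<rho> < 1 / 2" shows "noise_limit \<rho> \<rho> = 0"
proof -
  have "eventually (\<lambda>n. noise_energy \<rho> \<rho> n = 0) sequentially"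
    using eventually_model_facts[OF \<rho>]
  proof eventually_elim
    case (elim n)
    let ?V = "{..<npts n \<rho>}"
    have "planted_sets \<rho> \<rho> n = {?V}"
    proof
      show "planted_sets \<rho> \<rho> n \<subseteq> {?V}"
      proof
        fix A assume "A \<in> planted_sets \<rho> \<rho> n"
        then have A: "A \<subseteq> {..<n}" "card A = npts n \<rho>" "card (A \<inter> ?V) = npts n \<rho>"
          by (auto simp: planted_sets_def overlap_sets_def)
        have "finite A" using A(1) finite_subset by blast
        then have "A \<inter> ?V = A" using A by (intro card_subset_eq) auto
        moreover have "A \<inter> ?V = ?V" using A by (intro card_subset_eq) auto
        ultimately show "A \<in> {?V}" by auto
      qed
      show "{?V} \<subseteq> planted_sets \<rho> \<rho> n" using elim by (auto simp: planted_sets_def overlap_sets_def)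
    qed
    then show ?case by (simp add: noise_energy_def emax_def gmax_def integral_lin)
  qed
  then have "noise_energy \<rho> \<rho> \<longlonglongrightarrow> 0" by (rule tendsto_eventually)
  then show ?thesis using noise_limit[of \<rho> \<rho>] \<rho> LIMSEQ_unique by fastforce
qed

section \<open>Transfer to the planted submatrix model\<close>

definition entry_sd :: "nat \<Rightarrow> nat \<times> nat \<Rightarrow> real" where
  "entry_sd N = (\<lambda>(i, j). if i = j then sqrt (2 / real N) else sqrt (1 / real N))"

definition std_entries :: "(nat \<Rightarrow> nat \<Rightarrow> nat \<Rightarrow> 'w \<Rightarrow> real) \<Rightarrow> nat \<Rightarrow> 'w \<Rightarrow> nat \<times> nat \<Rightarrow> real" where
  "std_entries W N \<omega> = (\<lambda>(i, j)\<in>pairs N. W N i j \<omega> / entry_sd N (i, j))"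

lemma pairs_eq_upper: "{(i, j). i \<le> j \<and> j < N} = pairs N"
  by (simp add: pairs_def)

lemma hamiltonian_indicator:
  assumes N: "0 < N" and A: "A \<subseteq> {..<N}" and sym: "\<And>i j. i < N \<Longrightarrow> j < N \<Longrightarrow> W N i j \<omega> = W N j i \<omega>"
  shows "hamiltonian N (\<lambda>i j. W N i j \<omega>) (\<lambda>i\<in>{..<N}. if i \<in> A then 1 else 0)
    = lin (pairs N) (coef A) (std_entries W N \<omega>) / sqrt N"
proof -
  let ?f = "\<lambda>i j. if i \<in> A \<and> j \<in> A then W N i j \<omega> else 0"
  have "hamiltonian N (\<lambda>i j. W N i j \<omega>) (\<lambda>i\<in>{..<N}. if i \<in> A then 1 else 0) = (\<Sum>i<N. \<Sum>j<N. ?f i j)"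
    unfolding hamiltonian_def ip_def sum_distrib_left by (intro sum.cong refl) auto
  also have "\<dots> = (\<Sum>(i, j)\<in>pairs N. if i = j then ?f i j else 2 * ?f i j)"
  proof (rule sum_pairs_symmetric)
    show "?f i j = ?f j i" for i j using sym[of i j] A by auto
  qed
  also have "\<dots> = (\<Sum>e\<in>pairs N. coef A e * std_entries W N \<omega> e / sqrt N)"
  proof (rule sum.cong[OF refl])
    fix e assume e: "e \<in> pairs N"
    obtain i j where ij: "e = (i, j)" by force
    have s2: "sqrt (2 / real N) = sqrt 2 / sqrt N" "sqrt (1 / real N) = 1 / sqrt N"
      by (simp_all add: real_sqrt_divide)
    show "(case e of (i, j) \<Rightarrow> if i = j then ?f i j else 2 * ?f i j) = coef A e * std_entries W N \<omega> e / sqrt N"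
      using e N unfolding ij by (simp add: coef_def std_entries_def entry_sd_def s2)
  qed
  finally show ?thesis by (simp add: lin_def sum_divide_distrib)
qed

definition planted_set :: "(nat \<Rightarrow> nat \<Rightarrow> real) \<Rightarrow> nat \<Rightarrow> nat set" where
  "planted_set v N = {i. i < N \<and> v N i = 1}"

lemma npts_grid: "0 < N \<Longrightarrow> 0 \<le> r \<Longrightarrow> real N * grid N r = real (npts N r)"
proof -
  assume N: "0 < N" and r: "0 \<le> r"
  have "0 \<le> round (real N * r)" using round_mono[of 0 "real N * r"] r by simp
  then show ?thesis using N by (simp add: grid_def npts_def)
qed

lemma sum_indicator_subset: "A \<subseteq> {..<N::nat} \<Longrightarrow> (\<Sum>i<N. if i \<in> A then 1 else 0 :: real) = real (card A)"
proof -
  assume A: "A \<subseteq> {..<N}"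
  have "(\<Sum>i<N. if i \<in> A then 1 else 0 :: real) = (\<Sum>i\<in>{..<N} \<inter> A. 1)"
    by (rule sum.inter_restrict[symmetric]) simp
  also have "{..<N} \<inter> A = A" using A by auto
  finally show ?thesis by simp
qed

lemma Sparse_indicator:
  assumes "x \<in> Sparse N r"
  obtains A where "A \<subseteq> {..<N}" "x = (\<lambda>i\<in>{..<N}. if i \<in> A then 1 else 0)" "real (card A) = real N * r"
    "A = {i. i < N \<and> x i = 1}"
proof -
  let ?A = "{i. i < N \<and> x i = 1}"
  have x: "x \<in> extensional {..<N}" "\<And>i. i < N \<Longrightarrow> x i = 0 \<or> x i = 1" "(\<Sum>i<N. x i) = real N * r"
    using assms by (auto simp: Sparse_def PiE_def)
  have eq: "x = (\<lambda>i\<in>{..<N}. if i \<in> ?A then 1 else 0)"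
  proof
    fix i show "x i = (\<lambda>i\<in>{..<N}. if i \<in> ?A then 1 else 0) i"
      using x(1) x(2)[of i] by (auto simp: extensional_def)
  qed
  have "(\<Sum>i<N. x i) = (\<Sum>i<N. if i \<in> ?A then 1 else 0)" using x(2) by (intro sum.cong) auto
  also have "\<dots> = real (card ?A)" by (rule sum_indicator_subset) auto
  finally have "real (card ?A) = real N * r" using x(3) by simp
  then show ?thesis using eq by (intro that[of ?A]) auto
qed

lemma indicator_in_Sparse:
  assumes "A \<subseteq> {..<N}" "real (card A) = real N * r"
  shows "(\<lambda>i\<in>{..<N}. if i \<in> A then 1 else 0) \<in> Sparse N r"
proof -
  show ?thesis using assms(2) sum_indicator_subset[OF assms(1)] by (auto simp: Sparse_def)
qed

lemma ip_indicators:
  assumes "A \<subseteq> {..<N}" "B \<subseteq> {..<N}"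
  shows "ip N (\<lambda>i\<in>{..<N}. if i \<in> A then 1 else 0) (\<lambda>i\<in>{..<N}. if i \<in> B then 1 else 0) = real (card (A \<inter> B))"
proof -
  have "ip N (\<lambda>i\<in>{..<N}. if i \<in> A then 1 else 0) (\<lambda>i\<in>{..<N}. if i \<in> B then 1 else 0) = (\<Sum>i<N. if i \<in> A \<inter> B then 1 else 0)"
    unfolding ip_def by (intro sum.cong) auto
  also have "\<dots> = real (card (A \<inter> B))" using assms(1) by (intro sum_indicator_subset) auto
  finally show ?thesis .
qed

lemma energy_N_eq_lmax:
  assumes N: "0 < N" and \<rho>: "0 \<le> \<rho>" and q: "0 \<le> q" and v: "v N \<in> Sparse N (grid N \<rho>)"
    and sym: "\<And>i j. i < N \<Longrightarrow> j < N \<Longrightarrow> W N i j \<omega> = W N j i \<omega>"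
    and ne: "overlap_sets N (planted_set v N) (npts N \<rho>) (npts N q) \<noteq> {}"
  shows "energy_N N (\<lambda>i j. W N i j \<omega>) (v N) \<rho> lam q
    = lmax (pairs N) (overlap_sets N (planted_set v N) (npts N \<rho>) (npts N q)) coef (std_entries W N \<omega>) / (real N * sqrt N)
      + lam * (grid N q)\<^sup>2"
proof -
  let ?V = "planted_set v N" and ?\<chi> = "\<lambda>A. \<lambda>i\<in>{..<N}. if i \<in> A then 1 else (0 :: real)"
  let ?O = "overlap_sets N ?V (npts N \<rho>) (npts N q)"
  have vV: "?V \<subseteq> {..<N}" "v N = ?\<chi> ?V"
    using Sparse_indicator[OF v] unfolding planted_set_def by metis+
  have "{x \<in> Sparse N (grid N \<rho>). ip N x (v N) = real N * grid N q} = ?\<chi> ` ?O"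
  proof
    show "{x \<in> Sparse N (grid N \<rho>). ip N x (v N) = real N * grid N q} \<subseteq> ?\<chi> ` ?O"
    proof
      fix x assume x: "x \<in> {x \<in> Sparse N (grid N \<rho>). ip N x (v N) = real N * grid N q}"
      then obtain A where A: "A \<subseteq> {..<N}" "x = ?\<chi> A" "real (card A) = real N * grid N \<rho>"
        using Sparse_indicator[of x N "grid N \<rho>"] by blast
      have "real (card (A \<inter> ?V)) = real N * grid N q"
        using x ip_indicators[OF A(1) vV(1)] vV(2) A(2) by simp
      then have "A \<in> ?O"
        using A npts_grid[OF N \<rho>] npts_grid[OF N q] by (simp add: overlap_sets_def)
      then show "x \<in> ?\<chi> ` ?O" using A(2) by blast
    qed
    show "?\<chi> ` ?O \<subseteq> {x \<in> Sparse N (grid N \<rho>). ip N x (v N) = real N * grid N q}"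
    proof
      fix x assume "x \<in> ?\<chi> ` ?O"
      then obtain A where A: "A \<subseteq> {..<N}" "card A = npts N \<rho>" "card (A \<inter> ?V) = npts N q" "x = ?\<chi> A"
        by (auto simp: overlap_sets_def)
      have "x \<in> Sparse N (grid N \<rho>)"
        unfolding A(4) using A npts_grid[OF N \<rho>] by (intro indicator_in_Sparse) auto
      moreover have "ip N x (v N) = real N * grid N q"
        using ip_indicators[OF A(1) vV(1)] vV(2) A(3,4) npts_grid[OF N q] by simp
      ultimately show "x \<in> {x \<in> Sparse N (grid N \<rho>). ip N x (v N) = real N * grid N q}" by simp
    qed
  qed
  then have "hamiltonian N (\<lambda>i j. W N i j \<omega>) ` {x \<in> Sparse N (grid N \<rho>). ip N x (v N) = real N * grid N q}
    = (\<lambda>A. hamiltonian N (\<lambda>i j. W N i j \<omega>) (?\<chi> A)) ` ?O"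
    by (simp add: image_image)
  also have "\<dots> = (\<lambda>A. lin (pairs N) (coef A) (std_entries W N \<omega>) / sqrt N) ` ?O"
    using hamiltonian_indicator[where W = W and \<omega> = \<omega> and N = N, OF N _ sym] overlap_sets_subset[of N ?V "npts N \<rho>" "npts N q"]
    by (intro image_cong refl) blast
  also have "\<dots> = (\<lambda>y. y / sqrt N) ` (\<lambda>A. lin (pairs N) (coef A) (std_entries W N \<omega>)) ` ?O"
    by (simp add: image_image)
  also have "Max \<dots> = lmax (pairs N) ?O coef (std_entries W N \<omega>) / sqrt N"
    using ne by (intro mono_Max_commute[symmetric]) (auto intro!: monoI divide_right_mono)
  finally show ?thesis by (simp add: energy_N_def)
qed

context planted_submatrix
begin

lemma std_entries_measurable:
  assumes "0 < N" shows "std_entries W N \<in> M \<rightarrow>\<^sub>M gauss (pairs N)"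
proof -
  have rv: "(\<lambda>\<omega>. W N i j \<omega>) \<in> borel_measurable M" if "(i, j) \<in> pairs N" for i j
    using W_indep[of N] that unfolding indep_vars_def pairs_eq_upper by fastforce
  have "(\<lambda>\<omega>. \<lambda>e\<in>pairs N. (case e of (i, j) \<Rightarrow> W N i j \<omega> / entry_sd N (i, j))) \<in> M \<rightarrow>\<^sub>M (\<Pi>\<^sub>M e\<in>pairs N. borel)"
    using rv by (intro measurable_restrict) auto
  then show ?thesis
    unfolding std_entries_def[abs_def] using measurable_cong_sets[OF refl sets_gauss] by blast
qed

lemma distr_std_entries:
  assumes N: "0 < N" shows "distr M (gauss (pairs N)) (std_entries W N) = gauss (pairs N)"
proof -
  let ?X = "\<lambda>e \<omega>. (case e of (i, j) \<Rightarrow> W N i j \<omega>) / entry_sd N e"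
  have "indep_vars (\<lambda>_. borel) (\<lambda>e \<omega>. (\<lambda>e x. x / entry_sd N e) e ((case e of (i, j) \<Rightarrow> W N i j) \<omega>)) (pairs N)"
    using W_indep[of N] unfolding pairs_eq_upper by (rule indep_vars_compose2) simp
  then have ind: "indep_vars (\<lambda>_. borel) ?X (pairs N)"
    by (simp add: case_prod_unfold)
  have std: "distr M borel (?X e) = std_normal" if e: "e \<in> pairs N" for e
  proof -
    obtain i j where ij: "e = (i, j)" by force
    have lt: "i \<le> j" "j < N" using e ij by (auto simp: pairs_def)
    have sd: "0 < entry_sd N (i, j)" using N by (simp add: entry_sd_def)
    have "distributed M lborel (W N i j) (normal_density 0 (entry_sd N (i, j)))"
      using W_offdiag[of i j N] W_diag[of j N] lt by (cases "i = j") (auto simp: entry_sd_def)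
    then have "distributed M lborel (?X e) std_normal_density"
      using normal_standard_normal_convert[OF sd, of "W N i j" 0] by (simp add: ij)
    then have "distr M lborel (?X e) = std_normal" by (simp add: distributed_def)
    moreover have "distr M borel (?X e) = distr M lborel (?X e)" by (rule distr_cong) auto
    ultimately show ?thesis by simp
  qed
  have "(0, 0) \<in> pairs N" using N by (simp add: pairs_def)
  then have ne: "pairs N \<noteq> {}" by blast
  have rv: "?X e \<in> borel_measurable M" if "e \<in> pairs N" for e
    using ind that unfolding indep_vars_def by blast
  have "distr M (\<Pi>\<^sub>M e\<in>pairs N. borel) (\<lambda>\<omega>. \<lambda>e\<in>pairs N. ?X e \<omega>) = (\<Pi>\<^sub>M e\<in>pairs N. distr M borel (?X e))"
    using indep_vars_iff_distr_eq_PiM'[OF ne rv] ind by simp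
  also have "\<dots> = gauss (pairs N)"
    unfolding gauss_def using std by (intro PiM_cong refl) auto
  also have "(\<lambda>\<omega>. \<lambda>e\<in>pairs N. ?X e \<omega>) = std_entries W N"
    by (auto simp: std_entries_def fun_eq_iff restrict_def)
  finally have "distr M (\<Pi>\<^sub>M e\<in>pairs N. borel) (std_entries W N) = gauss (pairs N)" .
  moreover have "distr M (gauss (pairs N)) (std_entries W N) = distr M (\<Pi>\<^sub>M e\<in>pairs N. borel) (std_entries W N)"
    by (rule distr_cong) (auto simp: sets_gauss)
  ultimately show ?thesis by simp
qed

text \<open>The variance bound is \<open>2 * N\<^sup>2\<close> and the deviation
  \<open>t * N * sqrt N\<close>, so the exponent is linear in \<open>N\<close> and the probabilities
  are dominated by a geometric series, as Borel-Cantelli requires.\<close>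

lemma lmax_deviation_probability:
  assumes N: "0 < N" and T: "T \<subseteq> Pow {..<N}" "T \<noteq> {}" and t: "0 \<le> t"
  shows "prob {\<omega> \<in> space M. t * (real N * sqrt N) \<le> \<bar>lmax (pairs N) T coef (std_entries W N \<omega>) - emax N T\<bar>}
    \<le> 2 * exp (- (t\<^sup>2 / pi\<^sup>2)) ^ N"
proof -
  have finT: "finite T" using T(1) finite_subset by blast
  let ?E = "{x \<in> space (gauss (pairs N)). t * (real N * sqrt N) \<le> \<bar>lmax (pairs N) T coef x - emax N T\<bar>}"
  note [measurable] = std_entries_measurable[OF N] lmax_measurable[OF finT, of "pairs N" coef]
  have E: "?E \<in> sets (gauss (pairs N))" by measurable
  have "prob {\<omega> \<in> space M. t * (real N * sqrt N) \<le> \<bar>lmax (pairs N) T coef (std_entries W N \<omega>) - emax N T\<bar>}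
    = prob (std_entries W N -` ?E \<inter> space M)"
    using measurable_space[OF std_entries_measurable[OF N]] by (intro arg_cong[where f = prob]) auto
  also have "\<dots> = measure (gauss (pairs N)) ?E"
    using measure_distr[OF std_entries_measurable[OF N] E] by (simp add: distr_std_entries[OF N])
  also have "\<dots> \<le> 2 * exp (- (2 * (t * (real N * sqrt N))\<^sup>2 / (pi\<^sup>2 * (2 * (real N)\<^sup>2))))"
    unfolding emax_def
  proof (rule gaussian_concentration_lmax[OF finite_pairs finT T(2)])
    fix A assume A: "A \<in> T"
    then have "card A \<le> N" using T(1) card_mono[of "{..<N}" A] by auto
    then have "(real (card A))\<^sup>2 \<le> (real N)\<^sup>2" by (intro power_mono) auto
    then show "(\<Sum>e\<in>pairs N. (coef A e)\<^sup>2) \<le> 2 * (real N)\<^sup>2"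
      using A T(1) by (subst sum_coef_square) auto
  qed (use N t in auto)
  also have "2 * (t * (real N * sqrt N))\<^sup>2 / (pi\<^sup>2 * (2 * (real N)\<^sup>2)) = real N * (t\<^sup>2 / pi\<^sup>2)"
    using N by (simp add: power_mult_distrib power2_eq_square)
  also have "exp (- (real N * (t\<^sup>2 / pi\<^sup>2))) = exp (- (t\<^sup>2 / pi\<^sup>2)) ^ N"
    by (simp add: exp_of_nat_mult[symmetric])
  finally show ?thesis .
qed

text \<open>Borel-Cantelli asks only for summable probabilities, one size at a time, so the joint
  law of the noise for different sizes does not matter. Exchangeability identifies the mean for the
  actual planted set with that for the initial segment.\<close>

lemma AE_energy_N_tendsto:
  assumes \<rho>: "\<rho> < 1 / 2" and q: "0 \<le> q" "q \<le> \<rho>"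
  shows "AE \<omega> in M. (\<lambda>N. energy_N N (\<lambda>i j. W N i j \<omega>) (v N) \<rho> lam q) \<longlonglongrightarrow> noise_limit \<rho> q + lam * q\<^sup>2"
proof -
  define TN where "TN N = overlap_sets N (planted_set v N) (npts N \<rho>) (npts N q)" for N
  define good where "good N \<longleftrightarrow> 2 * npts N \<rho> \<le> N \<and> 0 < N" for N
  have ev: "eventually good sequentially"
    using eventually_model_facts[OF sparsity(1) \<rho>] by eventually_elim (simp add: good_def)
  have V: "planted_set v N \<subseteq> {..<N}" "card (planted_set v N) = npts N \<rho>" if "good N" for N
  proof -
    obtain A where A: "A \<subseteq> {..<N}" "real (card A) = real N * grid N \<rho>" "A = {i. i < N \<and> v N i = 1}"
      using Sparse_indicator[OF planted[of N]] by metis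
    have "real (card A) = real (npts N \<rho>)"
      using A(2) npts_grid[of N \<rho>] that sparsity by (simp add: good_def)
    then show "planted_set v N \<subseteq> {..<N}" "card (planted_set v N) = npts N \<rho>"
      using A by (auto simp: planted_set_def)
  qed
  have Osub: "TN N \<subseteq> Pow {..<N}" for N unfolding TN_def by (rule overlap_sets_subset)
  have finO: "finite (TN N)" for N unfolding TN_def by simp
  have TN: "TN N \<noteq> {}" "emax N (TN N) = emax N (planted_sets \<rho> q N)" if "good N" for N
  proof -
    have f: "2 * npts N \<rho> \<le> N" using that by (simp add: good_def)
    note pf = planted_sets_facts[OF q f]
    show "emax N (TN N) = emax N (planted_sets \<rho> q N)"
      using pf V[OF that] unfolding TN_def planted_sets_def
      by (intro emax_overlap_sets_exchangeable) auto
    show "TN N \<noteq> {}"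
      unfolding TN_def using pf V[OF that] by (intro overlap_sets_nonempty) auto
  qed
  let ?L = "\<lambda>N \<omega>. lmax (pairs N) (TN N) coef (std_entries W N \<omega>)"
  have AE_t: "AE \<omega> in M. eventually (\<lambda>N. \<bar>?L N \<omega> - emax N (TN N)\<bar> < t * (real N * sqrt N)) sequentially" if t: "0 < t" for t
  proof -
    \<comment> \<open>Empty at the finitely many sizes that are not \<open>good\<close>, where the
      constrained set might be empty; this way the geometric bound holds for every
      \<open>N\<close>.\<close>
    define A where "A N = (if good N then {\<omega> \<in> space M. t * (real N * sqrt N) \<le> \<bar>?L N \<omega> - emax N (TN N)\<bar>} else {})" for N
    have Am: "A N \<in> sets M" for N
    proof (cases "good N")
      case True
      then have "0 < N" by (simp add: good_def)
      have [measurable]: "?L N \<in> borel_measurable M"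
        by (rule measurable_compose[OF std_entries_measurable[OF \<open>0 < N\<close>] lmax_measurable[OF finO]])
      show ?thesis unfolding A_def if_P[OF True] by measurable
    qed (simp add: A_def)
    have "AE \<omega> in M. eventually (\<lambda>N. \<omega> \<in> space M - A N) sequentially"
    proof (rule borel_cantelli_AE1[OF Am])
      show "emeasure M (A N) < \<infinity>" for N by (simp add: emeasure_eq_measure)
      have "exp (- (t\<^sup>2 / pi\<^sup>2)) < 1" using t by simp
      then have "summable (\<lambda>N. 2 * exp (- (t\<^sup>2 / pi\<^sup>2)) ^ N)" by (intro summable_mult summable_geometric) simp
      then show "summable (\<lambda>N. prob (A N))"
      proof (rule summable_comparison_test'[where N = 0])
        fix N
        show "norm (prob (A N)) \<le> 2 * exp (- (t\<^sup>2 / pi\<^sup>2)) ^ N"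
          using lmax_deviation_probability[OF _ Osub TN(1), of N t] t by (auto simp: A_def good_def)
      qed
    qed
    then show ?thesis
    proof eventually_elim
      case (elim \<omega>)
      with ev show ?case by eventually_elim (auto simp: A_def)
    qed
  qed
  \<comment> \<open>Countably many thresholds, so that a single null set serves all of them.\<close>
  have "AE \<omega> in M. \<forall>m::nat. eventually (\<lambda>N. \<bar>?L N \<omega> - emax N (TN N)\<bar> < 1 / real (Suc m) * (real N * sqrt N)) sequentially"
    unfolding AE_all_countable by (intro allI AE_t) simp
  with AE_space show ?thesis
  proof eventually_elim
    case (elim \<omega>)
    let ?D = "\<lambda>N. (?L N \<omega> - emax N (TN N)) / (real N * sqrt N)"
    have D0: "?D \<longlonglongrightarrow> 0"
    proof (rule tendstoI)
      fix e :: real assume "0 < e"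
      then obtain m :: nat where m: "1 / real (Suc m) < e" using reals_Archimedean by (auto simp: inverse_eq_divide)
      have "eventually (\<lambda>N. \<bar>?L N \<omega> - emax N (TN N)\<bar> < 1 / real (Suc m) * (real N * sqrt N)) sequentially"
        using elim(2) by blast
      with ev show "eventually (\<lambda>N. dist (?D N) 0 < e) sequentially"
      proof eventually_elim
        case (elim N)
        have "0 < real N * sqrt N" using elim(1) by (simp add: good_def)
        then have "\<bar>?D N\<bar> < 1 / real (Suc m)"
          using elim(2) by (simp add: abs_div_pos[symmetric] pos_divide_less_eq)
        then show ?case using m by (simp add: dist_real_def)
      qed
    qed
    have grid: "(\<lambda>N. grid N q) \<longlonglongrightarrow> q"
    proof (rule Lim_transform_eventually[OF npts_tendsto[OF q(1)]])
      show "eventually (\<lambda>N. real (npts N q) / real N = grid N q) sequentially"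
        using eventually_gt_at_top[of 0]
      proof eventually_elim
        case (elim N)
        then show ?case using npts_grid[OF elim q(1)] by (simp add: field_simps)
      qed
    qed
    have "(\<lambda>N. ?D N + noise_energy \<rho> q N + lam * (grid N q)\<^sup>2) \<longlonglongrightarrow> 0 + noise_limit \<rho> q + lam * q\<^sup>2"
      by (intro tendsto_intros D0 noise_limit q \<rho> grid)
    moreover have "eventually (\<lambda>N. ?D N + noise_energy \<rho> q N + lam * (grid N q)\<^sup>2
        = energy_N N (\<lambda>i j. W N i j \<omega>) (v N) \<rho> lam q) sequentially"
      using ev
    proof eventually_elim
      case (elim N)
      have N: "0 < N" using elim by (simp add: good_def)
      have "energy_N N (\<lambda>i j. W N i j \<omega>) (v N) \<rho> lam q = ?L N \<omega> / (real N * sqrt N) + lam * (grid N q)\<^sup>2"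
        unfolding TN_def
      proof (rule energy_N_eq_lmax[where v = v and W = W and \<omega> = \<omega>, OF N])
        show "0 \<le> \<rho>" "0 \<le> q" using sparsity q by auto
        show "v N \<in> Sparse N (grid N \<rho>)" by (rule planted)
        show "W N i j \<omega> = W N j i \<omega>" if "i < N" "j < N" for i j
          using W_sym that \<open>\<omega> \<in> space M\<close> .
        show "overlap_sets N (planted_set v N) (npts N \<rho>) (npts N q) \<noteq> {}"
          using TN(1)[OF elim] by (simp add: TN_def)
      qed
      then show ?case by (simp add: noise_energy_def TN(2)[OF elim] diff_divide_distrib)
    qed
    ultimately show ?case using Lim_transform_eventually by fastforce
  qed
qed

text \<open>A deterministic almost sure limit is unique on a probability space, so the definite
  description picks it out.\<close>

lemma energy_eq:
  assumes "\<rho> < 1 / 2" "0 \<le> q" "q \<le> \<rho>"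
  shows "energy M W v \<rho> lam q = noise_limit \<rho> q + lam * q\<^sup>2"
  unfolding energy_def
proof (rule the_equality)
  note lim = AE_energy_N_tendsto[OF assms]
  show "AE \<omega> in M. (\<lambda>N. energy_N N (\<lambda>i j. W N i j \<omega>) (v N) \<rho> lam q) \<longlonglongrightarrow> noise_limit \<rho> q + lam * q\<^sup>2"
    by (rule lim)
  fix e assume "AE \<omega> in M. (\<lambda>N. energy_N N (\<lambda>i j. W N i j \<omega>) (v N) \<rho> lam q) \<longlonglongrightarrow> e"
  with lim have "AE \<omega> in M. e = noise_limit \<rho> q + lam * q\<^sup>2"
    by eventually_elim (rule LIMSEQ_unique)
  then show "e = noise_limit \<rho> q + lam * q\<^sup>2" by simp
qed

end

section \<open>The overlap gap\<close>

text \<open>Reduces the gap to two elementary inequalities: \<open>penalty\<close> puts the energy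
  at \<open>y\<close> below that at \<open>x\<close>, and \<open>first_moment\<close> separates the
  suprema by comparing with the endpoint \<rho>. The remaining witnesses are \<open>w = 0\<close>
  and an \<open>x\<close> just above \<rho>^2, while \<open>y\<close>, \<theta> and \<open>K\<close>
  are left to be chosen.\<close>

lemma overlap_gap_propertyI:
  fixes G :: "real \<Rightarrow> real"
  assumes \<rho>: "0 < \<rho>" "\<rho> < 1 / 2" and \<epsilon>: "0 < \<epsilon>" "\<epsilon> < 1" and lam: "0 < lam"
    and E: "\<And>q. 0 \<le> q \<Longrightarrow> q \<le> \<rho> \<Longrightarrow> E q = noise_limit \<rho> q + lam * q\<^sup>2"
    and y: "\<rho>\<^sup>2 < y" "y < \<rho>" "y < \<rho> powr (1 + \<epsilon>)"
    and \<theta>: "0 < \<theta>" and K: "0 < K"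
    and penalty: "\<rho> * (\<theta> * (K * (\<rho> / (1 - \<rho>)) + exp (3 * (\<theta>\<^sup>2 / \<rho>\<^sup>2)) / K\<^sup>2)) + lam * y\<^sup>2 < \<theta> * y"
    and first_moment: "2 * \<rho> * sqrt (\<rho> * (1 + ln (1 / \<rho>))) + lam * (\<epsilon> * \<rho>)\<^sup>2 < lam * \<rho>\<^sup>2"
  shows "overlap_gap_property \<epsilon> \<rho> E"
proof -
  \<comment> \<open>Chosen so that the continuity error \<open>8 * sqrt \<delta>\<close> equals
    \<open>lam * \<rho> ^ 4\<close>, the signal at \<rho>^2. The signal at \<open>x\<close> is
    strictly larger, which is all the room needed.\<close>
  define \<delta> where "\<delta> = (lam * \<rho> ^ 4 / 8)\<^sup>2"
  have \<delta>: "0 < \<delta>" "8 * sqrt \<delta> = lam * \<rho> ^ 4" using \<rho> lam by (simp_all add: \<delta>_def)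
  \<comment> \<open>The bound by \<open>y - \<rho>\<^sup>2\<close> keeps \<open>x\<close> below
    \<open>y\<close>.\<close>
  obtain \<mu> where \<mu>: "0 < \<mu>" "\<mu> \<le> \<delta>" "\<mu> \<le> y - \<rho>\<^sup>2"
    using that[of "min \<delta> (y - \<rho>\<^sup>2)"] \<delta>(1) y(1) by auto
  define x where "x = \<rho>\<^sup>2 + \<mu> / 2"
  have x: "\<rho>\<^sup>2 < x" "x < y" "\<bar>x - \<rho>\<^sup>2\<bar> < \<delta>" using \<mu> unfolding x_def by linarith+
  have \<rho>2: "0 < \<rho>\<^sup>2" using \<rho> by simp
  have xr: "0 \<le> x" "x \<le> \<rho>" using x y \<rho>2 by linarith+
  have "(\<rho>\<^sup>2)\<^sup>2 < x\<^sup>2" using x(1) \<rho>2 by (intro power_strict_mono) auto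
  then have x4: "lam * \<rho> ^ 4 < lam * x\<^sup>2" using lam by (simp flip: power_mult)
  have Ex: "E x = noise_limit \<rho> x + lam * x\<^sup>2" by (rule E[OF xr])
  have E0: "E 0 < E x"
    using noise_limit_le[OF \<rho> _ _ xr x(3), of 0] E[of 0] \<rho> x4 \<delta>(2) unfolding Ex by simp
  have yr: "0 \<le> y" "y \<le> \<rho>" using y \<rho>2 by linarith+
  have Ey: "E y < E x"
    using noise_limit_penalty[OF \<rho> yr xr x(3) \<theta> K] penalty x4 \<delta>(2) E[OF yr] unfolding Ex by linarith
  let ?B = "2 * \<rho> * sqrt (\<rho> * (1 + ln (1 / \<rho>))) + lam * (\<epsilon> * \<rho>)\<^sup>2"
  have \<epsilon>\<rho>: "\<epsilon> * \<rho> \<le> \<rho>" using \<rho> \<epsilon> by simp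
  have "(SUP q\<in>{0<..\<epsilon> * \<rho>}. ereal (E q)) \<le> ereal ?B"
  proof (rule SUP_least)
    fix q assume q: "q \<in> {0<..\<epsilon> * \<rho>}"
    then have qr: "0 \<le> q" "q \<le> \<rho>" using \<epsilon>\<rho> by auto
    have "q\<^sup>2 \<le> (\<epsilon> * \<rho>)\<^sup>2" using q by (intro power_mono) auto
    then have "lam * q\<^sup>2 \<le> lam * (\<epsilon> * \<rho>)\<^sup>2" using lam by simp
    then show "ereal (E q) \<le> ereal ?B"
      using noise_limit_first_moment[OF \<rho> qr] E[OF qr] by simp
  qed
  also have "ereal ?B < ereal (E \<rho>)"
    using first_moment E[of \<rho>] noise_limit_full_overlap[OF \<rho>] \<rho> by simp
  also have "\<dots> \<le> (SUP q\<in>{\<epsilon> * \<rho>..\<rho>}. ereal (E q))"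
    using \<epsilon>\<rho> by (intro SUP_upper) auto
  finally have sup: "(SUP q\<in>{0<..\<epsilon> * \<rho>}. ereal (E q)) < (SUP q\<in>{\<epsilon> * \<rho>..\<rho>}. ereal (E q))" .
  show ?thesis
    unfolding overlap_gap_property_def
  proof (intro exI conjI)
    show "(0 :: real) \<le> 0" ..
    show "0 < x" by (rule less_trans[OF \<rho>2 x(1)])
    show "max (E 0) (E y) < E x" using E0 Ey by simp
    show "(SUP q\<in>{0<..\<epsilon> * \<rho>}. ereal (E q)) < (SUP q\<in>{\<epsilon> * \<rho>..\<rho>}. ereal (E q))" by (rule sup)
  qed (fact x y \<rho>2)+
qed

text \<open>After removal of the common factor \<open>\<rho> * sqrt \<rho>\<close> the comparison is
  between \<open>2 * sqrt (1 + L)\<close> and \<open>c * sqrt L\<close> for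
  \<open>L = ln (1 / \<rho>)\<close>. As \<open>c\<close> exceeds 2, the additive 1 is absorbed once
  \<open>L\<close> is at least \<open>4 / (c\<^sup>2 - 4)\<close>.\<close>

lemma sqrt_bound_small_sparsity:
  fixes c :: real
  assumes "2 < c"
  shows "eventually (\<lambda>\<rho>. 2 * \<rho> * sqrt (\<rho> * (1 + ln (1 / \<rho>))) \<le> c * sqrt (1 / \<rho> * ln (1 / \<rho>)) * \<rho>\<^sup>2) (at_right 0)"
proof -
  have "filterlim (\<lambda>\<rho>::real. ln (1 / \<rho>)) at_top (at_right 0)" by real_asymp
  then have "eventually (\<lambda>\<rho>. 4 / (c\<^sup>2 - 4) \<le> ln (1 / \<rho>)) (at_right 0)"
    by (rule filterlim_at_top[THEN iffD1, rule_format])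
  with eventually_at_right_less[of 0] show ?thesis
  proof eventually_elim
    case (elim \<rho>)
    have c: "0 < c\<^sup>2 - 4" using power_strict_mono[of 2 c 2] assms by simp
    then have "4 * (1 + ln (1 / \<rho>)) \<le> c\<^sup>2 * ln (1 / \<rho>)"
      using elim(2) by (simp add: pos_divide_le_eq algebra_simps)
    then have "sqrt (4 * (1 + ln (1 / \<rho>))) \<le> sqrt (c\<^sup>2 * ln (1 / \<rho>))" by (rule real_sqrt_le_mono)
    then have "2 * sqrt (1 + ln (1 / \<rho>)) \<le> c * sqrt (ln (1 / \<rho>))"
      using assms unfolding real_sqrt_mult by simp
    then have "\<rho> * sqrt \<rho> * (2 * sqrt (1 + ln (1 / \<rho>))) \<le> \<rho> * sqrt \<rho> * (c * sqrt (ln (1 / \<rho>)))"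
      using elim(1) by (intro mult_left_mono) auto
    moreover have "sqrt (1 / \<rho> * ln (1 / \<rho>)) * \<rho>\<^sup>2 = \<rho> * sqrt \<rho> * sqrt (ln (1 / \<rho>))"
    proof -
      have "sqrt (1 / \<rho>) * \<rho> = sqrt \<rho>" using elim(1) by (simp add: real_sqrt_divide real_div_sqrt)
      then show ?thesis by (simp only: real_sqrt_mult power2_eq_square) (simp add: mult_ac)
    qed
    ultimately show ?case by (simp add: real_sqrt_mult mult_ac)
  qed
qed

text \<open>Everything is measured against \<rho>^(13/5), which is \<theta> y for \<theta> = \<rho>
  and y = \<rho>^(8/5). Both field errors are of order \<rho>^(8/3) at K = \<rho>^(-1/3), leaving
  the spare power 1/15 = 8/3 - 13/5; the signal leaves the spare power 3/5 - \<alpha>.\<close>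

lemma penalty_small_sparsity:
  assumes "\<alpha> < 3 / 5"
  shows "eventually (\<lambda>\<rho>::real. \<rho> * (\<rho> * (\<rho> powr (- (1 / 3)) * (\<rho> / (1 - \<rho>)) + exp (3 * (\<rho>\<^sup>2 / \<rho>\<^sup>2)) / (\<rho> powr (- (1 / 3)))\<^sup>2))
      + (1 / \<rho>) powr \<alpha> * (\<rho> powr (8 / 5))\<^sup>2 < \<rho> * \<rho> powr (8 / 5)) (at_right 0)"
proof -
  have pow: "((\<lambda>\<rho>::real. \<rho> powr \<gamma>) \<longlongrightarrow> 0) (at_right 0)" if "0 < \<gamma>" for \<gamma>
    using that by real_asymp
  have "((\<lambda>\<rho>::real. 2 * \<rho> powr (1 / 15) + exp 3 * \<rho> powr (1 / 15) + \<rho> powr (3 / 5 - \<alpha>)) \<longlongrightarrow> 2 * 0 + exp 3 * 0 + 0) (at_right 0)"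
    using assms by (intro tendsto_intros pow) auto
  then have *: "((\<lambda>\<rho>::real. 2 * \<rho> powr (1 / 15) + exp 3 * \<rho> powr (1 / 15) + \<rho> powr (3 / 5 - \<alpha>)) \<longlongrightarrow> 0) (at_right 0)"
    by simp
  have "eventually (\<lambda>\<rho>::real. 2 * \<rho> powr (1 / 15) + exp 3 * \<rho> powr (1 / 15) + \<rho> powr (3 / 5 - \<alpha>) < 1) (at_right 0)"
    by (rule order_tendstoD[OF *]) simp
  moreover have "eventually (\<lambda>\<rho>::real. \<rho> < 1 / 2) (at_right 0)"
    by (rule order_tendstoD[OF tendsto_ident_at]) simp
  ultimately show ?thesis
    using eventually_at_right_less[of 0]
  proof eventually_elim
    case (elim \<rho>)
    have \<rho>: "0 < \<rho>" "\<rho> < 1 / 2" using elim by auto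
    have split: "\<rho> powr (13 / 5) * \<rho> powr (1 / 15) = \<rho> powr (8 / 3)"
      by (simp only: powr_add[symmetric]) simp
    have t1: "\<rho> * (\<rho> * (\<rho> powr (- (1 / 3)) * (\<rho> / (1 - \<rho>)))) \<le> \<rho> powr (13 / 5) * (2 * \<rho> powr (1 / 15))"
    proof -
      have "\<rho> / (1 - \<rho>) \<le> 2 * \<rho>" using \<rho> by (simp add: pos_divide_le_eq algebra_simps)
      then have "\<rho> * (\<rho> * (\<rho> powr (- (1 / 3)) * (\<rho> / (1 - \<rho>)))) \<le> \<rho> * (\<rho> * (\<rho> powr (- (1 / 3)) * (2 * \<rho>)))"
        using \<rho> by (intro mult_left_mono) auto
      also have "\<dots> = 2 * (\<rho> powr 1 * \<rho> powr 1 * \<rho> powr (- (1 / 3)) * \<rho> powr 1)" using \<rho> by simp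
      also have "\<rho> powr 1 * \<rho> powr 1 * \<rho> powr (- (1 / 3)) * \<rho> powr 1 = \<rho> powr (8 / 3)"
        by (simp only: powr_add[symmetric]) simp
      also have "2 * \<rho> powr (8 / 3) = \<rho> powr (13 / 5) * (2 * \<rho> powr (1 / 15))" unfolding split[symmetric] by simp
      finally show ?thesis .
    qed
    have t2: "\<rho> * (\<rho> * (exp (3 * (\<rho>\<^sup>2 / \<rho>\<^sup>2)) / (\<rho> powr (- (1 / 3)))\<^sup>2)) = \<rho> powr (13 / 5) * (exp 3 * \<rho> powr (1 / 15))"
    proof -
      have sq: "(\<rho> powr (- (1 / 3)))\<^sup>2 = \<rho> powr (- (2 / 3))" by (simp only: power2_eq_square powr_add[symmetric]) simp
      have inv: "exp 3 / \<rho> powr (- (2 / 3)) = exp 3 * \<rho> powr (2 / 3)"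
        by (simp only: powr_minus divide_inverse inverse_inverse_eq)
      have one: "\<rho>\<^sup>2 / \<rho>\<^sup>2 = 1" using \<rho> by simp
      have "\<rho> * (\<rho> * (exp 3 * \<rho> powr (2 / 3))) = exp 3 * (\<rho> powr 1 * \<rho> powr 1 * \<rho> powr (2 / 3))"
        using \<rho> by simp
      then have "\<rho> * (\<rho> * (exp (3 * (\<rho>\<^sup>2 / \<rho>\<^sup>2)) / (\<rho> powr (- (1 / 3)))\<^sup>2)) = exp 3 * (\<rho> powr 1 * \<rho> powr 1 * \<rho> powr (2 / 3))"
        unfolding sq one mult_1_right inv .
      also have "\<rho> powr 1 * \<rho> powr 1 * \<rho> powr (2 / 3) = \<rho> powr (8 / 3)"
        by (simp only: powr_add[symmetric]) simp
      also have "exp 3 * \<rho> powr (8 / 3) = \<rho> powr (13 / 5) * (exp 3 * \<rho> powr (1 / 15))" unfolding split[symmetric] by simp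
      finally show ?thesis .
    qed
    have t3: "(1 / \<rho>) powr \<alpha> * (\<rho> powr (8 / 5))\<^sup>2 = \<rho> powr (13 / 5) * \<rho> powr (3 / 5 - \<alpha>)"
    proof -
      have "(1 / \<rho>) powr \<alpha> = 1 / \<rho> powr \<alpha>" using \<rho> by (simp add: powr_divide)
      also have "\<dots> = \<rho> powr (- \<alpha>)" by (rule powr_minus_divide[symmetric])
      finally have "(1 / \<rho>) powr \<alpha> = \<rho> powr (- \<alpha>)" .
      then have "(1 / \<rho>) powr \<alpha> * (\<rho> powr (8 / 5))\<^sup>2 = \<rho> powr (- \<alpha> + (8 / 5 + 8 / 5))"
        by (simp only: power2_eq_square powr_add)
      also have "- \<alpha> + (8 / 5 + 8 / 5) = 13 / 5 + (3 / 5 - \<alpha>)" by simp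
      finally show ?thesis by (simp only: powr_add)
    qed
    have t4: "\<rho> * \<rho> powr (8 / 5) = \<rho> powr (13 / 5)"
    proof -
      have "\<rho> * \<rho> powr (8 / 5) = \<rho> powr 1 * \<rho> powr (8 / 5)" using \<rho> by simp
      also have "\<dots> = \<rho> powr (13 / 5)" by (simp only: powr_add[symmetric]) simp
      finally show ?thesis .
    qed
    have "\<rho> powr (13 / 5) * (2 * \<rho> powr (1 / 15) + exp 3 * \<rho> powr (1 / 15) + \<rho> powr (3 / 5 - \<alpha>)) < \<rho> powr (13 / 5) * 1"
      using elim(1) \<rho> by (intro mult_strict_left_mono) auto
    then show ?case using t1 t2 t3 t4 unfolding distrib_left by linarith
  qed
qed

theorem theorem1p4:
  fixes \<alpha> C\<^sub>1 :: real
  assumes "\<alpha> < 2 - sqrt 2" and "C\<^sub>1 > 2"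
  shows "\<exists>\<epsilon>>0. \<forall>\<^sub>F \<rho> in at_right 0. \<forall>lam.
           C\<^sub>1 * sqrt (1 / \<rho> * ln (1 / \<rho>)) < lam \<and> lam < (1 / \<rho>) powr \<alpha> \<longrightarrow>
           (\<forall>(M :: 'w measure) W v. planted_submatrix M W v \<rho> lam \<longrightarrow>
              overlap_gap_property \<epsilon> \<rho> (energy M W v \<rho> lam))"
proof -
  \<comment> \<open>The rational bound 3/5 lies above 2 - sqrt 2 and below 2/3, the limit of the
    method. It fixes the exponent 8/5 = 1 + 3/5 of \<open>y\<close>.\<close>
  have "7 / 5 < sqrt (2 :: real)" by (rule real_less_rsqrt) (simp add: power2_eq_square)
  then have \<alpha>: "\<alpha> < 3 / 5" using assms(1) by linarith
  \<comment> \<open>The last condition leaves room for the signal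
    \<open>lam * (\<epsilon> * \<rho>)\<^sup>2\<close> in the comparison with the first moment
    bound. Since 1/2 < 3/5, the second one puts \<rho>^(8/5) below \<rho>^(1 + \<epsilon>).\<close>
  obtain \<epsilon> where \<epsilon>: "0 < \<epsilon>" "\<epsilon> < 1 / 2" "2 < (1 - \<epsilon>\<^sup>2) * C\<^sub>1"
  proof -
    have "((\<lambda>\<epsilon>. (1 - \<epsilon>\<^sup>2) * C\<^sub>1) \<longlongrightarrow> (1 - 0\<^sup>2) * C\<^sub>1) (at_right 0)" by (intro tendsto_intros)
    then have "eventually (\<lambda>\<epsilon>. 2 < (1 - \<epsilon>\<^sup>2) * C\<^sub>1) (at_right 0)"
      by (rule order_tendstoD) (use assms(2) in simp)
    moreover have "eventually (\<lambda>\<epsilon>::real. \<epsilon> < 1 / 2) (at_right 0)"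
      by (rule order_tendstoD[OF tendsto_ident_at]) simp
    ultimately have "eventually (\<lambda>\<epsilon>. 0 < \<epsilon> \<and> \<epsilon> < 1 / 2 \<and> 2 < (1 - \<epsilon>\<^sup>2) * C\<^sub>1) (at_right 0)"
      using eventually_at_right_less[of 0] by eventually_elim simp
    from eventually_happens[OF this] that show ?thesis by auto
  qed
  have small: "eventually (\<lambda>\<rho>::real. \<rho> < 1 / 2) (at_right 0)"
    by (rule order_tendstoD[OF tendsto_ident_at]) simp
  have "\<forall>\<^sub>F \<rho> in at_right 0. \<forall>lam.
           C\<^sub>1 * sqrt (1 / \<rho> * ln (1 / \<rho>)) < lam \<and> lam < (1 / \<rho>) powr \<alpha> \<longrightarrow>
           (\<forall>(M :: 'w measure) W v. planted_submatrix M W v \<rho> lam \<longrightarrow>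
              overlap_gap_property \<epsilon> \<rho> (energy M W v \<rho> lam))"
    using sqrt_bound_small_sparsity[OF \<epsilon>(3)] penalty_small_sparsity[OF \<alpha>] small eventually_at_right_less[of 0]
  proof eventually_elim
    case (elim \<rho>)
    have \<rho>: "0 < \<rho>" "\<rho> < 1 / 2" using elim by auto
    show ?case
    proof (intro allI impI)
      fix lam :: real and M :: "'w measure" and W v
      assume lam: "C\<^sub>1 * sqrt (1 / \<rho> * ln (1 / \<rho>)) < lam \<and> lam < (1 / \<rho>) powr \<alpha>"
        and "planted_submatrix M W v \<rho> lam"
      then interpret planted_submatrix M W v \<rho> lam by simp
      show "overlap_gap_property \<epsilon> \<rho> (energy M W v \<rho> lam)"
      proof (rule overlap_gap_propertyI[where y = "\<rho> powr (8 / 5)" and \<theta> = \<rho> and K = "\<rho> powr (- (1 / 3))"])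
        show "energy M W v \<rho> lam q = noise_limit \<rho> q + lam * q\<^sup>2" if "0 \<le> q" "q \<le> \<rho>" for q
          using that by (intro energy_eq \<rho>)
        have "\<rho> powr 2 < \<rho> powr (8 / 5)" "\<rho> powr (8 / 5) < \<rho> powr 1" "\<rho> powr (8 / 5) < \<rho> powr (1 + \<epsilon>)"
          using \<rho> \<epsilon> by (intro powr_less_mono'; simp)+
        then show "\<rho>\<^sup>2 < \<rho> powr (8 / 5)" "\<rho> powr (8 / 5) < \<rho>" "\<rho> powr (8 / 5) < \<rho> powr (1 + \<epsilon>)"
          using \<rho> by (simp_all add: powr_numeral)
        have "lam * (\<rho> powr (8 / 5))\<^sup>2 \<le> (1 / \<rho>) powr \<alpha> * (\<rho> powr (8 / 5))\<^sup>2"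
          using lam by (intro mult_right_mono) auto
        then show "\<rho> * (\<rho> * (\<rho> powr (- (1 / 3)) * (\<rho> / (1 - \<rho>)) + exp (3 * (\<rho>\<^sup>2 / \<rho>\<^sup>2)) / (\<rho> powr (- (1 / 3)))\<^sup>2))
          + lam * (\<rho> powr (8 / 5))\<^sup>2 < \<rho> * \<rho> powr (8 / 5)"
          using elim(2) by linarith
        have \<epsilon>1: "0 < (1 - \<epsilon>\<^sup>2) * \<rho>\<^sup>2" using \<epsilon> \<rho> power_strict_mono[of \<epsilon> 1 2] by simp
        have "2 * \<rho> * sqrt (\<rho> * (1 + ln (1 / \<rho>))) \<le> (1 - \<epsilon>\<^sup>2) * \<rho>\<^sup>2 * (C\<^sub>1 * sqrt (1 / \<rho> * ln (1 / \<rho>)))"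
          using elim(1) by (simp only: mult_ac)
        also have "\<dots> < (1 - \<epsilon>\<^sup>2) * \<rho>\<^sup>2 * lam"
          using lam \<epsilon>1 by (intro mult_strict_left_mono) auto
        finally show "2 * \<rho> * sqrt (\<rho> * (1 + ln (1 / \<rho>))) + lam * (\<epsilon> * \<rho>)\<^sup>2 < lam * \<rho>\<^sup>2"
          by (simp add: algebra_simps power_mult_distrib)
      qed (use \<rho> \<epsilon> snr in auto)
    qed
  qed
  with \<epsilon>(1) show ?thesis by blast
qed

end
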